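(* Let $f:\mathbb C\to\hat{\mathbb C}$ be a meromorphic function of finite order $\rho$ with non-empty Fatou set satisfying the rapid derivative growth condition with exponents $\alpha_1,\alpha_2$, and put $\alpha=\alpha_1+\alpha_2$. Then for every $t>\rho/\alpha$ there exists a Borel probability $e^{P(t)}|f'|_\sigma^t$-conformal measure $m_t$ on $J(f)$.
   Context: Meromorphic functions $f:\mathbb C\to\hat{\mathbb C}$ are transcendental; no hyperbolicity is assumed. $J(f)$ denotes the Julia set of $f$ intersected with $\mathbb C$. Normalization: since the Fatou set is non-empty, after conjugating by a translation one assumes that $0$ lies in the Fatou set, so $0\notin J(f)$. Rapid derivative growth (in the form valid under this normalization): there are $\alpha_2>0$, $\alpha_1>-\alpha_2$ and $\kappa>0$ with $|f'(z)|\ge\kappa^{-1}|z|^{\alpha_1}|f(z)|^{\alpha_2}$ for all $z\in J(f)\setminus f^{-1}(\infty)$. The metric is $d\sigma(z)=|z|^{-\alpha_2}|dz|$, the derivative with respect to it is $|f'(z)|_\sigma=|f'(z)||z|^{\alpha_2}|f(z)|^{-\alpha_2}$, and the transfer operator is $\mathcal L_t\varphi(w)=\sum_{z\in f^{-1}(w)}|f'(z)|_\sigma^{-t}\varphi(z)$ for $w\in J(f)$. The topological pressure is $P(t)=P(t,x)=\limsup_{n\to\infty}\frac1n\log\mathcal L_t^n1(x)$, where $x\in J(f)$ is a fixed point of the Julia set. A Borel probability measure $m_t$ on $J(f)$ is $e^{P(t)}|f'|_\sigma^t$-conformal if $\frac{dm_t\circ f}{dm_t}=e^{P(t)}|f'|_\sigma^t$,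 i.e. $m_t(f(A))=\int_Ae^{P(t)}|f'|_\sigma^t\,dm_t$ for every Borel set $A\subset J(f)$ on which $f$ is (finite and) injective; equivalently, $\mathcal L_t^*m_t=e^{P(t)}m_t$. *)

theory Defs
  imports "HOL-Complex_Analysis.Complex_Analysis" "HOL-Probability.Probability"
begin

text \<open>
  A meromorphic function from the plane to the Riemann sphere is represented by a function that is
  nicely meromorphic on \<open>UNIV\<close>: it takes the value \<infinity> exactly at its poles, where the
  HOL function has the dummy value 0, and it has no removable singularities. Every definition below
  therefore treats the poles explicitly.
\<close>

definition transcendental_meromorphic :: "(complex \<Rightarrow> complex) \<Rightarrow> bool" where
  "transcendental_meromorphic f \<longleftrightarrow>
     f nicely_meromorphic_on UNIV \<and>
     \<not> (\<exists>p q :: complex poly. q \<noteq> 0 \<and>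
          (\<forall>z. poly q z \<noteq> 0 \<longrightarrow> f z = poly p z / poly q z))"


subsection \<open>Nevanlinna characteristic and order of growth\<close>

definition pole_count :: "(complex \<Rightarrow> complex) \<Rightarrow> real \<Rightarrow> nat" where
  "pole_count f r = (\<Sum>z | norm z \<le> r \<and> is_pole f z. nat (- zorder f z))"

definition proximity_fun :: "(complex \<Rightarrow> complex) \<Rightarrow> real \<Rightarrow> real" where
  "proximity_fun f r =
     1 / (2 * pi) * integral {0..2 * pi} (\<lambda>\<theta>. max 0 (ln (norm (f (of_real r * cis \<theta>)))))"

definition counting_fun :: "(complex \<Rightarrow> complex) \<Rightarrow> real \<Rightarrow> real" where
  "counting_fun f r =
     integral {0..r} (\<lambda>s. (real (pole_count f s) - real (pole_count f 0)) / s)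
     + real (pole_count f 0) * ln r"

definition nevanlinna_char :: "(complex \<Rightarrow> complex) \<Rightarrow> real \<Rightarrow> real" where
  "nevanlinna_char f r = proximity_fun f r + counting_fun f r"

definition order_of_growth :: "(complex \<Rightarrow> complex) \<Rightarrow> ereal" where
  "order_of_growth f = Limsup at_top (\<lambda>r. ereal (ln (nevanlinna_char f r) / ln r))"


subsection \<open>Fatou and Julia sets\<close>

text \<open>
  Inverse stereographic projection onto the unit sphere of \<open>complex \<times> real\<close>, with
  \<infinity> corresponding to \<open>(0, 1)\<close>. The distance of two images is the chordal distance, so
  that the limit functions below may take the value \<infinity>.
\<close>

definition to_sphere :: "complex \<Rightarrow> complex \<times> real" where
  "to_sphere z = (2 * z / of_real (1 + (norm z)\<^sup>2), ((norm z)\<^sup>2 - 1) / ((norm z)\<^sup>2 + 1))"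

definition normal_family_on :: "complex set \<Rightarrow> (complex \<Rightarrow> complex) set \<Rightarrow> bool" where
  "normal_family_on U \<F> \<longleftrightarrow>
     (\<forall>h :: nat \<Rightarrow> complex \<Rightarrow> complex. range h \<subseteq> \<F> \<longrightarrow>
        (\<exists>r g. strict_mono r \<and>
           (\<forall>K. compact K \<and> K \<subseteq> U \<longrightarrow>
              uniform_limit K (\<lambda>k z. to_sphere (h (r k) z)) g sequentially)))"

text \<open>
  For a transcendental meromorphic function, all iterates are defined on \<open>U\<close> iff no orbit
  starting in \<open>U\<close> hits a pole, because \<infinity> is an essential singularity. Both sets are
  taken within the finite plane.
\<close>

definition fatou_set :: "(complex \<Rightarrow> complex) \<Rightarrow> complex set" where
  "fatou_set f = {z. \<exists>U. open U \<and> z \<in> U \<and>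
     (\<forall>n. \<forall>w\<in>U. \<not> is_pole f ((f ^^ n) w)) \<and>
     normal_family_on U (range (\<lambda>n. f ^^ n))}"

definition julia_set :: "(complex \<Rightarrow> complex) \<Rightarrow> complex set" where
  "julia_set f = - fatou_set f"


subsection \<open>Rapid derivative growth, transfer operator and pressure\<close>

text \<open>
  The powers of \<open>norm z\<close> and \<open>norm (f z)\<close> are meaningful under the normalization
  \<open>0 \<in> fatou_set f\<close>: then \<open>z\<close> and \<open>f z\<close> are nonzero whenever \<open>z\<close> is a point of
  the Julia set that is not a pole.
\<close>

definition rapid_derivative_growth :: "(complex \<Rightarrow> complex) \<Rightarrow> real \<Rightarrow> real \<Rightarrow> bool" where
  "rapid_derivative_growth f \<alpha>1 \<alpha>2 \<longleftrightarrow>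
     \<alpha>2 > 0 \<and> \<alpha>1 > - \<alpha>2 \<and>
     (\<exists>\<kappa>>0. \<forall>z\<in>julia_set f. \<not> is_pole f z \<longrightarrow>
        norm (deriv f z) \<ge> inverse \<kappa> * norm z powr \<alpha>1 * norm (f z) powr \<alpha>2)"

definition sigma_deriv :: "(complex \<Rightarrow> complex) \<Rightarrow> real \<Rightarrow> complex \<Rightarrow> real" where
  "sigma_deriv f \<alpha>2 z = norm (deriv f z) * norm z powr \<alpha>2 * norm (f z) powr (- \<alpha>2)"

definition transfer_op ::
  "(complex \<Rightarrow> complex) \<Rightarrow> real \<Rightarrow> real \<Rightarrow> (complex \<Rightarrow> ennreal) \<Rightarrow> complex \<Rightarrow> ennreal" where
  "transfer_op f \<alpha>2 t \<phi> w =
     (\<Sum>\<^sub>\<infinity>z\<in>{z. \<not> is_pole f z \<and> f z = w}. ennreal (sigma_deriv f \<alpha>2 z powr (- t)) * \<phi> z)"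

text \<open>
  The pressure is extended-real valued: it is -\<infinity> when the iterated preimages of the base
  point run out at an omitted value. The conventions are \<open>ln 0 = -\<infinity>\<close> and
  \<open>exp (-\<infinity>) = 0\<close>.
\<close>

definition ext_ln :: "ennreal \<Rightarrow> ereal" where
  "ext_ln x = (if x = 0 then -\<infinity> else if x = \<infinity> then \<infinity> else ereal (ln (enn2real x)))"

definition ext_exp :: "ereal \<Rightarrow> ennreal" where
  "ext_exp p = (case p of ereal r \<Rightarrow> ennreal (exp r) | PInfty \<Rightarrow> \<infinity> | MInfty \<Rightarrow> 0)"

definition pressure :: "(complex \<Rightarrow> complex) \<Rightarrow> real \<Rightarrow> real \<Rightarrow> complex \<Rightarrow> ereal" where
  "pressure f \<alpha>2 t x =
     limsup (\<lambda>n. ereal (1 / real n) * ext_ln ((transfer_op f \<alpha>2 t ^^ n) (\<lambda>_. 1) x))"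


subsection \<open>Conformal measures\<close>

definition borel_prob_on :: "complex set \<Rightarrow> complex measure \<Rightarrow> bool" where
  "borel_prob_on J m \<longleftrightarrow> prob_space m \<and> sets m = sets (restrict_space borel J)"

definition conformal_measure ::
  "(complex \<Rightarrow> complex) \<Rightarrow> (complex \<Rightarrow> ennreal) \<Rightarrow> complex measure \<Rightarrow> bool" where
  "conformal_measure f g m \<longleftrightarrow>
     (\<forall>A\<in>sets m. (\<forall>z\<in>A. \<not> is_pole f z) \<and> inj_on f A \<longrightarrow>
        emeasure m (f ` A) = (\<integral>\<^sup>+z\<in>A. g z \<partial>m))"

end

theory Submission
  imports Defs
begin

text \<open>
  Write \<open>L\<close> for the transfer operator at \<open>t\<close>, \<open>\<sigma>\<close> for the derivative in the conformal metric and
  \<open>p\<close> for the pressure. Rapid derivative growth gives \<open>\<sigma>(z) \<ge> |z|^\<alpha> / \<kappa>\<close> on the Julia set, and the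
  first main theorem of Nevanlinna theory bounds the number of preimages of a point of the Julia set
  in a disc of radius \<open>r\<close> by \<open>C r^q\<close> for every \<open>q > \<rho>\<close>, uniformly in the point, because the Julia
  set stays away from \<open>f 0\<close>. Since \<open>\<alpha> t > \<rho>\<close>, the function \<open>L 1\<close> is bounded and its part coming from
  preimages outside a large disc is uniformly small.

  If \<open>p\<close> is finite, normalized weighted sums of the measures \<open>L*^n \<delta>_x\<close> are almost eigenmeasures of
  \<open>L*\<close>. They are tight by the uniform smallness, and a weak limit \<open>m\<close> satisfies \<open>L* m = e^p m\<close> on test
  functions supported where \<open>f\<close> is injective, which is conformality. There are no critical points in
  the Julia set.

  The pressure is \<open>-\<infinity>\<close> only if some point of the Julia set is an omitted value, and then the point
  mass there is conformal. Otherwise there is a disc such that each of its Julia points has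
  a preimage in the disc, so that \<open>L^n 1 (x)\<close> decays at most exponentially. Near a pole all large
  values are taken; for entire \<open>f\<close> of finite order the disc comes from the Taylor coefficients of the
  logarithms of \<open>f - w\<close>.
\<close>


subsection \<open>Jensen's formula\<close>

text \<open>Two difficulties come from the Julia set not being compact. Mass could escape to
  infinity in the limit; the dual inequality, tested on
  \<open>indicator {z. R \<le> norm z}\<close>, turns the tail bound of the operator into tightness.
  And continuity of \<open>L 1\<close>, or of \<open>L \<phi>\<close> for general \<phi>, is not at
  hand, so the limit is tested only on \<phi> for which \<open>L \<phi>\<close> agrees on the Julia
  set with a known continuous function. Bumps inside a disc of injectivity suffice, because
  conformality is a local property that a countable decomposition carries to all Borel sets.

  Weak compactness in the plane is reduced to Helly's selection theorem on the line. A discrete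
  measure can be lifted along any section of a continuous curve filling the plane, measurable or
  not, and the limit is pushed down by the curve.

  A pressure above minus infinity needs a backward orbit along which \<sigma> stays bounded. This is
  what a disc whose Julia points have preimages in the same disc provides; an entire function has no
  pole to produce such a disc, so growth must be used.\<close>

lemma has_integral_circle_holomorphic:
  fixes h :: "complex \<Rightarrow> complex"
  assumes "h holomorphic_on ball 0 R" "0 < r" "r < R"
  shows "((\<lambda>\<theta>. h (of_real r * cis \<theta>) * cis (- (of_nat n * \<theta>))) has_integral
           2 * pi * ((deriv ^^ n) h 0 / fact n * of_real r ^ n)) {0..2 * pi}"
proof -
  have sub: "cball 0 r \<subseteq> ball (0::complex) R" using assms by auto
  have "((\<lambda>u. h u / (u - 0) ^ Suc n) has_contour_integral ((2 * pi * \<i>) / fact n * (deriv ^^ n) h 0))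
          (circlepath 0 r)"
    using assms sub ball_subset_cball[of 0 r]
    by (intro Cauchy_has_contour_integral_higher_derivative_circlepath)
       (auto intro!: holomorphic_on_imp_continuous_on intro: holomorphic_on_subset)
  then have "((\<lambda>t. h (0 + r * cis t) / (0 + r * cis t - 0) ^ Suc n * r * \<i> * cis t) has_integral
               ((2 * pi * \<i>) / fact n * (deriv ^^ n) h 0)) {0..2*pi}"
    unfolding circlepath_def by (subst (asm) has_contour_integral_part_circlepath_iff) auto
  then have *: "((\<lambda>t. (of_real r ^ n / \<i>) * (h (0 + r * cis t) / (0 + r * cis t - 0) ^ Suc n * r * \<i> * cis t)) has_integral
               (of_real r ^ n / \<i>) * ((2 * pi * \<i>) / fact n * (deriv ^^ n) h 0)) {0..2*pi}"
    by (rule has_integral_mult_right)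
  have "(of_real r ^ n / \<i>) * (h (0 + r * cis t) / (0 + r * cis t - 0) ^ Suc n * r * \<i> * cis t)
         = h (of_real r * cis t) * cis (- (of_nat n * t))" for t
  proof -
    have "cis (- (of_nat n * t)) = inverse (cis t ^ n)"
      by (simp add: Complex.DeMoivre cis_inverse)
    moreover have "cis t \<noteq> 0" by simp
    ultimately show ?thesis using assms by (simp add: field_simps power_mult_distrib)
  qed
  moreover have "(of_real r ^ n / \<i>) * ((2 * pi * \<i>) / fact n * (deriv ^^ n) h 0)
      = 2 * pi * ((deriv ^^ n) h 0 / fact n * of_real r ^ n)"
    by (simp add: field_simps)
  ultimately show ?thesis using * by simp
qed

text \<open>The Fourier coefficients of the opposite sign vanish by Cauchy's theorem for
  \<open>h u * u ^ (n - 1)\<close>. With the previous formula, this lets Taylor coefficients be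
  computed from \<open>Re h\<close> alone.\<close>

lemma has_integral_circle_holomorphic_cis:
  fixes h :: "complex \<Rightarrow> complex"
  assumes "h holomorphic_on ball 0 R" "0 < r" "r < R" "0 < n"
  shows "((\<lambda>\<theta>. h (of_real r * cis \<theta>) * cis (of_nat n * \<theta>)) has_integral 0) {0..2 * pi}"
proof -
  obtain m where m: "n = Suc m" using assms by (cases n) auto
  have "((\<lambda>u. h u * u ^ m) has_contour_integral 0) (circlepath 0 r)"
    using assms by (intro Cauchy_theorem_disc_simple[where e=R and a=0] holomorphic_intros) (auto simp: path_image_circlepath)
  then have "((\<lambda>t. h (0 + r * cis t) * (0 + r * cis t) ^ m * r * \<i> * cis t) has_integral 0) {0..2*pi}"
    unfolding circlepath_def by (subst (asm) has_contour_integral_part_circlepath_iff) auto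
  then have *: "((\<lambda>t. (1 / (\<i> * of_real r ^ n)) * (h (0 + r * cis t) * (0 + r * cis t) ^ m * r * \<i> * cis t)) has_integral
      (1 / (\<i> * of_real r ^ n)) * 0) {0..2*pi}"
    by (rule has_integral_mult_right)
  have "(1 / (\<i> * of_real r ^ n)) * (h (0 + r * cis t) * (0 + r * cis t) ^ m * r * \<i> * cis t)
      = h (of_real r * cis t) * cis (of_nat n * t)" for t
  proof -
    have "cis (of_nat n * t) = cis t ^ n"
      by (simp add: Complex.DeMoivre)
    then show ?thesis using assms by (simp add: m field_simps power_mult_distrib)
  qed
  then show ?thesis using * by simp
qed

text \<open>A holomorphic logarithm exists on the disc, so the integrand is a real part and the mean
  value property applies.\<close>

lemma has_integral_ln_norm_nonvanishing:
  assumes "G holomorphic_on ball 0 R" "0 < r" "r < R" "\<And>z. z \<in> ball 0 R \<Longrightarrow> G z \<noteq> 0"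
  shows "((\<lambda>\<theta>. ln (norm (G (of_real r * cis \<theta>)))) has_integral 2 * pi * ln (norm (G 0))) {0..2 * pi}"
proof -
  obtain h where h: "h holomorphic_on ball 0 R" "\<And>x. x \<in> ball 0 R \<Longrightarrow> exp (h x) = G x"
    using holomorphic_logarithm_exists[of "ball 0 R" G 0] assms by (metis convex_ball open_ball centre_in_ball order_less_trans)
  have ln: "ln (norm (G z)) = Re (h z)" if "z \<in> ball 0 R" for z
    using h(2)[OF that] by (metis norm_exp_eq_Re ln_exp)
  have "((\<lambda>\<theta>. h (of_real r * cis \<theta>)) has_integral 2 * pi * h 0) {0..2 * pi}"
    using has_integral_circle_holomorphic[OF h(1) assms(2,3), of 0] by simp
  from has_integral_Re[OF this] have "((\<lambda>\<theta>. Re (h (of_real r * cis \<theta>))) has_integral 2 * pi * Re (h 0)) {0..2 * pi}"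
    by simp
  then show ?thesis
    using assms by (subst ln) (auto simp: ln norm_mult)
qed

text \<open>On the circle, \<open>z - a\<close> has the same modulus as the reflected factor
  \<open>r - cnj a * z / r\<close>, which has no zero on a larger disc and takes the value
  \<open>r\<close> at 0.\<close>

lemma has_integral_ln_norm_diff:
  assumes "norm a < r"
  shows "((\<lambda>\<theta>. ln (norm (of_real r * cis \<theta> - a))) has_integral 2 * pi * ln r) {0..2 * pi}"
proof -
  have r: "r > 0" using assms norm_ge_zero[of a] by linarith
  \<comment> \<open>The only zero of the reflected factor has modulus
    \<open>r\<^sup>2 / norm a\<close>; for \<open>a = 0\<close> the factor is constant and any
    larger radius will do.\<close>
  define R where "R = (if a = 0 then r + 1 else r\<^sup>2 / norm a)"
  have R: "r < R" using assms r by (auto simp: R_def field_simps power2_eq_square)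
  let ?G = "\<lambda>z. of_real r - cnj a * z / of_real r"
  have "((\<lambda>\<theta>. ln (norm (?G (of_real r * cis \<theta>)))) has_integral 2 * pi * ln (norm (?G 0))) {0..2 * pi}"
  proof (rule has_integral_ln_norm_nonvanishing)
    fix z :: complex assume z: "z \<in> ball 0 R"
    show "?G z \<noteq> 0"
    proof
      assume "?G z = 0"
      then have "of_real r * of_real r = cnj a * z" using r by (simp add: field_simps)
      then have "norm (complex_of_real r * of_real r) = norm (cnj a * z)" by simp
      then have e: "r\<^sup>2 = norm a * norm z" using r by (simp add: norm_mult power2_eq_square)
      then have "a \<noteq> 0" using r by auto
      then have "norm a * norm z < r\<^sup>2" using z by (auto simp: R_def field_simps)
      with e show False by simp
    qed
  qed (use r R in \<open>auto intro!: holomorphic_intros\<close>)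
  moreover have "norm (?G (of_real r * cis \<theta>)) = norm (of_real r * cis \<theta> - a)" for \<theta>
  proof -
    have "norm (?G (of_real r * cis \<theta>)) = norm (cnj (of_real r - cnj a * cis \<theta>))"
      using r by (subst complex_mod_cnj) simp
    also have "\<dots> = norm (cis \<theta> * (of_real r - a * cis (-\<theta>)))"
      by (simp add: norm_mult cis_cnj)
    also have "cis \<theta> * (of_real r - a * cis (-\<theta>)) = of_real r * cis \<theta> - a"
      by (simp add: algebra_simps cis_mult flip: cis_inverse)
    finally show ?thesis .
  qed
  ultimately show ?thesis using r by simp
qed

text \<open>The induction step of Jensen's formula: a zero is divided out with its full multiplicity
  and the other orders do not change. At \<open>a\<close> the quotient takes the value of
  \<open>zor_poly\<close>, which removes the singularity.\<close>

lemma holomorphic_factor_zorder: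
  assumes F: "F holomorphic_on A" "open A" "connected A" "a \<in> A" "\<exists>w\<in>A. F w \<noteq> 0"
  obtains G where "G holomorphic_on A" "\<And>z. z \<in> A \<Longrightarrow> F z = (z - a) ^ nat (zorder F a) * G z" "G a \<noteq> 0"
    "\<And>b. b \<in> A \<Longrightarrow> b \<noteq> a \<Longrightarrow> zorder G b = zorder F b"
proof -
  define n where "n = nat (zorder F a)"
  define G where "G z = (if z = a then zor_poly F a a else F z / (z - a) ^ n)" for z
  obtain r where r: "r > 0" "cball a r \<subseteq> A" "zor_poly F a holomorphic_on cball a r"
      "\<And>w. w \<in> cball a r \<Longrightarrow> F w = zor_poly F a w * (w - a) ^ n \<and> zor_poly F a w \<noteq> 0"
    using zorder_exist_zero[OF F] unfolding n_def by blast
  have "G holomorphic_on ball a r"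
    using r by (subst holomorphic_cong[OF refl, of _ _ "zor_poly F a"])
       (auto simp: G_def intro: holomorphic_on_subset)
  moreover have "G holomorphic_on (A - {a})"
    by (subst holomorphic_cong[OF refl, of _ _ "\<lambda>z. F z / (z - a) ^ n"])
       (auto simp: G_def intro!: holomorphic_intros holomorphic_on_subset[OF F(1)])
  ultimately have "G holomorphic_on (ball a r \<union> (A - {a}))"
    using F by (subst holomorphic_on_Un) (auto intro: open_delete)
  then have 1: "G holomorphic_on A"
    by (rule holomorphic_on_subset) (use r in auto)
  have 2: "F z = (z - a) ^ n * G z" if "z \<in> A" for z
    using r(4)[of a] r(1) by (auto simp: G_def)
  have 3: "G a \<noteq> 0" using r(1) r(4)[of a] by (auto simp: G_def)
  have 4: "zorder G b = zorder F b" if b: "b \<in> A" "b \<noteq> a" for b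
  proof -
    have ex: "\<exists>w\<in>A. G w \<noteq> 0" using 3 F(4) by blast
    obtain r' where r': "r' > 0" "cball b r' \<subseteq> A" "zor_poly G b holomorphic_on cball b r'"
      "\<And>w. w \<in> cball b r' \<Longrightarrow> G w = zor_poly G b w * (w - b) ^ nat (zorder G b) \<and> zor_poly G b w \<noteq> 0"
      using zorder_exist_zero[OF 1 F(2,3) b(1) ex] by blast
    have pos: "zorder G b \<ge> 0"
      using zorder_exist_zero[OF 1 F(2,3) b(1) ex, THEN conjunct1] by (simp split: if_splits)
    have "zorder F b = zorder G b"
    proof (rule zorder_eqI[where g = "\<lambda>z. (z - a) ^ n * zor_poly G b z" and S = "ball b r'"])
      show "(\<lambda>z. (z - a) ^ n * zor_poly G b z) holomorphic_on ball b r'"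
        using r' by (intro holomorphic_intros) (auto intro: holomorphic_on_subset)
      show "F w = (w - a) ^ n * zor_poly G b w * (w - b) powi zorder G b" if "w \<in> ball b r'" "w \<noteq> b" for w
      proof -
        have w: "w \<in> cball b r'" "w \<in> A" using that r' by auto
        have "F w = (w - a) ^ n * G w" using 2 w by simp
        also have "G w = zor_poly G b w * (w - b) ^ nat (zorder G b)" using r'(4) w by blast
        also have "(w - b) ^ nat (zorder G b) = (w - b) powi zorder G b"
          using pos by (simp add: power_int_def)
        finally show ?thesis by simp
      qed
    qed (use r' b r'(4)[of b] in auto)
    then show ?thesis by simp
  qed
  show thesis using that[of G] 1 2 3 4 unfolding n_def by blast
qed

lemma Jensen_formula_holomorphic:
  assumes "finite S"
  shows "F holomorphic_on ball 0 R \<Longrightarrow> 0 < r \<Longrightarrow> r < R \<Longrightarrow> F 0 \<noteq> 0 \<Longrightarrow> S \<subseteq> ball 0 r \<Longrightarrow>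
    {z \<in> ball 0 R. F z = 0} = S \<Longrightarrow>
    ((\<lambda>\<theta>. ln (norm (F (of_real r * cis \<theta>)))) has_integral
      2 * pi * (ln (norm (F 0)) + (\<Sum>a\<in>S. of_int (zorder F a) * ln (r / norm a)))) {0..2 * pi}"
  using assms
proof (induction S arbitrary: F)
  case empty
  then show ?case using has_integral_ln_norm_nonvanishing[of F R r] by auto
next
  case (insert a S F)
  have a: "a \<in> ball 0 R" "F a = 0" "norm a < r" "a \<noteq> 0"
    using insert.prems by auto
  have ex: "\<exists>w\<in>ball 0 R. F w \<noteq> 0" using insert.prems by (intro bexI[of _ 0]) auto
  obtain G where G: "G holomorphic_on ball 0 R"
      "\<And>z. z \<in> ball 0 R \<Longrightarrow> F z = (z - a) ^ nat (zorder F a) * G z" "G a \<noteq> 0"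
      "\<And>b. b \<in> ball 0 R \<Longrightarrow> b \<noteq> a \<Longrightarrow> zorder G b = zorder F b"
    using holomorphic_factor_zorder[OF insert.prems(1) open_ball connected_ball a(1) ex] by blast
  define n where "n = nat (zorder F a)"
  have pos: "zorder F a > 0"
    using zorder_exist_zero[OF insert.prems(1) open_ball connected_ball a(1) ex, THEN conjunct1] a(2) by simp
  then have npos: "n > 0" by (simp add: n_def)
  have zG: "{z \<in> ball 0 R. G z = 0} = S"
  proof -
    have "F z = 0 \<longleftrightarrow> z = a \<or> G z = 0" if "z \<in> ball 0 R" for z
      by (subst G(2)[OF that, folded n_def]) (use npos in auto)
    then have "{z \<in> ball 0 R. F z = 0} = {z \<in> ball 0 R. z = a \<or> G z = 0}" by blast
    then show ?thesis using insert.prems(6) G(3) insert.hyps a by auto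
  qed
  have F0: "F 0 = (0 - a) ^ n * G 0" using G(2)[of 0] insert.prems by (simp add: n_def)
  then have G0: "G 0 \<noteq> 0" using insert.prems by auto
  have IH: "((\<lambda>\<theta>. ln (norm (G (of_real r * cis \<theta>)))) has_integral
      2 * pi * (ln (norm (G 0)) + (\<Sum>a\<in>S. of_int (zorder G a) * ln (r / norm a)))) {0..2 * pi}"
    using insert.prems zG G0 G(1) by (intro insert.IH) auto
  have "((\<lambda>\<theta>. real n * ln (norm (of_real r * cis \<theta> - a)) + ln (norm (G (of_real r * cis \<theta>)))) has_integral
      real n * (2 * pi * ln r) + 2 * pi * (ln (norm (G 0)) + (\<Sum>a\<in>S. of_int (zorder G a) * ln (r / norm a)))) {0..2 * pi}"
    by (intro has_integral_add has_integral_mult_right IH has_integral_ln_norm_diff a)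
  moreover have "real n * ln (norm (of_real r * cis \<theta> - a)) + ln (norm (G (of_real r * cis \<theta>)))
       = ln (norm (F (of_real r * cis \<theta>)))" for \<theta>
  proof -
    let ?z = "of_real r * cis \<theta>"
    have z: "norm ?z = r" using insert.prems(2) by (simp add: norm_mult)
    have zz: "?z \<in> ball 0 R" using z insert.prems(3) by simp
    have "?z \<notin> ball 0 r" using z by simp
    then have "?z \<notin> insert a S" using insert.prems(5) by blast
    then have "?z - a \<noteq> 0" "G ?z \<noteq> 0" using zG zz by auto
    moreover have "F ?z = (?z - a) ^ n * G ?z" using G(2) zz unfolding n_def by blast
    ultimately show ?thesis by (simp add: norm_mult norm_power ln_mult ln_realpow)
  qed
  \<comment> \<open>The mean \<open>n * ln r\<close> of the removed factor splits into
    \<open>n * ln (r / norm a)\<close>, the new term of the sum, and \<open>n * ln (norm a)\<close>,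
    which completes \<open>ln (norm (G 0))\<close> to \<open>ln (norm (F 0))\<close>.\<close>
  moreover have "real n * (2 * pi * ln r) + 2 * pi * (ln (norm (G 0)) + (\<Sum>a\<in>S. of_int (zorder G a) * ln (r / norm a)))
     = 2 * pi * (ln (norm (F 0)) + (\<Sum>a\<in>insert a S. of_int (zorder F a) * ln (r / norm a)))"
  proof -
    have "ln (norm (F 0)) = real n * ln (norm a) + ln (norm (G 0))"
      using F0 G0 a by (simp add: norm_mult norm_power ln_mult ln_realpow)
    moreover have "(\<Sum>a\<in>S. of_int (zorder G a) * ln (r / norm a)) = (\<Sum>a\<in>S. of_int (zorder F a) * ln (r / norm a))"
      using G(4) zG insert.hyps by (intro sum.cong) auto
    moreover have "real_of_int (zorder F a) = real n" using pos by (simp add: n_def)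
    moreover have "ln r = ln (r / norm a) + ln (norm a)" using a insert.prems(2) by (simp add: ln_div)
    ultimately show ?thesis using insert.hyps by (simp only: sum.insert) (simp add: algebra_simps)
  qed
  ultimately show ?case by (simp only:)
qed


subsection \<open>Weak limits of tight discrete measures in the plane\<close>

text \<open>The digit-reading function of Schoenberg's curve: 0 on \<open>[0, 1/3]\<close>, 1 on
  \<open>[2/3, 1]\<close>, even, of period 2. Clamping a cosine makes continuity and periodicity
  immediate.\<close>

definition clamped_cos :: "real \<Rightarrow> real" where
  "clamped_cos t = max 0 (min 1 (1 / 2 - cos (pi * t)))"

lemma clamped_cos_bounds: "0 \<le> clamped_cos t" "clamped_cos t \<le> 1"
  by (auto simp: clamped_cos_def)

lemma clamped_cos_eq_0:
  assumes "0 \<le> t" "t \<le> 1 / 3"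
  shows "clamped_cos t = 0"
proof -
  have "cos (pi / 3) \<le> cos (pi * t)"
    using assms by (intro cos_monotone_0_pi_le) auto
  then show ?thesis by (simp add: clamped_cos_def cos_60)
qed

lemma clamped_cos_eq_1:
  assumes "2 / 3 \<le> t" "t \<le> 1"
  shows "clamped_cos t = 1"
proof -
  have "cos (pi * (1 - t)) \<ge> cos (pi / 3)"
    using assms by (intro cos_monotone_0_pi_le) auto
  moreover have "cos (pi * (1 - t)) = - cos (pi * t)"
    by (simp add: right_diff_distrib)
  ultimately show ?thesis by (simp add: clamped_cos_def cos_60)
qed

lemma clamped_cos_add_even: "clamped_cos (t + 2 * of_int m) = clamped_cos t"
proof -
  have "cos (pi * (t + 2 * of_int m)) = cos (pi * t + 2 * pi * of_int m)"
    by (simp add: algebra_simps)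
  then show ?thesis by (simp add: clamped_cos_def cos_add)
qed

lemma continuous_clamped_cos [continuous_intros]:
  fixes f :: "real \<Rightarrow> real"
  shows "continuous_on A f \<Longrightarrow> continuous_on A (\<lambda>x. clamped_cos (f x))"
  unfolding clamped_cos_def by (intro continuous_intros)

text \<open>For \<open>j = 0, 1\<close> these are the coordinates of Schoenberg's space-filling
  curve. From a number with ternary digits 0 and 2 they read every second digit, starting at
  \<open>j\<close>, as a binary digit.\<close>

definition schoenberg :: "nat \<Rightarrow> real \<Rightarrow> real" where
  "schoenberg j t = (\<Sum>k. clamped_cos (3 ^ (2 * k + j) * t) / 2 ^ Suc k)"

lemma continuous_on_schoenberg: "continuous_on UNIV (schoenberg j)"
proof -
  have "uniform_limit UNIV (\<lambda>n t. \<Sum>k<n. clamped_cos (3 ^ (2 * k + j) * t) / 2 ^ Suc k)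
          (\<lambda>t. \<Sum>k. clamped_cos (3 ^ (2 * k + j) * t) / 2 ^ Suc k) sequentially"
  proof (rule Weierstrass_m_test)
    show "summable (\<lambda>k. (1 / 2 :: real) ^ Suc k)"
      by (simp add: summable_geometric)
  qed (use clamped_cos_bounds in \<open>auto simp: power_one_over field_simps\<close>)
  then have "continuous_on UNIV (\<lambda>t. \<Sum>k. clamped_cos (3 ^ (2 * k + j) * t) / 2 ^ Suc k)"
    by (rule uniform_limit_theorem[rotated]) (auto intro!: always_eventually continuous_intros)
  then show ?thesis by (simp add: schoenberg_def[abs_def])
qed

lemma schoenberg_add_even: "schoenberg j (t + 2 * of_int m) = schoenberg j t"
proof -
  have "clamped_cos (3 ^ k * (t + 2 * of_int m)) = clamped_cos (3 ^ k * t)" for k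
    using clamped_cos_add_even[of "3 ^ k * t" "3 ^ k * m"] by (simp add: algebra_simps)
  then show ?thesis by (simp add: schoenberg_def)
qed

text \<open>Multiplication by \<open>3 ^ k\<close> turns the first \<open>k\<close> digits, all
  even, into an even integer, which the period removes. The remainder lies in
  \<open>[0, 1/3]\<close> or \<open>[2/3, 1]\<close> according to the digit
  \<open>a k\<close>.\<close>

lemma clamped_cos_ternary:
  fixes a :: "nat \<Rightarrow> real"
  assumes a: "\<And>i. a i \<in> {0, 1}"
  shows "clamped_cos (3 ^ k * (\<Sum>i. 2 * a i / 3 ^ Suc i)) = a k"
    "(\<Sum>i. 2 * a i / 3 ^ Suc i) \<in> {0..1}"
proof -
  have geo: "(\<lambda>i. 2 / 3 ^ Suc i :: real) sums 1"
    using sums_mult[OF geometric_sums[of "1/3 :: real"], of "2/3"] by (simp add: power_one_over field_simps)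
  have bd: "0 \<le> 2 * b i / 3 ^ Suc i \<and> 2 * b i / 3 ^ Suc i \<le> 2 / 3 ^ Suc i"
    if "\<And>i. b i \<in> {0, 1}" for b :: "nat \<Rightarrow> real" and i
    using that[of i] by auto
  have sm: "summable (\<lambda>i. 2 * b i / 3 ^ Suc i)" if "\<And>i. b i \<in> {0, 1}" for b :: "nat \<Rightarrow> real"
  proof (rule summable_comparison_test'[OF sums_summable[OF geo], of 0])
    show "norm (2 * b i / 3 ^ Suc i) \<le> 2 / 3 ^ Suc i" for i using that[of i] by auto
  qed
  have rng: "(\<Sum>i. 2 * b i / 3 ^ Suc i) \<in> {0..1}" if b: "\<And>i. b i \<in> {0, 1}" for b :: "nat \<Rightarrow> real"
  proof -
    have "0 \<le> (\<Sum>i. 2 * b i / 3 ^ Suc i)"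
      by (intro suminf_nonneg sm b) (use bd[of b, OF b] in auto)
    moreover have "(\<Sum>i. 2 * b i / 3 ^ Suc i) \<le> (\<Sum>i. 2 / 3 ^ Suc i)"
      by (intro suminf_le sm b sums_summable[OF geo]) (use bd[of b, OF b] in blast)
    ultimately show ?thesis using sums_unique[OF geo] by simp
  qed
  show "(\<Sum>i. 2 * a i / 3 ^ Suc i) \<in> {0..1}" by (rule rng[OF a])
  have sa: "summable (\<lambda>i. 2 * a i / 3 ^ Suc i)" by (rule sm) (rule a)
  have shift: "3 ^ k * (\<Sum>i. 2 * a i / 3 ^ Suc i)
     = (\<Sum>i<k. 2 * a i * 3 ^ (k - Suc i)) + (\<Sum>i. 2 * a (i + k) / 3 ^ Suc i)"
  proof -
    have "(\<Sum>i. 2 * a i / 3 ^ Suc i) = (\<Sum>i. 2 * a (i + k) / 3 ^ Suc (i + k)) + (\<Sum>i<k. 2 * a i / 3 ^ Suc i)"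
      by (rule suminf_split_initial_segment[OF sa])
    moreover have "3 ^ k * (\<Sum>i. 2 * a (i + k) / 3 ^ Suc (i + k)) = (\<Sum>i. 3 ^ k * (2 * a (i + k) / 3 ^ Suc (i + k)))"
      using summable_ignore_initial_segment[OF sa, of k] by (intro suminf_mult[symmetric]) simp
    moreover have "3 ^ k * (2 * a (i + k) / 3 ^ Suc (i + k)) = 2 * a (i + k) / 3 ^ Suc i" for i
      by (simp add: power_add)
    moreover have "3 ^ k * (\<Sum>i<k. 2 * a i / 3 ^ Suc i) = (\<Sum>i<k. 2 * a i * 3 ^ (k - Suc i))"
      unfolding sum_distrib_left
    proof (intro sum.cong refl)
      fix i assume "i \<in> {..<k}"
      then have "(3::real) ^ k = 3 ^ (k - Suc i + Suc i)" by simp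
      also have "\<dots> = 3 ^ (k - Suc i) * 3 ^ Suc i" by (rule power_add)
      finally have "(3::real) ^ k = 3 ^ (k - Suc i) * 3 ^ Suc i" .
      then show "3 ^ k * (2 * a i / 3 ^ Suc i) = 2 * a i * 3 ^ (k - Suc i)" by simp
    qed
    ultimately show ?thesis by (simp add: distrib_left)
  qed
  have ev: "(\<Sum>i<k. 2 * a i * 3 ^ (k - Suc i)) = 2 * of_int (\<Sum>i<k. \<lfloor>a i\<rfloor> * 3 ^ (k - Suc i))"
  proof -
    have "a i = of_int \<lfloor>a i\<rfloor>" for i using a[of i] by auto
    then show ?thesis by (auto simp: sum_distrib_left intro!: sum.cong)
  qed
  define r where "r = (\<Sum>i. 2 * a (i + Suc k) / 3 ^ Suc i)"
  have r: "r \<in> {0..1}" unfolding r_def by (rule rng) (rule a)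
  have "(\<Sum>i. 2 * a (i + k) / 3 ^ Suc i) = 2 * a k / 3 + r / 3"
  proof -
    have s1: "summable (\<lambda>i. 2 * a (i + k) / 3 ^ Suc i)" by (rule sm) (rule a)
    have s2: "summable (\<lambda>i. 2 * a (i + Suc k) / 3 ^ Suc i)" by (rule sm) (rule a)
    have "(\<Sum>i. 2 * a (i + k) / 3 ^ Suc i) = (\<Sum>i. 2 * a (Suc i + k) / 3 ^ Suc (Suc i)) + 2 * a k / 3"
      using suminf_split_head[OF s1] by simp
    also have "(\<Sum>i. 2 * a (Suc i + k) / 3 ^ Suc (Suc i)) = (\<Sum>i. (2 * a (i + Suc k) / 3 ^ Suc i) / 3)"
      by (intro arg_cong[where f = suminf] ext) (simp add: field_simps)
    also have "\<dots> = r / 3" unfolding r_def by (rule suminf_divide[OF s2])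
    finally show ?thesis by simp
  qed
  then have "clamped_cos (3 ^ k * (\<Sum>i. 2 * a i / 3 ^ Suc i)) = clamped_cos (2 * a k / 3 + r / 3)"
    unfolding shift ev by (subst add.commute) (simp only: clamped_cos_add_even)
  also have "\<dots> = a k"
    using a[of k] r clamped_cos_eq_0[of "r / 3"] clamped_cos_eq_1[of "2 / 3 + r / 3"] by auto
  finally show "clamped_cos (3 ^ k * (\<Sum>i. 2 * a i / 3 ^ Suc i)) = a k" .
qed

lemma binary_expansion:
  fixes x :: real
  assumes "0 \<le> x" "x < 1"
  obtains a :: "nat \<Rightarrow> real" where "\<And>k. a k \<in> {0, 1}" "(\<lambda>k. a k / 2 ^ Suc k) sums x"
proof -
  define a :: "nat \<Rightarrow> real" where "a k = of_int (\<lfloor>2 ^ Suc k * x\<rfloor> mod 2)" for k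
  have 1: "a k \<in> {0, 1}" for k
    unfolding a_def using mod2_eq_if[of "\<lfloor>2 ^ Suc k * x\<rfloor>"] by (simp split: if_splits)
  have part: "(\<Sum>k<n. a k / 2 ^ Suc k) = of_int \<lfloor>2 ^ n * x\<rfloor> / 2 ^ n" for n
  proof (induction n)
    case 0
    have "\<lfloor>x\<rfloor> = 0" using assms by linarith
    then show ?case by simp
  next
    case (Suc n)
    have "\<lfloor>2 * (2 ^ n * x)\<rfloor> div 2 = \<lfloor>2 ^ n * x\<rfloor>" by linarith
    then have "\<lfloor>2 ^ Suc n * x\<rfloor> = 2 * \<lfloor>2 ^ n * x\<rfloor> + \<lfloor>2 ^ Suc n * x\<rfloor> mod 2"
      by (metis mult.assoc mult_div_mod_eq power_Suc)
    then have "real_of_int \<lfloor>2 ^ Suc n * x\<rfloor> = 2 * of_int \<lfloor>2 ^ n * x\<rfloor> + a n"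
      unfolding a_def by linarith
    then show ?case using Suc by (simp add: field_simps)
  qed
  have "(\<lambda>n. of_int \<lfloor>2 ^ n * x\<rfloor> / 2 ^ n) \<longlonglongrightarrow> x"
  proof (rule LIMSEQ_I)
    fix e :: real assume "e > 0"
    then obtain N where N: "(1/2) ^ N < e" using real_arch_pow_inv[of e "1/2"] by auto
    have "norm (of_int \<lfloor>2 ^ n * x\<rfloor> / 2 ^ n - x) < e" if "n \<ge> N" for n
    proof -
      have "\<bar>of_int \<lfloor>2 ^ n * x\<rfloor> - 2 ^ n * x\<bar> \<le> 1" by linarith
      then have "\<bar>(of_int \<lfloor>2 ^ n * x\<rfloor> - 2 ^ n * x) / 2 ^ n\<bar> \<le> (1/2) ^ n"
        by (simp add: power_one_over divide_right_mono)
      also have "(1/2) ^ n \<le> (1/2 :: real) ^ N" using that by (intro power_decreasing) auto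
      finally show ?thesis using N by (simp add: diff_divide_distrib)
    qed
    then show "\<exists>no. \<forall>n\<ge>no. norm (of_int \<lfloor>2 ^ n * x\<rfloor> / 2 ^ n - x) < e" by blast
  qed
  then have 2: "(\<lambda>k. a k / 2 ^ Suc k) sums x" unfolding sums_def part .
  show thesis using that[of a] 1 2 by blast
qed

text \<open>The binary digits of \<open>x\<close> and \<open>y\<close> are interlaced to form the
  ternary digits of the parameter.\<close>

lemma schoenberg_surj:
  assumes "0 \<le> x" "x < 1" "0 \<le> y" "y < 1"
  obtains t where "t \<in> {0..1}" "schoenberg 0 t = x" "schoenberg 1 t = y"
proof -
  obtain a where a: "\<And>k. a k \<in> {0, 1}" "(\<lambda>k. a k / 2 ^ Suc k) sums x"
    using binary_expansion[OF assms(1,2)] by blast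
  obtain b where b: "\<And>k. b k \<in> {0, 1}" "(\<lambda>k. b k / 2 ^ Suc k) sums y"
    using binary_expansion[OF assms(3,4)] by blast
  define c :: "nat \<Rightarrow> real" where "c i = (if even i then a (i div 2) else b (i div 2))" for i
  have c: "c i \<in> {0, 1}" for i using a(1) b(1) by (simp add: c_def)
  define t where "t = (\<Sum>i. 2 * c i / 3 ^ Suc i)"
  have val: "clamped_cos (3 ^ k * t) = c k" for k unfolding t_def by (rule clamped_cos_ternary(1)[OF c])
  have "schoenberg 0 t = x" using a(2) by (simp add: schoenberg_def val c_def sums_iff)
  moreover have "schoenberg 1 t = y" using b(2) unfolding schoenberg_def val by (simp add: c_def sums_iff)
  moreover have "t \<in> {0..1}" unfolding t_def by (rule clamped_cos_ternary(2)[OF c])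
  ultimately show thesis using that by blast
qed

text \<open>The factor below is the integer \<open>n\<close> on each interval \<open>[2n, 2n + 1]\<close>.\<close>

definition plane_curve :: "real \<Rightarrow> complex" where
  "plane_curve t = of_real (t / 2 - arccos (cos (pi * t)) / (2 * pi)) *
     Complex (schoenberg 0 t - 1 / 2) (schoenberg 1 t - 1 / 2)"

lemma continuous_on_plane_curve: "continuous_on UNIV plane_curve"
proof -
  have "continuous_on UNIV (\<lambda>t. Complex (schoenberg 0 t - 1 / 2) (schoenberg 1 t - 1 / 2))"
    unfolding Complex_eq
    by (intro continuous_intros continuous_on_compose2[OF continuous_on_schoenberg]) auto
  moreover have "continuous_on UNIV (\<lambda>t::real. complex_of_real (t / 2 - arccos (cos (pi * t)) / (2 * pi)))"
    by (intro continuous_intros) auto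
  ultimately show ?thesis unfolding plane_curve_def[abs_def]
    by (rule continuous_on_mult[rotated])
qed

text \<open>The section is chosen pointwise, with no measurability claimed. Its linear growth is
  what carries tightness from the plane to the line.\<close>

lemma plane_curve_section:
  "\<exists>s :: complex \<Rightarrow> real. \<forall>z. plane_curve (s z) = z \<and> \<bar>s z\<bar> \<le> 8 * norm z + 5"
proof -
  have "\<exists>t. plane_curve t = z \<and> \<bar>t\<bar> \<le> 8 * norm z + 5" for z
  proof -
    \<comment> \<open>With \<open>4 * norm z < n\<close> the point \<open>z / n\<close> lies well
      inside the centred unit square, and adding \<open>2 * n\<close> to the parameter moves to the
      interval on which the factor of the curve is \<open>n\<close>.\<close>
    define n where "n = \<lceil>4 * norm z\<rceil> + 1"
    have n: "4 * norm z < n" "n \<le> 4 * norm z + 2" "n > 0"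
      unfolding n_def using norm_ge_zero[of z] by linarith+
    have re: "\<bar>Re z / n\<bar> < 1 / 2" "\<bar>Im z / n\<bar> < 1 / 2"
      using n(1,3) abs_Re_le_cmod[of z] abs_Im_le_cmod[of z] norm_ge_zero[of z]
      by (simp_all add: abs_divide field_simps)
    obtain \<tau> where \<tau>: "\<tau> \<in> {0..1}" "schoenberg 0 \<tau> = Re z / n + 1 / 2" "schoenberg 1 \<tau> = Im z / n + 1 / 2"
      using schoenberg_surj[of "Re z / n + 1 / 2" "Im z / n + 1 / 2"] re by (smt (verit) field_sum_of_halves)
    define t where "t = \<tau> + 2 * of_int n"
    have "cos (pi * t) = cos (pi * \<tau> + 2 * pi * of_int n)" by (simp add: t_def algebra_simps)
    then have "cos (pi * t) = cos (pi * \<tau>)" by (simp add: cos_add)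
    moreover have "arccos (cos (pi * \<tau>)) = pi * \<tau>" using \<tau> by (intro arccos_cos) auto
    ultimately have "t / 2 - arccos (cos (pi * t)) / (2 * pi) = n" by (simp add: t_def add_divide_distrib)
    then have "plane_curve t = of_real n * Complex (Re z / n) (Im z / n)"
      using \<tau> by (simp add: plane_curve_def t_def schoenberg_add_even)
    also have "\<dots> = z" using n by (simp add: complex_eq_iff)
    finally have "plane_curve t = z" .
    moreover have "\<bar>t\<bar> \<le> 8 * norm z + 5" using n \<tau> unfolding t_def by auto
    ultimately show ?thesis by blast
  qed
  then show ?thesis by metis
qed

text \<open>Discreteness makes the arbitrary section \<open>s\<close> measurable, so the measures
  can be lifted to the line and a weakly convergent subsequence extracted there. A test function
  composed with the continuous curve is again bounded and continuous.\<close>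

lemma tight_discrete_weak_limit:
  fixes M :: "nat \<Rightarrow> complex measure"
  assumes prob: "\<And>k. prob_space (M k)" and discrete: "\<And>k. sets (M k) = UNIV"
    and tight: "\<And>\<epsilon>. \<epsilon> > 0 \<Longrightarrow> \<exists>B. \<forall>k. measure (M k) {z. norm z > B} < \<epsilon>"
  obtains r \<mu> where "strict_mono (r :: nat \<Rightarrow> nat)" "prob_space \<mu>" "sets \<mu> = sets borel"
    "\<And>\<phi> :: complex \<Rightarrow> real. continuous_on UNIV \<phi> \<Longrightarrow> bounded (range \<phi>) \<Longrightarrow>
       (\<lambda>k. \<integral>z. \<phi> z \<partial>M (r k)) \<longlonglongrightarrow> (\<integral>z. \<phi> z \<partial>\<mu>)"
proof -
  obtain s where s: "\<And>z. plane_curve (s z) = z" "\<And>z. \<bar>s z\<bar> \<le> 8 * norm z + 5"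
    using plane_curve_section by blast
  have space: "space (M k) = UNIV" for k using sets_eq_imp_space_eq[of "M k" "count_space UNIV"] discrete by simp
  have meas: "f \<in> measurable (M k) N \<longleftrightarrow> f \<in> UNIV \<rightarrow> space N" for f :: "complex \<Rightarrow> 'b" and N k
    using discrete by (auto simp: measurable_def space)
  have [measurable]: "s \<in> borel_measurable (M k)" for k by (simp add: meas)
  define \<nu> where "\<nu> k = distr (M k) borel s" for k
  have rd: "real_distribution (\<nu> k)" for k
    unfolding \<nu>_def by (intro prob_space.real_distribution_distr prob) simp
  have tnu: "tight \<nu>"
    unfolding tight_def
  proof (intro conjI allI impI rd)
    fix \<epsilon> :: real assume "\<epsilon> > 0"
    then obtain B where B: "\<And>k. measure (M k) {z. norm z > B} < \<epsilon>" using tight by blast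
    \<comment> \<open>The section is bounded by \<open>8 * \<bar>B\<bar> + 5\<close> where
      \<open>norm z \<le> B\<close>; one more keeps it off the excluded left end point.\<close>
    define b where "b = 8 * \<bar>B\<bar> + 6"
    have "measure (\<nu> k) {- b<..b} > 1 - \<epsilon>" for k
    proof -
      interpret prob_space "M k" by (rule prob)
      have "1 - \<epsilon> < 1 - measure (M k) {z. norm z > B}" using B[of k] by simp
      also have "\<dots> = measure (M k) (space (M k) - {z. norm z > B})"
        by (subst prob_compl) (auto simp: discrete)
      also have "\<dots> \<le> measure (M k) (s -` {- b<..b} \<inter> space (M k))"
      proof (rule finite_measure_mono)
        have "- b < s z \<and> s z \<le> b" if "norm z \<le> B" for z
          using s(2)[of z] that unfolding b_def by linarith
        then show "space (M k) - {z. norm z > B} \<subseteq> s -` {- b<..b} \<inter> space (M k)"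
          by (auto simp: not_less)
      qed (simp add: discrete)
      also have "\<dots> = measure (\<nu> k) {- b<..b}"
        unfolding \<nu>_def by (subst measure_distr) auto
      finally show ?thesis .
    qed
    then show "\<exists>a b. a < b \<and> (\<forall>n. measure (\<nu> n) {a<..b} > 1 - \<epsilon>)"
      by (intro exI[of _ "- b"] exI[of _ b]) (auto simp: b_def)
  qed
  obtain r N where r: "strict_mono r" and N: "real_distribution N" and w: "weak_conv_m (\<nu> \<circ> r) N"
    using tight_imp_convergent_subsubsequence[OF tnu, of id] strict_mono_id by auto
  interpret N: real_distribution N by (rule N)
  have pc [measurable]: "plane_curve \<in> borel_measurable borel"
    by (rule borel_measurable_continuous_onI[OF continuous_on_plane_curve])
  have pcN: "plane_curve \<in> measurable N borel" by simp
  define \<mu> where "\<mu> = distr N borel plane_curve"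
  have "prob_space \<mu>" unfolding \<mu>_def by (rule N.prob_space_distr[OF pcN])
  moreover have "(\<lambda>k. \<integral>z. \<phi> z \<partial>M (r k)) \<longlonglongrightarrow> (\<integral>z. \<phi> z \<partial>\<mu>)"
    if \<phi>: "continuous_on UNIV \<phi>" "bounded (range \<phi>)" for \<phi> :: "complex \<Rightarrow> real"
  proof -
    have [measurable]: "\<phi> \<in> borel_measurable borel" by (rule borel_measurable_continuous_onI[OF \<phi>(1)])
    obtain B where B: "\<And>z. norm (\<phi> z) \<le> B" using \<phi>(2) unfolding bounded_iff by auto
    have comp: "continuous_on UNIV (\<lambda>t. \<phi> (plane_curve t))"
      using continuous_on_compose2[OF \<phi>(1) continuous_on_plane_curve] by simp
    have "(\<lambda>k. \<integral>t. \<phi> (plane_curve t) \<partial>(\<nu> \<circ> r) k) \<longlonglongrightarrow> (\<integral>t. \<phi> (plane_curve t) \<partial>N)"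
    proof (rule weak_conv_imp_integral_bdd_continuous_conv[OF _ N w])
      show "isCont (\<lambda>t. \<phi> (plane_curve t)) x" for x
        using comp by (simp add: continuous_on_eq_continuous_at)
      show "norm (\<phi> (plane_curve x)) \<le> B" for x by (rule B)
    qed (simp add: rd)
    moreover have "(\<integral>t. \<phi> (plane_curve t) \<partial>(\<nu> \<circ> r) k) = (\<integral>z. \<phi> z \<partial>M (r k))" for k
      unfolding \<nu>_def by (simp add: integral_distr s(1))
    moreover have "(\<integral>t. \<phi> (plane_curve t) \<partial>N) = (\<integral>z. \<phi> z \<partial>\<mu>)"
      unfolding \<mu>_def by (subst integral_distr) auto
    ultimately show ?thesis by simp
  qed
  moreover have "sets \<mu> = sets borel" by (simp add: \<mu>_def)
  ultimately show thesis using that r by blast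
qed


subsection \<open>Invariance of the Fatou and Julia sets\<close>

lemma transcendental_nicely_meromorphic:
  "transcendental_meromorphic f \<Longrightarrow> f nicely_meromorphic_on UNIV"
  by (simp add: transcendental_meromorphic_def)

lemma nicely_meromorphic_nonpole_iff:
  assumes "f nicely_meromorphic_on UNIV"
  shows "\<not> is_pole f z \<longleftrightarrow> f analytic_on {z}"
  using assms analytic_at_imp_no_pole nicely_meromorphic_on_imp_analytic_at by blast

lemma open_nonpoles:
  assumes "f nicely_meromorphic_on UNIV"
  shows "open {z. \<not> is_pole f z}"
proof -
  have "\<exists>e>0. ball z e \<subseteq> {z. \<not> is_pole f z}" if "\<not> is_pole f z" for z
  proof -
    have "f analytic_on {z}" using that assms nicely_meromorphic_nonpole_iff by blast
    then obtain e where "e > 0" "f holomorphic_on ball z e"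
      by (auto simp: analytic_on_def)
    then have "\<And>w. w \<in> ball z e \<Longrightarrow> f analytic_on {w}"
      using analytic_on_open[OF open_ball] analytic_on_subset by blast
    then show ?thesis using \<open>e > 0\<close> nicely_meromorphic_nonpole_iff[OF assms] by blast
  qed
  then show ?thesis by (auto simp: open_contains_ball)
qed

lemma holomorphic_on_nonpoles:
  assumes "f nicely_meromorphic_on UNIV"
  shows "f holomorphic_on {z. \<not> is_pole f z}"
  using assms by (intro analytic_imp_holomorphic)
    (auto simp: analytic_on_analytic_at[of f "Collect _"] nicely_meromorphic_nonpole_iff)

lemma isCont_nonpole:
  assumes "f nicely_meromorphic_on UNIV" "\<not> is_pole f z"
  shows "isCont f z"
  using assms analytic_at_imp_isCont nicely_meromorphic_nonpole_iff by blast

lemma transcendental_not_constant_on: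
  assumes f: "transcendental_meromorphic f" and A: "open A" "A \<noteq> {}"
  shows "\<not> f constant_on A"
proof
  assume "f constant_on A"
  then have "f constant_on UNIV"
    using constant_on_extend_nicely_meromorphic_on[OF transcendental_nicely_meromorphic[OF f]] A
    by blast
  then obtain c where "\<And>z. f z = c" by (auto simp: constant_on_def)
  then have "\<forall>z. poly 1 z \<noteq> 0 \<longrightarrow> f z = poly [:c:] z / poly 1 z" by simp
  then show False using f unfolding transcendental_meromorphic_def by (metis one_neq_zero)
qed

lemma transcendental_open_map:
  assumes f: "transcendental_meromorphic f" and U: "open U" "\<And>z. z \<in> U \<Longrightarrow> \<not> is_pole f z"
  shows "open (f ` U)"
proof -
  have "\<exists>e>0. ball w e \<subseteq> f ` U" if w: "w \<in> f ` U" for w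
  proof -
    obtain z where z: "z \<in> U" "w = f z" using w by blast
    obtain e where e: "e > 0" "ball z e \<subseteq> U" using U(1) z by (meson open_contains_ball)
    have "f holomorphic_on ball z e"
      using holomorphic_on_nonpoles[OF transcendental_nicely_meromorphic[OF f]] U e
      by (auto intro: holomorphic_on_subset)
    then have "open (f ` ball z e)"
      using e transcendental_not_constant_on[OF f] by (intro open_mapping_thm[of f "ball z e"]) auto
    moreover have "w \<in> f ` ball z e" using z e by auto
    ultimately show ?thesis using e by (meson image_mono open_contains_ball subset_trans)
  qed
  then show ?thesis by (meson open_contains_ball)
qed

section \<open>Complete invariance of the Fatou set\<close>

lemma fatou_setI:
  assumes "open U" "z \<in> U" "\<And>n w. w \<in> U \<Longrightarrow> \<not> is_pole f ((f ^^ n) w)"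
    "normal_family_on U (range (\<lambda>n. f ^^ n))"
  shows "z \<in> fatou_set f"
  unfolding fatou_set_def mem_Collect_eq by (intro exI[of _ U] conjI allI ballI assms)

lemma fatou_setE:
  assumes "z \<in> fatou_set f"
  obtains U where "open U" "z \<in> U" "\<And>n w. w \<in> U \<Longrightarrow> \<not> is_pole f ((f ^^ n) w)"
    "normal_family_on U (range (\<lambda>n. f ^^ n))"
proof -
  from assms show thesis
    unfolding fatou_set_def mem_Collect_eq by (elim exE conjE) (rule that, auto)
qed

lemma open_fatou_set: "open (fatou_set f)"
proof -
  have "\<exists>U. open U \<and> z \<in> U \<and> U \<subseteq> fatou_set f" if z: "z \<in> fatou_set f" for z
  proof -
    obtain U where U: "open U" "z \<in> U" "\<And>n w. w \<in> U \<Longrightarrow> \<not> is_pole f ((f ^^ n) w)"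
      "normal_family_on U (range (\<lambda>n. f ^^ n))"
      using fatou_setE[OF z] by metis
    show ?thesis
      by (intro exI[of _ U] conjI U subsetI) (rule fatou_setI[OF U(1) _ U(3,4)])
  qed
  then show ?thesis by (intro iffD2[OF open_subopen] ballI)
qed

lemma closed_julia_set: "closed (julia_set f)"
  using open_fatou_set by (simp add: julia_set_def closed_def)

lemma fatou_set_nonpole: "z \<in> fatou_set f \<Longrightarrow> \<not> is_pole f z"
  by (metis fatou_setE funpow_0)

lemma fatou_set_image:
  assumes f: "transcendental_meromorphic f" and z: "z \<in> fatou_set f"
  shows "f z \<in> fatou_set f"
proof -
  obtain U where U: "open U" "z \<in> U" "\<And>n w. w \<in> U \<Longrightarrow> \<not> is_pole f ((f ^^ n) w)"
    "normal_family_on U (range (\<lambda>n. f ^^ n))"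
    using fatou_setE[OF z] by metis
  \<comment> \<open>Normality controls compact sets only, so all preimages are taken in one closed
    disc.\<close>
  obtain e where e: "e > 0" "cball z e \<subseteq> U" using U by (meson open_contains_cball)
  define V where "V = f ` ball z e"
  have "open V" unfolding V_def
    using U(3)[where n = 0] e by (intro transcendental_open_map f) (auto simp: subset_iff)
  moreover have "f z \<in> V" using e by (auto simp: V_def)
  moreover have "\<not> is_pole f ((f ^^ n) w)" if "w \<in> V" for n w
    using that U(3)[where n = "Suc n"] e by (auto simp: V_def funpow_swap1 subset_iff)
  moreover have "normal_family_on V (range (\<lambda>n. f ^^ n))"
    unfolding normal_family_on_def
  proof (intro allI impI)
    fix h :: "nat \<Rightarrow> complex \<Rightarrow> complex" assume h: "range h \<subseteq> range (\<lambda>n. f ^^ n)"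
    have "range (\<lambda>k. h k \<circ> f) \<subseteq> range (\<lambda>n. f ^^ n)"
    proof safe
      fix k
      obtain n where "h k = f ^^ n" using h by blast
      then have "h k \<circ> f = f ^^ Suc n" by (simp only: funpow_Suc_right)
      then show "h k \<circ> f \<in> range (\<lambda>n. f ^^ n)" by blast
    qed
    then obtain r g where r: "strict_mono r" and
      "\<forall>K. compact K \<and> K \<subseteq> U \<longrightarrow>
              uniform_limit K (\<lambda>k z. to_sphere ((h (r k) \<circ> f) z)) g sequentially"
      using U(4) unfolding normal_family_on_def by (elim allE[of _ "\<lambda>k. h k \<circ> f"]) auto
    then have lim: "uniform_limit (cball z e) (\<lambda>k z. to_sphere (h (r k) (f z))) g sequentially"
      using e by auto
    \<comment> \<open>Any choice of preimages will do: uniform convergence on \<open>V\<close> is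
      inherited pointwise from the disc, whatever the regularity of \<open>s\<close>.\<close>
    define s where "s w = (SOME u. u \<in> cball z e \<and> f u = w)" for w
    have s: "s w \<in> cball z e \<and> f (s w) = w" if "w \<in> V" for w
      unfolding s_def by (rule someI_ex) (use that ball_subset_cball[of z e] in \<open>unfold V_def, blast\<close>)
    have "uniform_limit K (\<lambda>k w. to_sphere (h (r k) w)) (\<lambda>w. g (s w)) sequentially"
      if K: "K \<subseteq> V" for K
    proof (rule uniform_limitI)
      fix d :: real assume "d > 0"
      from uniform_limitD[OF lim this] show "\<forall>\<^sub>F k in sequentially. \<forall>w\<in>K. dist (to_sphere (h (r k) w)) (g (s w)) < d"
      proof eventually_elim
        case (elim k)
        show ?case
        proof
          fix w assume "w \<in> K"
          then have "s w \<in> cball z e" "f (s w) = w" using s K by blast+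
          then show "dist (to_sphere (h (r k) w)) (g (s w)) < d" using elim by metis
        qed
      qed
    qed
    then show "\<exists>r g. strict_mono r \<and> (\<forall>K. compact K \<and> K \<subseteq> V \<longrightarrow>
          uniform_limit K (\<lambda>k z. to_sphere (h (r k) z)) g sequentially)"
      using r by blast
  qed
  ultimately show ?thesis by (rule fatou_setI)
qed

lemma fatou_set_preimage:
  assumes f: "f nicely_meromorphic_on UNIV" and z: "\<not> is_pole f z" "f z \<in> fatou_set f"
  shows "z \<in> fatou_set f"
proof -
  obtain U where U: "open U" "f z \<in> U" "\<And>n w. w \<in> U \<Longrightarrow> \<not> is_pole f ((f ^^ n) w)"
    "normal_family_on U (range (\<lambda>n. f ^^ n))"
    using fatou_setE[OF z(2)] by metis
  define V where "V = {w. \<not> is_pole f w} \<inter> f -` U"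
  have cont: "continuous_on {w. \<not> is_pole f w} f"
    using holomorphic_on_nonpoles[OF f] by (rule holomorphic_on_imp_continuous_on)
  then have "open V" unfolding V_def using open_nonpoles[OF f] U(1)
    by (simp add: continuous_open_preimage)
  moreover have "z \<in> V" using z U by (auto simp: V_def)
  moreover have "\<not> is_pole f ((f ^^ n) w)" if "w \<in> V" for n w
    using that U(3) by (cases n) (auto simp: V_def funpow_swap1)
  moreover have "normal_family_on V (range (\<lambda>n. f ^^ n))"
    unfolding normal_family_on_def
  proof (intro allI impI)
    fix h :: "nat \<Rightarrow> complex \<Rightarrow> complex" assume h: "range h \<subseteq> range (\<lambda>n. f ^^ n)"
    show "\<exists>r g. strict_mono r \<and> (\<forall>K. compact K \<and> K \<subseteq> V \<longrightarrow>
          uniform_limit K (\<lambda>k z. to_sphere (h (r k) z)) g sequentially)"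
    \<comment> \<open>Every iterate other than the identity factors through \<open>f\<close> and can
      be handled on \<open>U\<close>. A sequence meeting the identity infinitely often has a
      constant subsequence; otherwise finitely many terms are dropped.\<close>
    proof (cases "infinite {k. h k = id}")
      case True
      then obtain r :: "nat \<Rightarrow> nat" where r: "strict_mono r" "\<And>k. h (r k) = id"
        using infinite_enumerate[of "{k. h k = id}"] by blast
      then have "uniform_limit K (\<lambda>k z. to_sphere (h (r k) z)) to_sphere sequentially" for K
        by (simp add: uniform_limit_const)
      then show ?thesis using r by blast
    next
      case False
      then obtain N where N: "\<And>k. k \<ge> N \<Longrightarrow> h k \<noteq> id"
        by (auto simp: finite_nat_set_iff_bounded) (metis leD)
      have "\<exists>n. h (k + N) = f ^^ n \<circ> f" for k
      proof -
        obtain n where n: "h (k + N) = f ^^ n" using h by blast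
        then have "n \<noteq> 0" using N[of "k + N"] by (metis funpow_0 eq_id_iff le_add2)
        then obtain m where "n = Suc m" by (cases n) auto
        then show ?thesis using n by (metis funpow_Suc_right)
      qed
      then obtain n where n: "\<And>k. h (k + N) = f ^^ n k \<circ> f" by metis
      obtain r g where r: "strict_mono r" and
        lim: "\<forall>K. compact K \<and> K \<subseteq> U \<longrightarrow>
                uniform_limit K (\<lambda>k z. to_sphere ((f ^^ n (r k)) z)) g sequentially"
      proof -
        have "range (\<lambda>k. f ^^ n k) \<subseteq> range (\<lambda>n. f ^^ n)" by blast
        with U(4) show ?thesis
          unfolding normal_family_on_def by (elim allE[of _ "\<lambda>k. f ^^ n k"] impE exE conjE) (assumption, rule that)
      qed
      have "uniform_limit K (\<lambda>k z. to_sphere (h (r k + N) z)) (\<lambda>z. g (f z)) sequentially"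
        if K: "compact K" "K \<subseteq> V" for K
      proof -
        have "compact (f ` K)"
          using K cont by (intro compact_continuous_image continuous_on_subset[OF cont]) (auto simp: V_def)
        moreover have "f ` K \<subseteq> U" using K by (auto simp: V_def)
        ultimately have *: "uniform_limit (f ` K) (\<lambda>k z. to_sphere ((f ^^ n (r k)) z)) g sequentially"
          using lim by blast
        show ?thesis
        proof (rule uniform_limitI)
          fix d :: real assume "d > 0"
          from uniform_limitD[OF * this] show "\<forall>\<^sub>F k in sequentially. \<forall>w\<in>K. dist (to_sphere (h (r k + N) w)) (g (f w)) < d"
            by eventually_elim (auto simp: n)
        qed
      qed
      moreover have "strict_mono (\<lambda>k. r k + N)" using r by (auto simp: strict_mono_def)
      ultimately show ?thesis by blast
    qed
  qed
  ultimately show ?thesis by (rule fatou_setI)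
qed

lemma julia_set_image_iff:
  assumes "transcendental_meromorphic f" "\<not> is_pole f z"
  shows "f z \<in> julia_set f \<longleftrightarrow> z \<in> julia_set f"
  using assms fatou_set_image fatou_set_preimage transcendental_nicely_meromorphic
  unfolding julia_set_def by blast


subsection \<open>Uniform bounds for the number of preimages\<close>

text \<open>Since \<open>u\<close> and \<open>v\<close> have no common zero, the solutions of
  \<open>f z = w\<close> off the poles are exactly the zeros of the entire function
  \<open>u - w * v\<close>. The equation for \<open>f\<close> also holds at poles, where both sides
  are the dummy value 0.\<close>

lemma nicely_meromorphic_quotient:
  assumes f: "f nicely_meromorphic_on UNIV"
  obtains u v where "u holomorphic_on UNIV" "v holomorphic_on UNIV"
    "\<And>z. v z = 0 \<longleftrightarrow> is_pole f z" "\<And>z. is_pole f z \<Longrightarrow> zorder v z = - zorder f z"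
    "\<And>z. is_pole f z \<Longrightarrow> u z \<noteq> 0" "\<And>z. f z = u z / v z"
proof -
  obtain h f1 f2 where h: "h holomorphic_on UNIV" "f1 holomorphic_on UNIV" "f2 holomorphic_on UNIV"
    "\<forall>z. f1 z = 0 \<longleftrightarrow> \<not>is_pole f z \<and> f z = 0"
    "\<forall>z. f2 z = 0 \<longleftrightarrow> is_pole f z"
    "\<forall>z. is_pole f z \<longrightarrow> zorder f2 z = -zorder f z"
    "\<forall>z. h z \<noteq> 0"
    "\<forall>z. f z = h z * f1 z / f2 z"
    using weierstrass_factorization_meromorphic_UNIV[OF f] by metis
  show thesis
    by (rule that[of "\<lambda>z. h z * f1 z" f2]) (use h in \<open>auto intro!: holomorphic_intros\<close>)
qed

lemma finite_zeros_cball: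
  assumes "F holomorphic_on UNIV" "F 0 \<noteq> 0"
  shows "finite {z \<in> cball 0 R. F z = 0}"
proof (cases "F constant_on UNIV")
  case True
  then have "F z \<noteq> 0" for z using assms(2) by (auto simp: constant_on_def)
  then show ?thesis by simp
next
  case False
  with holomorphic_compact_finite_zeros[OF assms(1) open_UNIV connected_UNIV compact_cball] show ?thesis
    by blast
qed

lemma Jensen_formula_entire:
  assumes F: "F holomorphic_on UNIV" "F 0 \<noteq> 0" "0 < R" "\<And>z. norm z = R \<Longrightarrow> F z \<noteq> 0"
  defines "S \<equiv> {z \<in> cball 0 R. F z = 0}"
  shows "((\<lambda>\<theta>. ln (norm (F (of_real R * cis \<theta>)))) has_integral
      2 * pi * (ln (norm (F 0)) + (\<Sum>a\<in>S. of_int (zorder F a) * ln (R / norm a)))) {0..2 * pi}"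
proof -
  \<comment> \<open>Finitely many zeros lie just outside the circle. A radius \<open>R1\<close> not
    exceeding any of their moduli leaves only \<open>S\<close> in the open disc.\<close>
  define Z where "Z = {z \<in> cball 0 (R + 1). F z = 0 \<and> norm z > R}"
  have finZ: "finite Z" unfolding Z_def
    by (rule finite_subset[OF _ finite_zeros_cball[OF F(1,2), of "R + 1"]]) auto
  define R1 where "R1 = Min (insert (R + 1) (norm ` Z))"
  have R1: "R < R1" "R1 \<le> R + 1" "\<And>z. z \<in> Z \<Longrightarrow> R1 \<le> norm z"
    unfolding R1_def using finZ by (auto simp: Z_def)
  have "{z \<in> ball 0 R1. F z = 0} = S"
  proof -
    have "norm z \<le> R" if "norm z < R1" "F z = 0" for z
      using R1(2) R1(3)[of z] that unfolding Z_def by (cases "norm z \<le> R") auto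
    then show ?thesis unfolding S_def using R1(1) by auto
  qed
  moreover have "S \<subseteq> ball 0 R" unfolding S_def using F(4) by (auto simp: less_le)
  moreover have "finite S" unfolding S_def by (rule finite_zeros_cball[OF F(1,2)])
  ultimately show ?thesis
    using F R1 by (intro Jensen_formula_holomorphic[of S F R1 R]) (auto intro: holomorphic_on_subset)
qed

lemma finite_poles_cball:
  assumes "f nicely_meromorphic_on UNIV" "\<not> is_pole f 0"
  shows "finite {z \<in> cball 0 R. is_pole f z}"
proof -
  obtain u v where v: "v holomorphic_on UNIV" "\<And>z. v z = 0 \<longleftrightarrow> is_pole f z"
    using nicely_meromorphic_quotient[OF assms(1)] by metis
  then show ?thesis using finite_zeros_cball[OF v(1)] assms(2) by (simp flip: v(2))
qed

text \<open>Each pole \<open>b\<close> contributes the integral of \<open>1 / s\<close> from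
  \<open>norm b\<close> to \<open>R\<close>, with its multiplicity. The subtracted term at radius 0
  vanishes because 0 is not a pole.\<close>

lemma counting_fun_eq:
  assumes f: "f nicely_meromorphic_on UNIV" "\<not> is_pole f 0" and R: "0 < R"
  shows "counting_fun f R = (\<Sum>b | b \<in> cball 0 R \<and> is_pole f b. real (nat (- zorder f b)) * ln (R / norm b))"
proof -
  define P where "P = {b \<in> cball 0 R. is_pole f b}"
  have finP: "finite P" unfolding P_def by (rule finite_poles_cball[OF f])
  have "{z. norm z \<le> 0 \<and> is_pole f z} = {}" using f(2) by auto
  then have c0: "pole_count f 0 = 0" unfolding pole_count_def by simp
  \<comment> \<open>This includes \<open>s = 0\<close>, where both sides are 0 since division by
    zero gives 0.\<close>
  have count: "real (pole_count f s) / s = (\<Sum>b\<in>P. real (nat (- zorder f b)) * (if s \<in> {norm b..R} then 1 / s else 0))"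
    if s: "s \<in> {0..R}" for s
  proof -
    have "{z. norm z \<le> s \<and> is_pole f z} = {b \<in> P. norm b \<le> s}"
      using s by (auto simp: P_def)
    then have "real (pole_count f s) = (\<Sum>b\<in>{b \<in> P. norm b \<le> s}. real (nat (- zorder f b)))"
      unfolding pole_count_def by simp
    also have "\<dots> = (\<Sum>b\<in>P. if norm b \<le> s then real (nat (- zorder f b)) else 0)"
      by (rule sum.inter_filter[OF finP])
    finally have "real (pole_count f s) / s = (\<Sum>b\<in>P. (if norm b \<le> s then real (nat (- zorder f b)) else 0) / s)"
      by (simp add: sum_divide_distrib)
    also have "\<dots> = (\<Sum>b\<in>P. real (nat (- zorder f b)) * (if s \<in> {norm b..R} then 1 / s else 0))"
      using s by (intro sum.cong) auto
    finally show ?thesis .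
  qed
  have int: "((\<lambda>s. if s \<in> {norm b..R} then 1 / s else 0) has_integral ln (R / norm b)) {0..R}" if "b \<in> P" for b
  proof -
    have b: "0 < norm b" "norm b \<le> R" using that f(2) by (auto simp: P_def)
    have "((\<lambda>s. 1 / s) has_integral (ln R - ln (norm b))) {norm b..R}"
      using b by (intro fundamental_theorem_of_calculus)
        (auto intro!: derivative_eq_intros intro: order.strict_trans2[OF b(1)] simp flip: has_real_derivative_iff_has_vector_derivative)
    then have "((\<lambda>s. if s \<in> {norm b..R} then 1 / s else 0) has_integral (ln R - ln (norm b))) {0..R}"
      using b by (subst has_integral_restrict) auto
    then show ?thesis using b by (subst ln_div) auto
  qed
  have "((\<lambda>s. \<Sum>b\<in>P. real (nat (- zorder f b)) * (if s \<in> {norm b..R} then 1 / s else 0)) has_integral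
         (\<Sum>b\<in>P. real (nat (- zorder f b)) * ln (R / norm b))) {0..R}"
    by (intro has_integral_sum finP has_integral_mult_right int)
  then have "((\<lambda>s. real (pole_count f s) / s) has_integral
         (\<Sum>b\<in>P. real (nat (- zorder f b)) * ln (R / norm b))) {0..R}"
    by (rule has_integral_eq[rotated]) (use count in simp)
  then show ?thesis unfolding counting_fun_def c0 P_def by (simp add: integral_unique)
qed

section \<open>The positive logarithm and the first main inequality\<close>

lemma ln_add_le_max_ln:
  fixes x y :: real
  assumes "0 \<le> x" "0 \<le> y" "0 < x + y"
  shows "ln (x + y) \<le> max 0 (ln x) + max 0 (ln y) + ln 2"
proof -
  have "ln (x + y) \<le> ln (2 * max x y)" using assms by (intro ln_mono) auto
  also have "\<dots> = ln 2 + ln (max x y)" using assms by (subst ln_mult) auto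
  finally show ?thesis by (auto simp: max_def split: if_splits)
qed

lemma ln_norm_diff_le:
  fixes x w :: complex
  assumes "x \<noteq> w"
  shows "ln (norm (x - w)) \<le> max 0 (ln (norm x)) + (max 0 (ln (norm w)) + ln 2)"
proof -
  have "0 < norm (x - w)" using assms by simp
  moreover have "norm (x - w) \<le> norm x + norm w" by (rule norm_triangle_ineq4)
  ultimately have "ln (norm (x - w)) \<le> ln (norm x + norm w)" "0 < norm x + norm w"
    by (blast intro: ln_mono order.strict_trans2)+
  with ln_add_le_max_ln[of "norm x" "norm w"] show ?thesis by simp
qed

lemma has_integral_proximity_fun:
  assumes "continuous_on {0..2 * pi} (\<lambda>\<theta>. f (of_real R * cis \<theta>))"
  shows "((\<lambda>\<theta>. max 0 (ln (norm (f (of_real R * cis \<theta>))))) has_integral 2 * pi * proximity_fun f R) {0..2 * pi}"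
proof -
  define g where "g \<theta> = max 0 (ln (norm (f (of_real R * cis \<theta>))))" for \<theta>
  \<comment> \<open>Written as \<open>ln (max 1 _)\<close>, the positive logarithm is visibly
    continuous, also where \<open>f\<close> vanishes.\<close>
  have "continuous_on {0..2 * pi} (\<lambda>\<theta>. ln (max 1 (norm (f (of_real R * cis \<theta>)))))"
    using assms by (intro continuous_intros) auto
  moreover have "ln (max 1 (norm (f (of_real R * cis \<theta>)))) = g \<theta>" for \<theta>
  proof -
    have "ln x \<ge> 0 \<longleftrightarrow> x \<ge> 1" if "x > 0" for x :: real using that by simp
    then show ?thesis unfolding g_def
      by (cases "f (of_real R * cis \<theta>) = 0") (auto simp: max_def)
  qed
  ultimately have "g integrable_on {0..2 * pi}"
    by (simp add: integrable_continuous_real)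
  then have "(g has_integral integral {0..2 * pi} g) {0..2 * pi}" by blast
  moreover have "integral {0..2 * pi} g = 2 * pi * proximity_fun f R"
    unfolding proximity_fun_def g_def by simp
  ultimately show ?thesis by (simp add: g_def[abs_def])
qed

text \<open>Jensen's formula for \<open>u - w * v\<close> minus that for \<open>v\<close> gives the
  mean of \<open>ln (norm (f - w))\<close> on the circle. The zeros of \<open>v\<close> produce the
  counting function, and the mean is at most the proximity function plus the terms in
  \<open>w\<close>.\<close>

lemma first_main_inequality:
  assumes f: "f nicely_meromorphic_on UNIV" "\<not> is_pole f 0" "f 0 \<noteq> w"
    and R: "0 < R" "\<And>z. norm z = R \<Longrightarrow> \<not> is_pole f z \<and> f z \<noteq> w"
    and A: "\<And>z. z \<in> A \<Longrightarrow> \<not> is_pole f z \<and> f z = w \<and> norm z \<le> R"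
  shows "finite A" "(\<Sum>a\<in>A. ln (R / norm a)) \<le> nevanlinna_char f R + max 0 (ln (norm w)) + ln 2 - ln (norm (f 0 - w))"
proof -
  obtain u v where u: "u holomorphic_on UNIV" and v: "v holomorphic_on UNIV"
    "\<And>z. v z = 0 \<longleftrightarrow> is_pole f z" "\<And>z. is_pole f z \<Longrightarrow> zorder v z = - zorder f z"
    and up: "\<And>z. is_pole f z \<Longrightarrow> u z \<noteq> 0" and fuv: "\<And>z. f z = u z / v z"
    using nicely_meromorphic_quotient[OF f(1)] by metis
  define F where "F z = u z - w * v z" for z
  have F: "F holomorphic_on UNIV" unfolding F_def by (intro holomorphic_intros u v)
  have Fv: "F z = v z * (f z - w)" if "\<not> is_pole f z" for z
    using that v(2)[of z] by (simp add: F_def fuv field_simps)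
  have F0: "F z = 0 \<longleftrightarrow> \<not> is_pole f z \<and> f z = w" for z
    using Fv[of z] v(2)[of z] up[of z] by (cases "is_pole f z") (auto simp: F_def)
  have v0: "v 0 \<noteq> 0" and F00: "F 0 \<noteq> 0" using f v(2) F0 by auto
  define S where "S = {z \<in> cball 0 R. F z = 0}"
  have finS: "finite S" unfolding S_def by (rule finite_zeros_cball[OF F F00])
  have AS: "A \<subseteq> S" using A F0 by (auto simp: S_def)
  then show "finite A" using finS finite_subset by blast
  define P where "P = {z \<in> cball 0 R. is_pole f z}"
  have J1: "((\<lambda>\<theta>. ln (norm (F (of_real R * cis \<theta>)))) has_integral
      2 * pi * (ln (norm (F 0)) + (\<Sum>a\<in>S. of_int (zorder F a) * ln (R / norm a)))) {0..2 * pi}"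
    unfolding S_def using R F0 by (intro Jensen_formula_entire F F00) auto
  have J2: "((\<lambda>\<theta>. ln (norm (v (of_real R * cis \<theta>)))) has_integral
      2 * pi * (ln (norm (v 0)) + (\<Sum>a\<in>P. of_int (zorder v a) * ln (R / norm a)))) {0..2 * pi}"
    unfolding P_def v(2)[symmetric] using R v(2) by (intro Jensen_formula_entire v(1) v0) auto
  have cR: "norm (of_real R * cis \<theta>) = R" for \<theta> using R by (simp add: norm_mult)
  have np: "\<not> is_pole f (of_real R * cis \<theta>)" "f (of_real R * cis \<theta>) \<noteq> w" for \<theta> using R(2) cR by blast+
  have "ln (norm (F (of_real R * cis \<theta>))) - ln (norm (v (of_real R * cis \<theta>)))
       = ln (norm (f (of_real R * cis \<theta>) - w))" for \<theta>
    using np[of \<theta>] v(2) by (subst Fv) (auto simp: norm_mult ln_mult)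
  with has_integral_diff[OF J1 J2]
  have I: "((\<lambda>\<theta>. ln (norm (f (of_real R * cis \<theta>) - w))) has_integral
     2 * pi * (ln (norm (F 0)) + (\<Sum>a\<in>S. of_int (zorder F a) * ln (R / norm a))) -
     2 * pi * (ln (norm (v 0)) + (\<Sum>a\<in>P. of_int (zorder v a) * ln (R / norm a)))) {0..2 * pi}"
    by simp
  have cnt: "counting_fun f R = (\<Sum>a\<in>P. of_int (zorder v a) * ln (R / norm a))"
    unfolding counting_fun_eq[OF f(1,2) R(1)]
  proof (rule sum.cong)
    fix b assume b: "b \<in> P"
    have "\<exists>z\<in>UNIV. v z \<noteq> 0" using v0 by blast
    from zorder_exist_zero[OF v(1) open_UNIV connected_UNIV UNIV_I this, THEN conjunct1, of b]
    have "zorder v b \<ge> 0" by (simp split: if_splits)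
    moreover have "zorder v b = - zorder f b" using b v(3) by (auto simp: P_def)
    ultimately show "real (nat (- zorder f b)) * ln (R / norm b) = of_int (zorder v b) * ln (R / norm b)" by simp
  qed (simp add: P_def)
  have ln0: "ln (norm (f 0 - w)) = ln (norm (F 0)) - ln (norm (v 0))"
    using Fv[of 0] f v0 by (simp add: norm_mult ln_mult)
  define g where "g \<theta> = max 0 (ln (norm (f (of_real R * cis \<theta>))))" for \<theta>
  \<comment> \<open>Jensen's sum counts every zero with order at least 1, and all its terms are
    nonnegative inside the disc; so it dominates a sum over any subset counted without
    multiplicity.\<close>
  have "(\<Sum>a\<in>A. ln (R / norm a)) \<le> (\<Sum>a\<in>S. of_int (zorder F a) * ln (R / norm a))"
  proof (rule sum_mono2[OF finS AS, THEN order_trans[rotated]])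
    have nz: "a \<noteq> 0" "norm a \<le> R" "zorder F a \<ge> 1" if "a \<in> S" for a
    proof -
      show "a \<noteq> 0" "norm a \<le> R" using that F00 by (auto simp: S_def)
      have "\<exists>z\<in>UNIV. F z \<noteq> 0" using F00 by blast
      from zorder_exist_zero[OF F open_UNIV connected_UNIV UNIV_I this, THEN conjunct1, of a]
      show "zorder F a \<ge> 1" using that by (simp add: S_def)
    qed
    have pos: "0 \<le> ln (R / norm a)" if "a \<in> S" for a
      using nz[OF that] R by (intro ln_ge_zero) (auto simp: field_simps)
    show "(\<Sum>a\<in>A. ln (R / norm a)) \<le> (\<Sum>a\<in>A. of_int (zorder F a) * ln (R / norm a))"
    proof (rule sum_mono)
      fix a assume "a \<in> A"
      then have "a \<in> S" using AS by blast
      from mult_right_mono[OF _ pos[OF this], of 1 "of_int (zorder F a)"] nz(3)[OF this]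
      show "ln (R / norm a) \<le> of_int (zorder F a) * ln (R / norm a)" by simp
    qed
    show "0 \<le> of_int (zorder F b) * ln (R / norm b)" if "b \<in> S - A" for b
      using nz(3)[of b] pos[of b] that by (intro mult_nonneg_nonneg) auto
  qed
  moreover have "2 * pi * (\<Sum>a\<in>S. of_int (zorder F a) * ln (R / norm a))
     \<le> 2 * pi * (proximity_fun f R + max 0 (ln (norm w)) + ln 2 - ln (norm (f 0 - w)) + counting_fun f R)"
  proof -
    have "continuous_on {0..2 * pi} (\<lambda>\<theta>. f (of_real R * cis \<theta>))"
      using np by (intro continuous_on_compose2[OF holomorphic_on_imp_continuous_on[OF holomorphic_on_nonpoles[OF f(1)]]] continuous_intros) auto
    then have gi: "(g has_integral 2 * pi * proximity_fun f R) {0..2 * pi}"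
      unfolding g_def by (rule has_integral_proximity_fun)
    have ci: "((\<lambda>_. max 0 (ln (norm w)) + ln 2) has_integral 2 * pi * (max 0 (ln (norm w)) + ln 2)) {0..2 * pi}"
      using has_integral_const_real[of "max 0 (ln (norm w)) + ln 2" 0 "2 * pi"] by simp
    have "2 * pi * (ln (norm (F 0)) + (\<Sum>a\<in>S. of_int (zorder F a) * ln (R / norm a))) -
       2 * pi * (ln (norm (v 0)) + (\<Sum>a\<in>P. of_int (zorder v a) * ln (R / norm a)))
        \<le> 2 * pi * proximity_fun f R + 2 * pi * (max 0 (ln (norm w)) + ln 2)"
    proof (rule has_integral_le[OF I has_integral_add[OF gi ci]])
      fix \<theta>
      show "ln (norm (f (of_real R * cis \<theta>) - w)) \<le> g \<theta> + (max 0 (ln (norm w)) + ln 2)"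
        unfolding g_def by (rule ln_norm_diff_le) (rule np)
    qed
    then show ?thesis unfolding cnt ln0 by (simp add: algebra_simps)
  qed
  then have "(\<Sum>a\<in>S. of_int (zorder F a) * ln (R / norm a))
     \<le> proximity_fun f R + max 0 (ln (norm w)) + ln 2 - ln (norm (f 0 - w)) + counting_fun f R"
    by (subst (asm) mult_le_cancel_left_pos) auto
  ultimately show "(\<Sum>a\<in>A. ln (R / norm a)) \<le> nevanlinna_char f R + max 0 (ln (norm w)) + ln 2 - ln (norm (f 0 - w))"
    unfolding nevanlinna_char_def by linarith
qed


lemma exists_good_radius:
  assumes f: "f nicely_meromorphic_on UNIV" "\<not> is_pole f 0" "f 0 \<noteq> w" and "a < b"
  shows "\<exists>R. a < R \<and> R < b \<and> (\<forall>z. norm z = R \<longrightarrow> \<not> is_pole f z \<and> f z \<noteq> w)"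
proof -
  obtain u v where u: "u holomorphic_on UNIV" and v: "v holomorphic_on UNIV"
    "\<And>z. v z = 0 \<longleftrightarrow> is_pole f z" and fuv: "\<And>z. f z = u z / v z"
    using nicely_meromorphic_quotient[OF f(1)] by metis
  define F where "F z = u z - w * v z" for z
  have F: "F holomorphic_on UNIV" unfolding F_def by (intro holomorphic_intros u v)
  have Fv: "F z = v z * (f z - w)" if "\<not> is_pole f z" for z
    using that v(2)[of z] by (simp add: F_def fuv field_simps)
  have v0: "v 0 \<noteq> 0" and F0: "F 0 \<noteq> 0" using f v(2)[of 0] Fv[of 0] by auto
  let ?B = "norm ` ({z \<in> cball 0 b. F z = 0} \<union> {z \<in> cball 0 b. v z = 0})"
  have "finite ?B" using finite_zeros_cball[OF F F0] finite_zeros_cball[OF v(1) v0] by blast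
  then have "infinite ({a<..<b} - ?B)" using assms(4) by (simp add: Diff_infinite_finite)
  then obtain R where R: "R \<in> {a<..<b} - ?B" using infinite_imp_nonempty by blast
  have "\<not> is_pole f z \<and> f z \<noteq> w" if "norm z = R" for z
  proof -
    have "F z \<noteq> 0" "v z \<noteq> 0" using R that by auto
    then show ?thesis using v(2) Fv by auto
  qed
  then show ?thesis using R by auto
qed

section \<open>Order of growth and the number of preimages\<close>

lemma nevanlinna_char_le_powr:
  assumes "order_of_growth f < ereal q"
  shows "\<exists>r0\<ge>1. \<forall>r\<ge>r0. nevanlinna_char f r \<le> r powr q"
proof -
  have "\<forall>\<^sub>F r in at_top. ereal (ln (nevanlinna_char f r) / ln r) < ereal q"
    using assms unfolding order_of_growth_def by (rule Limsup_lessD)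
  then obtain r1 where r1: "\<And>r. r \<ge> r1 \<Longrightarrow> ln (nevanlinna_char f r) / ln r < q"
    by (auto simp: eventually_at_top_linorder)
  have "nevanlinna_char f r \<le> r powr q" if r: "r \<ge> max 2 r1" for r
  proof (cases "nevanlinna_char f r > 0")
    case True
    have "ln r > 0" using r by simp
    then have "ln (nevanlinna_char f r) \<le> q * ln r" using r1[of r] r by (simp add: field_simps)
    then have "exp (ln (nevanlinna_char f r)) \<le> exp (q * ln r)" by simp
    then show ?thesis using True r by (simp add: powr_def)
  next
    case False
    then show ?thesis using powr_ge_zero[of r q] by linarith
  qed
  then show ?thesis by (intro exI[of _ "max 2 r1"]) auto
qed

text \<open>A negative order would bound the characteristic by 1 for large radii, but a single
  preimage \<open>z\<close> of a value \<open>w\<close> other than \<open>f 0\<close> already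
  contributes \<open>ln (R / norm z)\<close>, which is unbounded.\<close>

lemma order_of_growth_nonneg:
  assumes f: "transcendental_meromorphic f" "\<not> is_pole f 0"
  shows "order_of_growth f \<ge> 0"
proof (rule ccontr)
  note nm = transcendental_nicely_meromorphic[OF f(1)]
  assume "\<not> order_of_growth f \<ge> 0"
  then have neg: "order_of_growth f < ereal 0" by (simp add: zero_ereal_def)
  then obtain r0 where r0: "r0 \<ge> 1" "\<And>r. r \<ge> r0 \<Longrightarrow> nevanlinna_char f r \<le> r powr 0"
    using nevanlinna_char_le_powr[OF neg] by metis
  obtain e where e: "e > 0" "ball 0 e \<subseteq> {z. \<not> is_pole f z}"
    using openE[OF open_nonpoles[OF nm], of 0] f(2) by blast
  have "\<not> f constant_on ball 0 e"
    using transcendental_not_constant_on[OF f(1), of "ball 0 e"] e(1) by simp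
  then obtain z where z: "z \<in> ball 0 e" "f z \<noteq> f 0" unfolding constant_on_def by metis
  then have z0: "z \<noteq> 0" "\<not> is_pole f z" using e by auto
  define w where "w = f z"
  define c where "c = 1 + max 0 (ln (norm w)) + ln 2 - ln (norm (f 0 - w))"
  \<comment> \<open>Beyond this radius \<open>ln (R / norm z)\<close> exceeds the constant
    \<open>c\<close>.\<close>
  define a where "a = max r0 (norm z * exp (\<bar>c\<bar> + 1))"
  obtain R where R: "R > a" "\<And>z. norm z = R \<Longrightarrow> \<not> is_pole f z \<and> f z \<noteq> w"
    using exists_good_radius[OF nm f(2), of w a "a + 1"] z by (auto simp: w_def)
  have "norm z * 1 \<le> norm z * exp (\<bar>c\<bar> + 1)" by (intro mult_left_mono) auto
  then have Ra: "R > r0" "R > norm z" "R > norm z * exp (\<bar>c\<bar> + 1)" using R(1) by (auto simp: a_def)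
  then have "(\<Sum>a\<in>{z}. ln (R / norm a)) \<le> nevanlinna_char f R + max 0 (ln (norm w)) + ln 2 - ln (norm (f 0 - w))"
    using z z0 R r0(1) by (intro first_main_inequality nm f(2)) (auto simp: w_def)
  moreover have "nevanlinna_char f R \<le> 1" using r0(2)[of R] Ra r0(1) by simp
  ultimately have "ln (R / norm z) \<le> c" by (simp add: c_def)
  moreover have "ln (exp (\<bar>c\<bar> + 1)) < ln (R / norm z)"
    using Ra z0 r0(1) by (subst ln_less_cancel_iff) (auto simp: field_simps)
  ultimately show False by simp
qed

lemma julia_set_away_from_0:
  assumes "0 \<in> fatou_set f"
  obtains \<delta> where "\<delta> > 0" "\<And>z. z \<in> julia_set f \<Longrightarrow> norm z \<ge> \<delta>"
proof -
  obtain e where e: "e > 0" "ball 0 e \<subseteq> fatou_set f"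
    using assms open_fatou_set by (meson open_contains_ball)
  then show thesis by (intro that[of e]) (auto simp: julia_set_def subset_iff not_less[symmetric])
qed

text \<open>This keeps the term \<open>- ln (norm (f 0 - w))\<close> of the first main inequality
  bounded above uniformly over the Julia set.\<close>

lemma julia_set_away_from_value_at_0:
  assumes "transcendental_meromorphic f" "0 \<in> fatou_set f"
  obtains d where "d > 0" "\<And>w. w \<in> julia_set f \<Longrightarrow> norm (f 0 - w) \<ge> d"
proof -
  obtain e where e: "e > 0" "ball (f 0) e \<subseteq> fatou_set f"
    using fatou_set_image[OF assms] open_fatou_set by (meson open_contains_ball)
  then show thesis by (intro that[of e]) (auto simp: julia_set_def subset_iff not_less[symmetric] dist_norm)
qed

text \<open>The first main inequality is used at more than twice the radius, where each preimage
  counted weighs at least \<open>ln 2\<close>.\<close>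

lemma card_preimages_le_powr:
  assumes f: "transcendental_meromorphic f" and F0: "0 \<in> fatou_set f"
    and q: "0 < q" "order_of_growth f < ereal q" and \<delta>: "0 < \<delta>"
  obtains C where "C > 0" "\<And>w r. w \<in> julia_set f \<Longrightarrow> \<delta> \<le> r \<Longrightarrow>
    finite {z. \<not> is_pole f z \<and> f z = w \<and> norm z \<le> r} \<and>
    real (card {z. \<not> is_pole f z \<and> f z = w \<and> norm z \<le> r}) \<le> C * r powr q"
proof -
  note nm = transcendental_nicely_meromorphic[OF f]
  have np: "\<not> is_pole f 0" by (rule fatou_set_nonpole[OF F0])
  obtain d where d: "d > 0" "\<And>w. w \<in> julia_set f \<Longrightarrow> norm (f 0 - w) \<ge> d"
    using julia_set_away_from_value_at_0[OF f F0] by blast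
  obtain r0 where r0: "r0 \<ge> 1" "\<And>r. r \<ge> r0 \<Longrightarrow> nevanlinna_char f r \<le> r powr q"
    using nevanlinna_char_le_powr[OF q(2)] by blast
  \<comment> \<open>For large \<open>w\<close> the logarithms of \<open>norm w\<close> and of
    \<open>norm (f 0 - w)\<close> nearly cancel, leaving \<open>ln (1 + norm (f 0))\<close>; for
    \<open>w\<close> close to \<open>f 0\<close> the gap \<open>d\<close> takes over.\<close>
  define c where "c = ln (1 + norm (f 0)) + max 0 (- ln d) + ln 2"
  have c0: "c \<ge> 0" by (simp add: c_def add_nonneg_nonneg)
  have c: "max 0 (ln (norm w)) + ln 2 - ln (norm (f 0 - w)) \<le> c" if "w \<in> julia_set f" for w
  proof -
    define x where "x = norm (f 0 - w)"
    have x: "x \<ge> d" "x > 0" using d that by (force simp: x_def)+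
    have "norm w \<le> x + norm (f 0)" unfolding x_def
      using norm_triangle_ineq4[of "f 0" "f 0 - w"] by simp
    also have "\<dots> \<le> max 1 x * (1 + norm (f 0))"
    proof -
      have "1 * norm (f 0) \<le> max 1 x * norm (f 0)" by (intro mult_right_mono) auto
      then show ?thesis by (simp add: distrib_left)
    qed
    finally have "ln (norm w) \<le> ln (max 1 x * (1 + norm (f 0)))" if "w \<noteq> 0"
      using that by (intro ln_mono) auto
    also have "ln (max 1 x * (1 + norm (f 0))) = ln (max 1 x) + ln (1 + norm (f 0))"
      by (intro ln_mult_pos) (auto simp: add_pos_nonneg)
    finally have 1: "ln (norm w) \<le> ln (max 1 x) + ln (1 + norm (f 0))"
      by (cases "w = 0") auto
    have 2: "0 \<le> ln (max 1 x) + ln (1 + norm (f 0))" by (intro add_nonneg_nonneg ln_ge_zero) auto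
    have "ln (max 1 x) - ln x \<le> max 0 (- ln d)"
      using x d(1) by (auto simp: max_def)
    then show ?thesis using 1 2 unfolding c_def x_def by linarith
  qed
  have main: "finite {z. \<not> is_pole f z \<and> f z = w \<and> norm z \<le> r} \<and>
    real (card {z. \<not> is_pole f z \<and> f z = w \<and> norm z \<le> r}) \<le> ((3 powr q + c) / ln 2) * r powr q"
    if w: "w \<in> julia_set f" and r: "r \<ge> r0" for w r
  proof -
    let ?A = "{z. \<not> is_pole f z \<and> f z = w \<and> norm z \<le> r}"
    have wf: "f 0 \<noteq> w" using d(2)[OF w] d(1) by auto
    \<comment> \<open>The radius is free in an interval so that the circle can avoid poles and
      preimages of \<open>w\<close>.\<close>
    obtain R where R: "2 * r < R" "R < 3 * r" "\<And>z. norm z = R \<Longrightarrow> \<not> is_pole f z \<and> f z \<noteq> w"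
      using exists_good_radius[OF nm np wf, of "2 * r" "3 * r"] r r0(1) by auto
    have A: "\<And>z. z \<in> ?A \<Longrightarrow> \<not> is_pole f z \<and> f z = w \<and> norm z \<le> R" using R r r0(1) by auto
    have Rpos: "0 < R" using R r r0(1) by linarith
    note fm = first_main_inequality[OF nm np wf Rpos R(3) A]
    have "real (card ?A) * ln 2 \<le> (\<Sum>a\<in>?A. ln (R / norm a))"
    proof (rule sum_bounded_below)
      fix a assume a: "a \<in> ?A"
      then have "a \<noteq> 0" using wf by auto
      then have "2 \<le> R / norm a" using a R by (auto simp: field_simps)
      then show "ln 2 \<le> ln (R / norm a)" by (intro ln_mono) auto
    qed
    also have "\<dots> \<le> nevanlinna_char f R + max 0 (ln (norm w)) + ln 2 - ln (norm (f 0 - w))"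
      by (rule fm(2))
    also have "\<dots> \<le> R powr q + c" using c[OF w] r0(2)[of R] R r r0(1) by linarith
    also have "R powr q \<le> (3 * r) powr q" using R Rpos q(1) by (intro powr_mono2) auto
    also have "\<dots> = 3 powr q * r powr q" using r r0(1) by (simp add: powr_mult)
    also have "c \<le> c * r powr q"
      using c0 r r0(1) q(1) ge_one_powr_ge_zero[of r q] mult_left_mono[of 1 "r powr q" c] by simp
    finally have "real (card ?A) * ln 2 \<le> (3 powr q + c) * r powr q" by (simp add: algebra_simps)
    then have "real (card ?A) \<le> ((3 powr q + c) / ln 2) * r powr q" by (simp add: field_simps)
    then show ?thesis using fm(1) by blast
  qed
  define K where "K = (3 powr q + c) / ln 2"
  have K: "K > 0" using c0 by (simp add: K_def add_pos_nonneg)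
  \<comment> \<open>Radii between \<delta> and \<open>r0\<close> are absorbed into the constant,
    because \<open>max r r0\<close> is at most \<open>(1 + r0 / \<delta>) * r\<close>.\<close>
  show thesis
  proof (rule that[of "K * (1 + r0 / \<delta>) powr q"])
    have "1 + r0 / \<delta> > 0" using r0(1) \<delta> by (intro add_pos_nonneg) auto
    then show "K * (1 + r0 / \<delta>) powr q > 0" using K by (intro mult_pos_pos) auto
    fix w r assume w: "w \<in> julia_set f" and r: "\<delta> \<le> r"
    define r' where "r' = max r r0"
    let ?A = "\<lambda>r. {z. \<not> is_pole f z \<and> f z = w \<and> norm z \<le> r}"
    have m: "finite (?A r')" "real (card (?A r')) \<le> K * r' powr q"
      using main[OF w, of r'] by (auto simp: r'_def K_def)
    have sub: "?A r \<subseteq> ?A r'" by (auto simp: r'_def)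
    have "r0 * \<delta> \<le> r0 * r" using r r0(1) by (intro mult_left_mono) auto
    then have "r0 \<le> r0 / \<delta> * r" using \<delta> by (simp add: field_simps)
    moreover have "0 \<le> r0 / \<delta> * r" using r r0(1) \<delta> by simp
    ultimately have "r' \<le> (1 + r0 / \<delta>) * r" using r \<delta> by (simp add: r'_def distrib_right)
    then have "r' powr q \<le> ((1 + r0 / \<delta>) * r) powr q" using q(1) r0(1) by (intro powr_mono2) (auto simp: r'_def)
    also have "\<dots> = (1 + r0 / \<delta>) powr q * r powr q" by (rule powr_mult)
    finally have "K * r' powr q \<le> K * (1 + r0 / \<delta>) powr q * r powr q" using K by simp
    moreover have "card (?A r) \<le> card (?A r')" by (rule card_mono[OF m(1) sub])
    ultimately show "finite (?A r) \<and> real (card (?A r)) \<le> K * (1 + r0 / \<delta>) powr q * r powr q"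
      using m finite_subset[OF sub m(1)] by linarith
  qed
qed


subsection \<open>Returning preimages\<close>

text \<open>A Borel-Caratheodory estimate for coefficients: the coefficients of \<open>cnj h\<close>
  of this frequency vanish, so that of \<open>h\<close> is the coefficient of
  \<open>2 * Re h\<close>. Its absolute value is bounded by the integral of
  \<open>\<bar>2 * Re h\<bar> = 4 * max 0 (Re h) - 2 * Re h\<close>.\<close>

lemma norm_higher_deriv_le_Re:
  assumes h: "h holomorphic_on ball 0 R" and r: "0 < r" "r < R" and n: "0 < n"
    and I: "((\<lambda>\<theta>. max 0 (Re (h (of_real r * cis \<theta>)))) has_integral I) {0..2 * pi}"
  shows "norm ((deriv ^^ n) h 0) * r ^ n \<le> fact n * (2 * I / pi - 2 * Re (h 0))"
proof -
  let ?c = "(deriv ^^ n) h 0 / fact n * of_real r ^ n"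
  let ?h = "\<lambda>\<theta>. h (of_real r * cis \<theta>)"
  have 1: "((\<lambda>\<theta>. ?h \<theta> * cis (- (of_nat n * \<theta>))) has_integral 2 * pi * ?c) {0..2 * pi}"
    by (rule has_integral_circle_holomorphic[OF h r])
  have "(cnj \<circ> (\<lambda>\<theta>. ?h \<theta> * cis (of_nat n * \<theta>)) has_integral cnj 0) {0..2 * pi}"
    by (subst has_integral_cnj) (rule has_integral_circle_holomorphic_cis[OF h r n])
  with 1 have 2: "((\<lambda>\<theta>. ?h \<theta> * cis (- (of_nat n * \<theta>)) + (cnj \<circ> (\<lambda>\<theta>. ?h \<theta> * cis (of_nat n * \<theta>))) \<theta>)
      has_integral 2 * pi * ?c + cnj 0) {0..2 * pi}"
    by (rule has_integral_add)
  have eq: "?h \<theta> * cis (- (of_nat n * \<theta>)) + (cnj \<circ> (\<lambda>\<theta>. ?h \<theta> * cis (of_nat n * \<theta>))) \<theta>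
     = of_real (2 * Re (?h \<theta>)) * cis (- (of_nat n * \<theta>))" for \<theta>
  proof -
    have "?h \<theta> + cnj (?h \<theta>) = of_real (2 * Re (?h \<theta>))" by (rule complex_add_cnj)
    then show ?thesis by (simp add: cis_cnj flip: distrib_right)
  qed
  have "((\<lambda>\<theta>. ?h \<theta>) has_integral 2 * pi * h 0) {0..2 * pi}"
    using has_integral_circle_holomorphic[OF h r, of 0] by simp
  from has_integral_Re[OF this] have "((\<lambda>\<theta>. Re (?h \<theta>)) has_integral 2 * pi * Re (h 0)) {0..2 * pi}"
    by simp
  from has_integral_diff[OF has_integral_mult_right[OF I, of 4] has_integral_mult_right[OF this, of 2]]
  have 3: "((\<lambda>\<theta>. 4 * max 0 (Re (?h \<theta>)) - 2 * Re (?h \<theta>)) has_integral 4 * I - 2 * (2 * pi * Re (h 0))) {0..2 * pi}" .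
  have 4: "((\<lambda>\<theta>. of_real (2 * Re (?h \<theta>)) * cis (- (of_nat n * \<theta>))) has_integral 2 * pi * ?c) {0..2 * pi}"
    using 2 unfolding eq by simp
  have "norm (integral {0..2 * pi} (\<lambda>\<theta>. of_real (2 * Re (?h \<theta>)) * cis (- (of_nat n * \<theta>))))
      \<le> integral {0..2 * pi} (\<lambda>\<theta>. 4 * max 0 (Re (?h \<theta>)) - 2 * Re (?h \<theta>))"
  proof (rule Henstock_Kurzweil_Integration.integral_norm_bound_integral)
    show "norm (of_real (2 * Re (?h \<theta>)) * cis (- (of_nat n * \<theta>))) \<le> 4 * max 0 (Re (?h \<theta>)) - 2 * Re (?h \<theta>)" for \<theta>
      unfolding norm_mult norm_cis norm_of_real by linarith
  qed (use 3 4 in \<open>blast intro: has_integral_integrable\<close>)+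
  then have "norm (2 * pi * ?c) \<le> 4 * I - 2 * (2 * pi * Re (h 0))"
    using 3 4 by (simp only: integral_unique)
  moreover have "norm (2 * pi * ?c) = 2 * pi * (norm ((deriv ^^ n) h 0) * r ^ n / fact n)"
    using r by (simp add: norm_mult norm_divide norm_power)
  ultimately have "2 * pi * (norm ((deriv ^^ n) h 0) * r ^ n / fact n) \<le> 4 * I - 2 * (2 * pi * Re (h 0))"
    by (simp only:)
  then have "norm ((deriv ^^ n) h 0) * r ^ n / fact n \<le> (4 * I - 2 * (2 * pi * Re (h 0))) / (2 * pi)"
    by (subst pos_le_divide_eq) (simp_all add: mult.commute)
  also have "\<dots> = 2 * I / pi - 2 * Re (h 0)" by (simp add: field_simps)
  finally show ?thesis by (simp add: pos_divide_le_eq mult.commute)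
qed

text \<open>The real part of \<open>h = log (f - w)\<close> has mean \<open>log |f 0 - w|\<close> on circles, so its positive part, which
  the proximity function bounds, controls all Taylor coefficients of \<open>h\<close>.\<close>

lemma omitted_value_log:
  assumes f: "f holomorphic_on UNIV" and r: "0 < r" "r < R" and w: "\<And>z. norm z < R \<Longrightarrow> f z \<noteq> w"
  obtains h where "h holomorphic_on ball 0 R" "\<And>z. norm z < R \<Longrightarrow> deriv h z * (f z - w) = deriv f z"
    "\<And>n. 0 < n \<Longrightarrow> norm ((deriv ^^ n) h 0) * r ^ n \<le>
       fact n * (4 * (nevanlinna_char f r + max 0 (ln (norm w)) + ln 2) - 2 * ln (norm (f 0 - w)))"
proof -
  have hol: "(\<lambda>z. f z - w) holomorphic_on ball 0 R"
    by (intro holomorphic_intros holomorphic_on_subset[OF f]) auto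
  have nz: "f z - w \<noteq> 0" if "z \<in> ball 0 R" for z using w that by simp
  have "0 \<in> ball (0::complex) R" using r by simp
  then obtain h where h: "h holomorphic_on ball 0 R" "\<And>z. z \<in> ball 0 R \<Longrightarrow> exp (h z) = f z - w"
    using holomorphic_logarithm_exists[OF convex_ball open_ball hol nz] by blast
  have Re: "Re (h z) = ln (norm (f z - w))" if "norm z < R" for z
    using h(2)[of z] that by (metis norm_exp_eq_Re ln_exp mem_ball_0)
  have d: "deriv h z * (f z - w) = deriv f z" if z: "norm z < R" for z
  proof -
    have "h field_differentiable at z"
      using h(1) z holomorphic_on_imp_differentiable_at[of h "ball 0 R" z] by simp
    then have "((\<lambda>z. exp (h z)) has_field_derivative exp (h z) * deriv h z) (at z)"
      by (auto intro!: derivative_eq_intros simp: field_differentiable_derivI)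
    then have "((\<lambda>z. f z - w) has_field_derivative exp (h z) * deriv h z) (at z)"
      by (rule has_field_derivative_transform_within_open[where S = "ball 0 R"]) (use z h in auto)
    then have "((\<lambda>z. (f z - w) + w) has_field_derivative exp (h z) * deriv h z + 0) (at z)"
      by (intro DERIV_add DERIV_const)
    then have "deriv f z = exp (h z) * deriv h z" by (intro DERIV_imp_deriv) simp
    then show ?thesis using h(2)[of z] z by (simp add: mult.commute)
  qed
  have np: "\<not> is_pole f z" for z
    using f by (intro not_is_pole_holomorphic[of UNIV]) auto
  have nm: "f nicely_meromorphic_on UNIV"
    using f by (intro analytic_on_imp_nicely_meromorphic_on) (simp add: analytic_on_open)
  \<comment> \<open>An entire function has no poles to count, so the characteristic reduces to the
    proximity function.\<close>
  have T: "nevanlinna_char f r = proximity_fun f r"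
    unfolding nevanlinna_char_def by (subst counting_fun_eq[OF nm np r(1)]) (use np in simp)
  define g where "g \<theta> = max 0 (ln (norm (f (of_real r * cis \<theta>))))" for \<theta>
  define k where "k \<theta> = max 0 (Re (h (of_real r * cis \<theta>)))" for \<theta>
  have cr: "norm (of_real r * cis \<theta>) = r" for \<theta> using r by (simp add: norm_mult)
  have "continuous_on {0..2 * pi} (\<lambda>\<theta>. f (of_real r * cis \<theta>))"
    by (intro continuous_on_compose2[OF holomorphic_on_imp_continuous_on[OF f]] continuous_intros) auto
  then have gi: "(g has_integral 2 * pi * proximity_fun f r) {0..2 * pi}"
    unfolding g_def by (rule has_integral_proximity_fun)
  have ci: "((\<lambda>_. max 0 (ln (norm w)) + ln 2) has_integral 2 * pi * (max 0 (ln (norm w)) + ln 2)) {0..2 * pi}"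
    using has_integral_const_real[of "max 0 (ln (norm w)) + ln 2" 0 "2 * pi"] by simp
  have "continuous_on {0..2 * pi} (\<lambda>\<theta>. h (of_real r * cis \<theta>))"
    using r cr by (intro continuous_on_compose2[OF holomorphic_on_imp_continuous_on[OF h(1)]] continuous_intros) auto
  then have "k integrable_on {0..2 * pi}"
    unfolding k_def by (intro integrable_continuous_real continuous_intros)
  then have ki: "(k has_integral integral {0..2 * pi} k) {0..2 * pi}" by blast
  have "integral {0..2 * pi} k \<le> 2 * pi * proximity_fun f r + 2 * pi * (max 0 (ln (norm w)) + ln 2)"
  proof (rule has_integral_le[OF ki has_integral_add[OF gi ci]])
    fix \<theta>
    let ?x = "f (of_real r * cis \<theta>)"
    have "norm (of_real r * cis \<theta>) < R" using cr r by simp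
    then have "?x \<noteq> w" and e: "Re (h (of_real r * cis \<theta>)) = ln (norm (?x - w))" using w Re by blast+
    then show "k \<theta> \<le> g \<theta> + (max 0 (ln (norm w)) + ln 2)"
      using ln_norm_diff_le[of ?x w] unfolding k_def g_def e by simp
  qed
  then have I: "2 * integral {0..2 * pi} k / pi \<le> 4 * (nevanlinna_char f r + max 0 (ln (norm w)) + ln 2)"
    by (simp add: T field_simps)
  have "norm ((deriv ^^ n) h 0) * r ^ n \<le>
       fact n * (4 * (nevanlinna_char f r + max 0 (ln (norm w)) + ln 2) - 2 * ln (norm (f 0 - w)))" if n: "0 < n" for n
  proof -
    have "norm ((deriv ^^ n) h 0) * r ^ n \<le> fact n * (2 * integral {0..2 * pi} k / pi - 2 * Re (h 0))"
      using ki unfolding k_def by (intro norm_higher_deriv_le_Re[OF h(1) r n])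
    also have "\<dots> \<le> fact n * (4 * (nevanlinna_char f r + max 0 (ln (norm w)) + ln 2) - 2 * ln (norm (f 0 - w)))"
      using I Re[of 0] r by (intro mult_left_mono) auto
    finally show ?thesis .
  qed
  then show thesis using that h(1) d by blast
qed

text \<open>The images of the discs of integer radius, with poles removed, are open and exhaust the
  Julia set; finitely many cover its compact part.\<close>

lemma compact_julia_preimages_bounded:
  assumes f: "transcendental_meromorphic f"
    and surj: "\<And>w. w \<in> julia_set f \<Longrightarrow> \<exists>z. \<not> is_pole f z \<and> f z = w"
  shows "\<exists>N::nat. \<forall>w\<in>julia_set f. norm w \<le> B \<longrightarrow> (\<exists>z. \<not> is_pole f z \<and> f z = w \<and> norm z \<le> real N)"
proof -
  note nm = transcendental_nicely_meromorphic[OF f]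
  let ?K = "julia_set f \<inter> cball 0 B"
  let ?U = "\<lambda>n::nat. f ` ({z. \<not> is_pole f z} \<inter> ball 0 (real n))"
  have "compact ?K" using closed_julia_set by (intro closed_Int_compact) auto
  moreover have "open (?U n)" for n
    using open_nonpoles[OF nm] by (intro transcendental_open_map[OF f]) auto
  moreover have "?K \<subseteq> (\<Union>n\<in>UNIV. ?U n)"
  proof
    fix w assume "w \<in> ?K"
    then obtain z where z: "\<not> is_pole f z" "f z = w" using surj by blast
    obtain n :: nat where "norm z < n" using reals_Archimedean2 by blast
    then have "w \<in> ?U n" using z by auto
    then show "w \<in> (\<Union>n\<in>UNIV. ?U n)" by blast
  qed
  ultimately obtain C where C: "finite C" "?K \<subseteq> (\<Union>n\<in>C. ?U n)"
    using compactE_image[of ?K UNIV ?U] by metis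
  have "\<exists>z. \<not> is_pole f z \<and> f z = w \<and> norm z \<le> real (Max C)" if w: "w \<in> julia_set f" "norm w \<le> B" for w
  proof -
    have "w \<in> ?K" using w by simp
    then obtain n z where n: "n \<in> C" "\<not> is_pole f z" "f z = w" "norm z < real n" using C(2) by auto
    have "n \<le> Max C" using C(1) n(1) by simp
    then have "norm z \<le> real (Max C)" using n(4) by linarith
    then show ?thesis using n by blast
  qed
  then show ?thesis by blast
qed

text \<open>Near the pole, \<open>1 / f\<close> extends as the nonconstant holomorphic function
  \<open>v / u\<close> with value 0, whose image contains a neighbourhood of 0.\<close>

lemma preimages_near_pole:
  assumes f: "transcendental_meromorphic f" and p: "is_pole f p"
  shows "\<exists>R0. \<forall>w. norm w > R0 \<longrightarrow> (\<exists>z. \<not> is_pole f z \<and> f z = w \<and> norm z \<le> norm p + 1)"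
proof -
  obtain u v where u: "u holomorphic_on UNIV" and v: "v holomorphic_on UNIV"
    "\<And>z. v z = 0 \<longleftrightarrow> is_pole f z" and up: "\<And>z. is_pole f z \<Longrightarrow> u z \<noteq> 0" and fuv: "\<And>z. f z = u z / v z"
    using nicely_meromorphic_quotient[OF transcendental_nicely_meromorphic[OF f]] by metis
  have "isCont u p" using u holomorphic_on_imp_continuous_on continuous_on_eq_continuous_at open_UNIV by blast
  then obtain e0 where e0: "e0 > 0" "\<And>z. dist z p < e0 \<Longrightarrow> u z \<noteq> 0"
    using continuous_at_avoid[of p u 0] up[OF p] by (metis dist_commute)
  define e where "e = min e0 1"
  have e: "e > 0" "e \<le> 1" "\<And>z. z \<in> ball p e \<Longrightarrow> u z \<noteq> 0"
    using e0 by (auto simp: e_def dist_commute)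
  define g where "g z = v z / u z" for z
  have g: "g holomorphic_on ball p e"
    unfolding g_def using e(3) by (intro holomorphic_on_divide holomorphic_on_subset[OF u] holomorphic_on_subset[OF v(1)]) auto
  have gp: "g p = 0" using v(2) p by (simp add: g_def)
  have "\<not> g constant_on ball p e"
  proof
    assume "g constant_on ball p e"
    then have "g z = 0" if "z \<in> ball p e" for z
      using that e(1) gp by (metis centre_in_ball constant_on_def)
    then have "f z = 0" if "z \<in> ball p e" for z
      using that e(3) by (auto simp: g_def fuv)
    then have "f constant_on ball p e" by (auto simp: constant_on_def)
    then show False using transcendental_not_constant_on[OF f, of "ball p e"] e(1) by simp
  qed
  then have "open (g ` ball p e)" by (intro open_mapping_thm[OF g]) auto
  then obtain \<epsilon> where \<epsilon>: "\<epsilon> > 0" "ball (g p) \<epsilon> \<subseteq> g ` ball p e"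
    using openE[of "g ` ball p e" "g p"] e(1) by auto
  have "\<exists>z. \<not> is_pole f z \<and> f z = w \<and> norm z \<le> norm p + 1" if w: "norm w > 1 / \<epsilon>" for w
  proof -
    have w0: "norm w > 0" using w \<epsilon>(1) order.strict_trans zero_less_divide_1_iff by metis
    then have "1 / w \<in> ball (g p) \<epsilon>" using w \<epsilon>(1) by (simp add: gp norm_divide field_simps)
    then obtain z where z: "z \<in> ball p e" "1 / w = v z / u z" using \<epsilon>(2) by (auto simp: g_def)
    have "v z \<noteq> 0" using z w0 e(3)[OF z(1)] by auto
    then have "\<not> is_pole f z" using v(2) by blast
    moreover have "f z = w" using z(2) w0 e(3)[OF z(1)] \<open>v z \<noteq> 0\<close> by (auto simp: fuv field_simps)
    moreover have "norm z \<le> norm p + 1"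
      using z(1) e(2) norm_triangle_ineq2[of z p] by (simp add: dist_norm norm_minus_commute)
    ultimately show ?thesis by blast
  qed
  then show ?thesis by blast
qed

lemma transcendental_higher_deriv_nonzero:
  assumes f: "transcendental_meromorphic f" "f holomorphic_on UNIV"
  shows "\<exists>n\<ge>N. (deriv ^^ n) f 0 \<noteq> 0"
proof (rule ccontr)
  assume "\<not> (\<exists>n\<ge>N. (deriv ^^ n) f 0 \<noteq> 0)"
  then have z: "(deriv ^^ n) f 0 = 0" if "n \<ge> N" for n using that by blast
  define p where "p = (\<Sum>k<N. monom ((deriv ^^ k) f 0 / fact k) k)"
  have "f z = poly p z" for z
  proof -
    have "((\<lambda>n. (deriv ^^ n) f 0 / fact n * (z - 0) ^ n) sums f z)"
      by (rule holomorphic_power_series[where r = "norm z + 1"]) (auto intro: holomorphic_on_subset[OF f(2)])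
    moreover have "((\<lambda>n. (deriv ^^ n) f 0 / fact n * (z - 0) ^ n) sums (\<Sum>n<N. (deriv ^^ n) f 0 / fact n * (z - 0) ^ n))"
      by (rule sums_finite) (use z in auto)
    ultimately have "f z = (\<Sum>n<N. (deriv ^^ n) f 0 / fact n * (z - 0) ^ n)" by (rule sums_unique2)
    then show ?thesis by (simp add: p_def poly_sum poly_monom)
  qed
  then have "\<forall>z. poly 1 z \<noteq> 0 \<longrightarrow> f z = poly p z / poly 1 z" by simp
  then show False using f(1) unfolding transcendental_meromorphic_def by (metis one_neq_zero)
qed

text \<open>If \<open>f\<close> omits values \<open>w\<close> of modulus at most \<open>R\<close> on the disc of radius \<open>R\<close>, with
  \<open>R\<close> and \<open>w\<close> tending to infinity, then \<open>h = log (f - w)\<close> satisfies \<open>w h' + f' = h' f\<close>, which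
  tends to 0, while the high Taylor coefficients of \<open>w h'\<close> tend to 0 by the finite order of \<open>f\<close>.\<close>

lemma entire_return_radius:
  assumes f: "transcendental_meromorphic f" "f holomorphic_on UNIV"
    and F0: "0 \<in> fatou_set f" and q: "order_of_growth f < ereal q"
    and surj: "\<And>w. w \<in> julia_set f \<Longrightarrow> \<exists>z. \<not> is_pole f z \<and> f z = w"
  shows "\<exists>R\<ge>B. \<forall>w\<in>julia_set f. norm w \<le> R \<longrightarrow> (\<exists>z. \<not> is_pole f z \<and> f z = w \<and> norm z \<le> R)"
proof (rule ccontr)
  assume contr: "\<not> ?thesis"
  have np: "\<not> is_pole f z" for z
    using f(2) by (intro not_is_pole_holomorphic[of UNIV]) auto
  obtain d where d: "d > 0" "\<And>w. w \<in> julia_set f \<Longrightarrow> norm (f 0 - w) \<ge> d"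
    using julia_set_away_from_value_at_0[OF f(1) F0] by blast
  obtain r0 where r0: "r0 \<ge> 1" "\<And>r. r \<ge> r0 \<Longrightarrow> nevanlinna_char f r \<le> r powr q"
    using nevanlinna_char_le_powr[OF q] by blast
  \<comment> \<open>An integer exponent allows comparison with Taylor coefficients.\<close>
  define N where "N = Suc (nat \<lceil>q\<rceil>)"
  have N: "q \<le> real N" "N \<ge> 1" unfolding N_def by linarith+
  \<comment> \<open>The summands come from the characteristic, from
    \<open>4 * max 0 (ln (norm w)) \<le> 8 * r\<close>, and from the terms that depend on neither
    \<open>r\<close> nor \<open>w\<close>.\<close>
  define K where "K = 4 + 8 + 4 * ln 2 + 2 * \<bar>ln d\<bar>"
  have K: "K > 0" unfolding K_def using ln_gt_zero[of 2] by linarith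
  have E: "4 * (nevanlinna_char f r + max 0 (ln (norm w)) + ln 2) - 2 * ln (norm (f 0 - w)) \<le> K * r ^ N"
    if r: "r \<ge> r0" and w: "w \<in> julia_set f" "norm w \<le> 2 * r" for r w
  proof -
    have r1: "r \<ge> 1" using r r0 by linarith
    have "nevanlinna_char f r \<le> r powr q" using r0 r by blast
    also have "\<dots> \<le> r powr real N" using r1 N by (intro powr_mono) auto
    also have "\<dots> = r ^ N" using r1 by (simp add: powr_realpow)
    finally have 1: "nevanlinna_char f r \<le> r ^ N" .
    have "ln (norm w) \<le> norm w" using ln_le_minus_one[of "norm w"] by (cases "w = 0") auto
    then have 2: "max 0 (ln (norm w)) \<le> 2 * r" using w r1 by linarith
    have rN: "r \<le> r ^ N" "1 \<le> r ^ N" using r1 N by (auto intro: self_le_power)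
    have "ln d \<le> ln (norm (f 0 - w))" using d w by (intro ln_mono) auto
    then have 3: "- 2 * ln (norm (f 0 - w)) \<le> 2 * \<bar>ln d\<bar>" by linarith
    define D where "D = 4 * ln 2 + 2 * \<bar>ln d\<bar>"
    have D: "D \<ge> 0" unfolding D_def by (intro add_nonneg_nonneg) auto
    have 4: "D * 1 \<le> D * r ^ N" using rN D by (intro mult_left_mono) auto
    have "4 * (nevanlinna_char f r + max 0 (ln (norm w)) + ln 2) - 2 * ln (norm (f 0 - w))
        \<le> 4 * r ^ N + 8 * r + D"
    proof -
      have aux: "4 * (T + t + l) - 2 * s \<le> 4 * A + 8 * r' + (4 * l + x)"
        if "T \<le> A" "t \<le> 2 * r'" "- 2 * s \<le> x" for T t l s A r' x :: real
        using that by (simp add: algebra_simps)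
      show ?thesis unfolding D_def by (rule aux[OF 1 2 3])
    qed
    also have "\<dots> \<le> 4 * r ^ N + 8 * r ^ N + D * r ^ N" using 4 rN by linarith
    also have "\<dots> = K * r ^ N" by (simp add: K_def D_def algebra_simps)
    finally show ?thesis .
  qed
  have "compact (f ` cball 0 1 \<union> deriv f ` cball 0 1)"
    using f(2) by (intro compact_Un compact_continuous_image holomorphic_on_imp_continuous_on
      holomorphic_on_subset[OF f(2)] holomorphic_on_subset[OF holomorphic_deriv[OF f(2)]]) auto
  then have "bounded (f ` cball 0 1 \<union> deriv f ` cball 0 1)" by (rule compact_imp_bounded)
  then obtain M where M0: "M > 0" "\<forall>x\<in>f ` cball 0 1 \<union> deriv f ` cball 0 1. norm x \<le> M"
    unfolding bounded_pos by blast
  have M: "M > 0" "\<And>z. norm z \<le> 1 \<Longrightarrow> norm (f z) \<le> M" "\<And>z. norm z \<le> 1 \<Longrightarrow> norm (deriv f z) \<le> M"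
    using M0 by auto
  \<comment> \<open>Two powers of \<open>r\<close> are spare: one offsets the factor
    \<open>norm w \<le> 2 * r\<close>, the other makes the product small.\<close>
  obtain n where n: "n \<ge> N + 2" "(deriv ^^ n) f 0 \<noteq> 0"
    using transcendental_higher_deriv_nonzero[OF f] by blast
  obtain m where m: "n = Suc m" using n(1) by (cases n) auto
  define L where "L = norm ((deriv ^^ n) f 0)"
  have L: "L > 0" using n(2) by (simp add: L_def)
  \<comment> \<open>The first entry gives \<open>norm (f z - w) \<ge> norm w / 2\<close> on the unit
    disc; the second makes the Cauchy estimate for \<open>G\<close> below smaller than
    \<open>L / 2\<close>.\<close>
  define W where "W = max (2 * M) (4 * fact m * M\<^sup>2 / L)"
  obtain N0 :: nat where N0: "\<And>w. w \<in> julia_set f \<Longrightarrow> norm w \<le> W \<Longrightarrow> \<exists>z. \<not> is_pole f z \<and> f z = w \<and> norm z \<le> real N0"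
    using compact_julia_preimages_bounded[OF f(1) surj, of W] by blast
  \<comment> \<open>By \<open>N0\<close>, a Julia point omitted on the disc of radius
    \<open>2 * r\<close> must have modulus above \<open>W\<close>. The last entry makes the
    coefficient estimate of \<open>h\<close>, multiplied by \<open>norm w\<close>, smaller than
    \<open>L / 2\<close>.\<close>
  define r where "r = Max {B, r0, real N0, 1, 4 * fact n * K / L + 1}"
  have r: "r \<ge> B" "r \<ge> r0" "r \<ge> real N0" "r \<ge> 1" "r > 4 * fact n * K / L"
    unfolding r_def by (auto simp: less_max_iff_disj le_max_iff_disj)
  have "2 * r \<ge> B" using r by linarith
  with contr obtain w where w: "w \<in> julia_set f" "norm w \<le> 2 * r" "\<And>z. norm z \<le> 2 * r \<Longrightarrow> f z \<noteq> w"
    using np by metis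
  have wW: "norm w > W"
  proof (rule ccontr)
    assume "\<not> norm w > W"
    then obtain z where "f z = w" "norm z \<le> real N0" using N0[OF w(1)] by auto
    then show False using w(3)[of z] r by linarith
  qed
  then have w2M: "norm w > 2 * M" and wL: "norm w > 4 * fact m * M\<^sup>2 / L" by (auto simp: W_def)
  then have w0: "norm w > 0" using M(1) by linarith
  obtain h where h: "h holomorphic_on ball 0 (2 * r)"
    "\<And>z. norm z < 2 * r \<Longrightarrow> deriv h z * (f z - w) = deriv f z"
    "\<And>n. 0 < n \<Longrightarrow> norm ((deriv ^^ n) h 0) * r ^ n \<le>
       fact n * (4 * (nevanlinna_char f r + max 0 (ln (norm w)) + ln 2) - 2 * ln (norm (f 0 - w)))"
    using omitted_value_log[OF f(2), of r "2 * r" w] w(3) r by (smt (verit, best))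
  have dh: "deriv h holomorphic_on ball 0 (2 * r)" using h(1) by (intro holomorphic_deriv) auto
  have df: "deriv f holomorphic_on ball 0 (2 * r)"
    by (rule holomorphic_on_subset[OF holomorphic_deriv[OF f(2)]]) auto
  have t1: "norm w * norm ((deriv ^^ n) h 0) < L / 2"
  proof -
    have "norm ((deriv ^^ n) h 0) * r ^ n \<le> fact n * (K * r ^ N)"
      using h(3)[of n] m E[OF r(2) w(1,2)] by (meson fact_ge_zero mult_left_mono order_trans zero_less_Suc)
    moreover have "r ^ n = r ^ N * r ^ (n - N)" using n(1) by (simp flip: power_add)
    moreover have "r ^ 2 \<le> r ^ (n - N)" using n(1) r(4) by (intro power_increasing) auto
    moreover have rN: "r ^ N > 0" using r by simp
    ultimately have "norm ((deriv ^^ n) h 0) * r ^ (n - N) * r ^ N \<le> fact n * K * r ^ N"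
      by (simp add: algebra_simps)
    then have "norm ((deriv ^^ n) h 0) * r ^ (n - N) \<le> fact n * K" using rN by simp
    moreover have "norm ((deriv ^^ n) h 0) * r ^ 2 \<le> norm ((deriv ^^ n) h 0) * r ^ (n - N)"
      using \<open>r ^ 2 \<le> r ^ (n - N)\<close> by (intro mult_left_mono) auto
    ultimately have "norm ((deriv ^^ n) h 0) * r * r \<le> fact n * K" by (simp add: power2_eq_square mult.assoc)
    then have "norm ((deriv ^^ n) h 0) * r \<le> fact n * K / r" using r by (simp add: field_simps)
    also have "\<dots> < L / 4" using r L K by (simp add: field_simps)
    finally have "2 * (norm ((deriv ^^ n) h 0) * r) < L / 2" by simp
    moreover have "norm w * norm ((deriv ^^ n) h 0) \<le> 2 * r * norm ((deriv ^^ n) h 0)"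
      using w(2) by (intro mult_right_mono) auto
    ultimately show ?thesis by (simp add: algebra_simps)
  qed
  \<comment> \<open>On the unit disc \<open>G = deriv h * f\<close> is of size
    \<open>1 / norm w\<close>, yet its derivative of order \<open>m = n - 1\<close> at 0 differs
    from the nonzero \<open>(deriv ^^ n) f 0\<close> only by \<open>w * (deriv ^^ n) h 0\<close>.
    Both being small is the contradiction.\<close>
  define G where "G z = w * deriv h z + deriv f z" for z
  have G: "G holomorphic_on ball 0 (2 * r)"
    unfolding G_def by (intro holomorphic_on_add holomorphic_on_mult holomorphic_on_const dh df)
  have sub: "cball 0 1 \<subseteq> ball (0::complex) (2 * r)" using r by auto
  have "norm ((deriv ^^ m) G 0) \<le> fact m * (2 * M\<^sup>2 / norm w) / 1 ^ m"
  proof (rule Cauchy_inequality)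
    show "G holomorphic_on ball 0 1" using G sub ball_subset_cball by (blast intro: holomorphic_on_subset)
    show "continuous_on (cball 0 1) G" using G sub by (blast intro: holomorphic_on_subset holomorphic_on_imp_continuous_on)
    fix z :: complex assume "norm (0 - z) = 1"
    then have z: "norm z \<le> 1" "norm z < 2 * r" using r by auto
    have "G z = deriv h z * f z" unfolding G_def h(2)[OF z(2), symmetric] by (simp add: algebra_simps)
    moreover have "norm (deriv h z) \<le> 2 * M / norm w"
    proof -
      have "norm w / 2 \<le> norm (f z - w)"
        using norm_triangle_ineq2[of w "f z"] M(2)[OF z(1)] w2M by (simp add: norm_minus_commute)
      then have "norm (deriv h z) * (norm w / 2) \<le> norm (deriv h z) * norm (f z - w)"
        by (intro mult_left_mono) auto
      also have "\<dots> = norm (deriv f z)" by (simp flip: h(2)[OF z(2)] add: norm_mult)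
      also have "\<dots> \<le> M" by (rule M(3)[OF z(1)])
      finally show ?thesis using w0 by (simp add: field_simps)
    qed
    ultimately have "norm (G z) \<le> 2 * M / norm w * M"
      unfolding norm_mult using M(1) M(2)[OF z(1)] w0 by (simp only: norm_mult) (intro mult_mono, auto)
    then show "norm (G z) \<le> 2 * M\<^sup>2 / norm w" by (simp add: power2_eq_square)
  qed simp
  then have t2: "norm ((deriv ^^ m) G 0) \<le> fact m * (2 * M\<^sup>2 / norm w)" by simp
  have "fact m * (2 * M\<^sup>2 / norm w) < L / 2" using wL w0 L by (simp add: field_simps)
  with t2 have t3: "norm ((deriv ^^ m) G 0) < L / 2" by linarith
  have "(deriv ^^ m) G 0 = (deriv ^^ m) (\<lambda>z. w * deriv h z) 0 + (deriv ^^ m) (deriv f) 0"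
    unfolding G_def using r
    by (intro higher_deriv_add[of _ "ball 0 (2 * r)"] holomorphic_on_mult holomorphic_on_const dh df) auto
  also have "(deriv ^^ m) (\<lambda>z. w * deriv h z) 0 = w * (deriv ^^ m) (deriv h) 0"
    using r dh by (intro higher_deriv_cmult[of _ "ball 0 (2 * r)"]) auto
  also have "(deriv ^^ m) (deriv h) = (deriv ^^ n) h" unfolding m by (simp only: funpow_Suc_right o_apply)
  also have "(deriv ^^ m) (deriv f) = (deriv ^^ n) f" unfolding m by (simp only: funpow_Suc_right o_apply)
  finally have "(deriv ^^ n) f 0 = (deriv ^^ m) G 0 - w * (deriv ^^ n) h 0" by simp
  then have "L \<le> norm ((deriv ^^ m) G 0) + norm (w * (deriv ^^ n) h 0)"
    unfolding L_def by (simp only: norm_triangle_ineq4)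
  then show False using t1 t3 by (simp add: norm_mult)
qed

text \<open>If there is a pole, its neighbourhood supplies preimages of all large values and
  compactness supplies the rest.\<close>

lemma exists_return_radius:
  assumes f: "transcendental_meromorphic f"
    and F0: "0 \<in> fatou_set f" and q: "order_of_growth f < ereal q"
    and surj: "\<And>w. w \<in> julia_set f \<Longrightarrow> \<exists>z. \<not> is_pole f z \<and> f z = w"
  shows "\<exists>R\<ge>B. \<forall>w\<in>julia_set f. norm w \<le> R \<longrightarrow> (\<exists>z. \<not> is_pole f z \<and> f z = w \<and> norm z \<le> R)"
proof (cases "\<exists>p. is_pole f p")
  case True
  then obtain p where p: "is_pole f p" by blast
  obtain R0 where R0: "\<And>w. norm w > R0 \<Longrightarrow> \<exists>z. \<not> is_pole f z \<and> f z = w \<and> norm z \<le> norm p + 1"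
    using preimages_near_pole[OF f p] by blast
  obtain N0 :: nat where N0: "\<And>w. w \<in> julia_set f \<Longrightarrow> norm w \<le> R0 \<Longrightarrow> \<exists>z. \<not> is_pole f z \<and> f z = w \<and> norm z \<le> real N0"
    using compact_julia_preimages_bounded[OF f surj, of R0] by blast
  define R where "R = max B (max (norm p + 1) (real N0))"
  have R: "R \<ge> B" "R \<ge> norm p + 1" "R \<ge> real N0" by (auto simp: R_def)
  have "\<exists>z. \<not> is_pole f z \<and> f z = w \<and> norm z \<le> R" if "w \<in> julia_set f" for w
    using R0[of w] N0[OF that] R by (meson linorder_not_le order_trans)
  then show ?thesis using R(1) by blast
next
  case False
  then have "f holomorphic_on UNIV"
    using holomorphic_on_nonpoles[OF transcendental_nicely_meromorphic[OF f]] by simp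
  then show ?thesis by (rule entire_return_radius[OF f _ F0 q surj])
qed


subsection \<open>Transfer operators and almost conformal discrete measures\<close>

text \<open>This turns the unordered sums of the transfer operator into integrals, for which
  exchange of summation and monotone convergence are available.\<close>

lemma infsum_eq_nn_integral_count_space:
  fixes g :: "'a \<Rightarrow> ennreal"
  assumes "countable A"
  shows "(\<Sum>\<^sub>\<infinity>x\<in>A. g x) = (\<integral>\<^sup>+x. g x \<partial>count_space A)"
proof (cases "finite A")
  case True
  then show ?thesis by (simp add: nn_integral_count_space_finite)
next
  case False
  let ?e = "from_nat_into A"
  have bij: "bij_betw ?e UNIV A" using assms False by (rule bij_betw_from_nat_into)
  have fin: "sum g F \<le> (\<integral>\<^sup>+x. g x \<partial>count_space A)" if F: "finite F" "F \<subseteq> A" for F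
  proof -
    have "sum g F = (\<integral>\<^sup>+x. g x \<partial>count_space F)" using F by (simp add: nn_integral_count_space_finite)
    also have "\<dots> = (\<integral>\<^sup>+x. g x * indicator F x \<partial>count_space UNIV)" by (rule nn_integral_count_space_indicator) simp
    also have "\<dots> \<le> (\<integral>\<^sup>+x. g x * indicator A x \<partial>count_space UNIV)"
      using F by (intro nn_integral_mono) (auto split: split_indicator)
    also have "\<dots> = (\<integral>\<^sup>+x. g x \<partial>count_space A)" by (rule nn_integral_count_space_indicator[symmetric]) simp
    finally show ?thesis .
  qed
  have inf: "(\<Sum>\<^sub>\<infinity>x\<in>A. g x) = (SUP F\<in>{F. finite F \<and> F \<subseteq> A}. sum g F)"
    by (rule nonneg_infsum_complete) simp
  have "(\<integral>\<^sup>+x. g x \<partial>count_space A) = (\<Sum>n. g (?e n))"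
    by (simp add: nn_integral_bij_count_space[OF bij, symmetric] nn_integral_count_space_nat)
  also have "\<dots> = (SUP n. \<Sum>i<n. g (?e i))" by (rule suminf_eq_SUP)
  also have "\<dots> \<le> (SUP F\<in>{F. finite F \<and> F \<subseteq> A}. sum g F)"
  proof (rule SUP_mono)
    fix n
    have "inj_on ?e {..<n}" using bij by (meson bij_betw_def inj_on_subset subset_UNIV)
    then have "(\<Sum>i<n. g (?e i)) = sum g (?e ` {..<n})" by (simp add: sum.reindex)
    moreover have "?e ` {..<n} \<subseteq> A" using bij by (auto simp: bij_betw_def)
    ultimately show "\<exists>F\<in>{F. finite F \<and> F \<subseteq> A}. (\<Sum>i<n. g (?e i)) \<le> sum g F"
      by (intro bexI[of _ "?e ` {..<n}"]) auto
  qed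
  finally show ?thesis unfolding inf using fin by (intro antisym SUP_least) auto
qed

text \<open>The condition on preimages is an indicator rather than a domain, so that iterated sums
  run over one fixed space and can be exchanged.\<close>

definition ruelle_op :: "('a \<Rightarrow> ennreal) \<Rightarrow> ('a \<Rightarrow> 'a) \<Rightarrow> ('a \<Rightarrow> ennreal) \<Rightarrow> 'a \<Rightarrow> ennreal" where
  "ruelle_op k f \<phi> w = (\<integral>\<^sup>+z. k z * indicator {w} (f z) * \<phi> z \<partial>count_space UNIV)"

text \<open>The density, with respect to counting measure, of the \<open>n\<close>-th dual iterate
  of the point mass at \<open>x\<close>.\<close>

fun backward_weight :: "('a \<Rightarrow> ennreal) \<Rightarrow> ('a \<Rightarrow> 'a) \<Rightarrow> 'a \<Rightarrow> nat \<Rightarrow> 'a \<Rightarrow> ennreal" where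
  "backward_weight k f x 0 z = indicator {x} z"
| "backward_weight k f x (Suc n) z = backward_weight k f x n (f z) * k z"

lemma nn_integral_singleton: "(\<integral>\<^sup>+w. g w * indicator {y} w \<partial>count_space UNIV) = g y"
  by (subst nn_integral_count_space'[of "{y}"]) auto

lemma ruelle_op_funpow:
  "(ruelle_op k f ^^ n) \<phi> x = (\<integral>\<^sup>+z. backward_weight k f x n z * \<phi> z \<partial>count_space UNIV)"
proof (induction n arbitrary: \<phi>)
  case 0
  then show ?case using nn_integral_singleton[of \<phi> x] by (simp add: mult.commute)
next
  case (Suc n)
  let ?v = "backward_weight k f x n"
  let ?F = "\<lambda>(w, z). ?v w * (k z * indicator {w} (f z) * \<phi> z)"
  have "(ruelle_op k f ^^ Suc n) \<phi> x = (ruelle_op k f ^^ n) (ruelle_op k f \<phi>) x"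
    by (simp only: funpow_Suc_right o_apply)
  also have "\<dots> = (\<integral>\<^sup>+w. \<integral>\<^sup>+z. ?F (w, z) \<partial>count_space UNIV \<partial>count_space UNIV)"
    unfolding Suc ruelle_op_def by (simp add: nn_integral_cmult)
  also have "\<dots> = (\<integral>\<^sup>+z. \<integral>\<^sup>+w. ?F (w, z) \<partial>count_space UNIV \<partial>count_space UNIV)"
    unfolding nn_integral_fst_count_space nn_integral_snd_count_space ..
  also have "\<dots> = (\<integral>\<^sup>+z. backward_weight k f x (Suc n) z * \<phi> z \<partial>count_space UNIV)"
  proof (rule nn_integral_cong)
    fix z
    have "(\<integral>\<^sup>+w. ?F (w, z) \<partial>count_space UNIV)
        = (\<integral>\<^sup>+w. (?v w * k z * \<phi> z) * indicator {f z} w \<partial>count_space UNIV)"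
      by (intro nn_integral_cong) (auto split: split_indicator simp: mult_ac)
    then show "(\<integral>\<^sup>+w. ?F (w, z) \<partial>count_space UNIV) = backward_weight k f x (Suc n) z * \<phi> z"
      unfolding nn_integral_singleton by simp
  qed
  finally show ?case .
qed

section \<open>Exponential growth rates and almost conformal measures\<close>

lemma ext_ln_le_iff: "ext_ln a \<le> ereal y \<longleftrightarrow> a \<le> ennreal (exp y)"
proof (cases a)
  case (real r)
  show ?thesis
  proof (cases "r = 0")
    case False
    then have "ln r \<le> y \<longleftrightarrow> r \<le> exp y" using real ln_le_cancel_iff[of r "exp y"] by simp
    then show ?thesis using False real by (simp add: ext_ln_def ennreal_le_iff)
  qed (use real in \<open>simp add: ext_ln_def\<close>)
next
  case top
  then show ?thesis by (simp add: ext_ln_def top_unique infinity_ennreal_def)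
qed

lemma scaled_ext_ln_le_iff:
  assumes "n > 0"
  shows "ereal (1 / real n) * ext_ln a \<le> ereal c \<longleftrightarrow> a \<le> ennreal (exp (c * real n))"
proof -
  have "ereal (1 / real n) * e \<le> ereal c \<longleftrightarrow> e \<le> ereal (c * real n)" for e
    using assms by (cases e) (auto simp: field_simps)
  then show ?thesis by (simp add: ext_ln_le_iff)
qed

lemma limsup_scaled_ext_ln:
  fixes a :: "nat \<Rightarrow> ennreal"
  assumes p: "limsup (\<lambda>n. ereal (1 / real n) * ext_ln (a n)) = ereal p" and fin: "\<And>n. a n < \<infinity>" and s: "s > 0"
  shows "\<exists>C>0. \<forall>n. a n \<le> ennreal (C * exp ((p + s) * real n))"
    "\<exists>\<^sub>\<infinity>n. ennreal (exp ((p - s) * real n)) \<le> a n"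
proof -
  have "limsup (\<lambda>n. ereal (1 / real n) * ext_ln (a n)) < ereal (p + s)" using p s by simp
  from Limsup_lessD[OF this] obtain N where
    N: "\<And>n. n \<ge> N \<Longrightarrow> ereal (1 / real n) * ext_ln (a n) < ereal (p + s)"
    by (auto simp: eventually_sequentially)
  have big: "a n \<le> ennreal (exp ((p + s) * real n))" if "n \<ge> Suc N" for n
    using N[of n] that scaled_ext_ln_le_iff[of n "a n" "p + s"] by (auto simp: less_imp_le)
  \<comment> \<open>The sum covers the finitely many indices before the exponential bound sets in;
    the summand 1 covers all others.\<close>
  define C where "C = 1 + (\<Sum>n<Suc N. enn2real (a n) / exp ((p + s) * real n))"
  have C1: "C \<ge> 1" unfolding C_def by (simp add: sum_nonneg del: sum.lessThan_Suc)
  have "a n \<le> ennreal (C * exp ((p + s) * real n))" for n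
  proof (cases "n \<ge> Suc N")
    case True
    have "exp ((p + s) * real n) \<le> C * exp ((p + s) * real n)" using C1 by simp
    then show ?thesis using big[OF True] ennreal_leI order_trans by blast
  next
    case False
    have "enn2real (a n) / exp ((p + s) * real n) \<le> (\<Sum>n<Suc N. enn2real (a n) / exp ((p + s) * real n))"
      using False by (intro member_le_sum) auto
    then have "enn2real (a n) / exp ((p + s) * real n) \<le> C" unfolding C_def by linarith
    then have "enn2real (a n) \<le> C * exp ((p + s) * real n)" by (simp add: field_simps)
    then have "ennreal (enn2real (a n)) \<le> ennreal (C * exp ((p + s) * real n))" by (rule ennreal_leI)
    then show ?thesis using fin[of n] by (simp add: ennreal_enn2real)
  qed
  then show "\<exists>C>0. \<forall>n. a n \<le> ennreal (C * exp ((p + s) * real n))"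
    using C1 by (intro exI[of _ C]) auto
  show "\<exists>\<^sub>\<infinity>n. ennreal (exp ((p - s) * real n)) \<le> a n"
    unfolding INFM_nat
  proof (rule ccontr)
    assume "\<not> (\<forall>m. \<exists>n>m. ennreal (exp ((p - s) * real n)) \<le> a n)"
    then obtain m where m: "\<And>n. n > m \<Longrightarrow> a n \<le> ennreal (exp ((p - s) * real n))"
      by (meson linorder_le_cases)
    have "\<forall>\<^sub>F n in sequentially. ereal (1 / real n) * ext_ln (a n) \<le> ereal (p - s)"
      using eventually_gt_at_top[of m]
      by eventually_elim (use m scaled_ext_ln_le_iff in auto)
    then have "limsup (\<lambda>n. ereal (1 / real n) * ext_ln (a n)) \<le> ereal (p - s)"
      by (rule Limsup_bounded)
    then show False using p s by simp
  qed
qed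

text \<open>The weights \<open>c\<close> below grow and then decay geometrically with the small rate \<open>\<epsilon>\<close>. They make
  the weighted orbit sum finite and as large as desired, whether or not the Poincare series converges
  at the critical exponent.\<close>

lemma exists_almost_conformal_discrete_measure:
  fixes k :: "'a \<Rightarrow> ennreal" and f :: "'a \<Rightarrow> 'a"
  defines "L \<equiv> ruelle_op k f"
  assumes up: "\<And>s. s > 0 \<Longrightarrow> \<exists>C>0. \<forall>n. (L ^^ n) (\<lambda>_. 1) x \<le> ennreal (C * exp ((p + s) * real n))"
    and lo: "\<And>s. s > 0 \<Longrightarrow> \<exists>\<^sub>\<infinity>n. ennreal (exp ((p - s) * real n)) \<le> (L ^^ n) (\<lambda>_. 1) x"
    and \<epsilon>: "\<epsilon> > 0"
  obtains M :: "'a measure" where "prob_space M" "sets M = UNIV"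
    "emeasure M {z. \<forall>n. backward_weight k f x n z = 0} = 0"
    "\<And>\<phi>. (\<integral>\<^sup>+z. L \<phi> z \<partial>M) \<le> ennreal (exp \<epsilon>) * (ennreal (exp p) * (\<integral>\<^sup>+z. \<phi> z \<partial>M))"
    "\<And>\<phi>. ennreal (exp p) * (\<integral>\<^sup>+z. \<phi> z \<partial>M) \<le>
        ennreal (exp \<epsilon>) * (\<integral>\<^sup>+z. L \<phi> z \<partial>M) + ennreal \<epsilon> * (ennreal (exp p) * \<phi> x)"
proof -
  let ?v = "backward_weight k f x"
  obtain C where C: "C > 0" "\<And>n. (L ^^ n) (\<lambda>_. 1) x \<le> ennreal (C * exp ((p + \<epsilon> / 2) * real n))"
    using up[of "\<epsilon> / 2"] \<epsilon> by auto
  \<comment> \<open>Past \<open>N0\<close>, a single index \<open>N\<close> with large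
    \<open>(L ^^ N) 1 x\<close> already contributes \<open>1 / \<epsilon>\<close> to the total
    mass.\<close>
  obtain N0 :: nat where N0: "1 / \<epsilon> \<le> exp (\<epsilon> / 2 * real N0)"
  proof -
    obtain n :: nat where n: "(1 / \<epsilon>) / (\<epsilon> / 2) \<le> real n" using real_arch_simple by blast
    have "1 / \<epsilon> \<le> \<epsilon> / 2 * real n" using n \<epsilon> by (simp add: field_simps)
    also have "\<dots> \<le> exp (\<epsilon> / 2 * real n)" using exp_ge_add_one_self[of "\<epsilon> / 2 * real n"] by linarith
    finally show thesis using that by blast
  qed
  obtain N where N: "N > N0" "ennreal (exp ((p - \<epsilon> / 2) * real N)) \<le> (L ^^ N) (\<lambda>_. 1) x"
    using lo[of "\<epsilon> / 2"] \<epsilon> unfolding INFM_nat by auto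
  \<comment> \<open>The exponent is a tent of slope \<epsilon>, zero at \<open>n = 0\<close> and
    highest at \<open>n = N\<close>.\<close>
  define c where "c n = exp (\<epsilon> * (real N - \<bar>real N - real n\<bar>))" for n
  define d where "d n = c n * exp (- p * real n)" for n
  have d0: "d 0 = 1" by (simp add: d_def c_def)
  have dpos: "d n > 0" for n by (simp add: d_def c_def)
  have cc: "c n \<le> exp \<epsilon> * c (Suc n)" "c (Suc n) \<le> exp \<epsilon> * c n" for n
  proof -
    have "\<epsilon> * (real N - \<bar>real N - real n\<bar>) \<le> \<epsilon> * (1 + (real N - \<bar>real N - real (Suc n)\<bar>))"
      using \<epsilon> by (intro mult_left_mono) auto
    then show "c n \<le> exp \<epsilon> * c (Suc n)" unfolding c_def by (simp add: distrib_left flip: exp_add)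
    have "\<epsilon> * (real N - \<bar>real N - real (Suc n)\<bar>) \<le> \<epsilon> * (1 + (real N - \<bar>real N - real n\<bar>))"
      using \<epsilon> by (intro mult_left_mono) auto
    then show "c (Suc n) \<le> exp \<epsilon> * c n" unfolding c_def by (simp add: distrib_left flip: exp_add)
  qed
  have e1: "exp (- p * real n) = exp p * exp (- p * real (Suc n))" for n
    by (simp add: algebra_simps flip: exp_add)
  \<comment> \<open>An index shift costs a factor \<open>exp p\<close> up to
    \<open>exp \<epsilon>\<close>; this is what makes the weighted sum almost an
    eigenmeasure.\<close>
  have dd: "d n \<le> exp \<epsilon> * exp p * d (Suc n)" "exp p * d (Suc n) \<le> exp \<epsilon> * d n" for n
  proof -
    let ?e = "exp p * exp (- p * real (Suc n))"
    have dn: "d n = c n * ?e" "exp p * d (Suc n) = c (Suc n) * ?e"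
      unfolding d_def e1[of n] by (simp_all only: mult_ac)
    have "c n * ?e \<le> (exp \<epsilon> * c (Suc n)) * ?e" by (intro mult_right_mono cc) simp
    also have "\<dots> = exp \<epsilon> * exp p * d (Suc n)" unfolding d_def by (simp only: mult_ac)
    finally show "d n \<le> exp \<epsilon> * exp p * d (Suc n)" unfolding dn(1) .
    have "c (Suc n) * ?e \<le> (exp \<epsilon> * c n) * ?e" by (intro mult_right_mono cc) simp
    then show "exp p * d (Suc n) \<le> exp \<epsilon> * d n" unfolding dn by (simp only: mult_ac)
  qed
  define U where "U z = (\<Sum>n. ennreal (d n) * ?v n z)" for z
  have UI: "(\<integral>\<^sup>+z. U z * \<phi> z \<partial>count_space UNIV) = (\<Sum>n. ennreal (d n) * (L ^^ n) \<phi> x)" for \<phi>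
  proof -
    have "U z * \<phi> z = (\<Sum>n. ennreal (d n) * (?v n z * \<phi> z))" for z
      unfolding U_def by (simp add: mult.assoc flip: ennreal_suminf_multc)
    then have "(\<integral>\<^sup>+z. U z * \<phi> z \<partial>count_space UNIV) = (\<Sum>n. \<integral>\<^sup>+z. ennreal (d n) * (?v n z * \<phi> z) \<partial>count_space UNIV)"
      by (simp add: nn_integral_suminf)
    then show ?thesis unfolding L_def ruelle_op_funpow by (simp add: nn_integral_cmult)
  qed
  define Z where "Z = (\<integral>\<^sup>+z. U z \<partial>count_space UNIV)"
  have Zeq: "Z = (\<Sum>n. ennreal (d n) * (L ^^ n) (\<lambda>_. 1) x)" using UI[of "\<lambda>_. 1"] by (simp add: Z_def)
  \<comment> \<open>After \<open>N\<close> the tent decays at rate \<epsilon>, while the terms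
    divided by \<open>exp (p * n)\<close> grow at rate at most
    \<open>\<epsilon> / 2\<close>.\<close>
  have Zfin: "Z < \<infinity>"
  proof -
    let ?r = "exp (- (\<epsilon> / 2))"
    let ?K = "C * exp (2 * \<epsilon> * real N)"
    have "ennreal (d n) * (L ^^ n) (\<lambda>_. 1) x \<le> ennreal (?K * ?r ^ n)" for n
    proof -
      have "ennreal (d n) * (L ^^ n) (\<lambda>_. 1) x \<le> ennreal (d n) * ennreal (C * exp ((p + \<epsilon> / 2) * real n))"
        by (intro mult_left_mono C) auto
      also have "\<dots> = ennreal (d n * (C * exp ((p + \<epsilon> / 2) * real n)))"
        using dpos[of n] C(1) by (simp add: ennreal_mult)
      also have "d n * (C * exp ((p + \<epsilon> / 2) * real n)) = C * (c n * exp (\<epsilon> / 2 * real n))"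
        unfolding d_def by (simp add: algebra_simps flip: exp_add)
      also have "c n * exp (\<epsilon> / 2 * real n) \<le> exp (2 * \<epsilon> * real N) * ?r ^ n"
      proof -
        have "\<epsilon> * (real N - \<bar>real N - real n\<bar>) \<le> \<epsilon> * (2 * real N - real n)"
          using \<epsilon> by (intro mult_left_mono) auto
        then have "\<epsilon> * (real N - \<bar>real N - real n\<bar>) + \<epsilon> / 2 * real n \<le> 2 * \<epsilon> * real N + real n * (- (\<epsilon> / 2))"
          by (simp add: algebra_simps)
        then show ?thesis unfolding c_def by (simp add: exp_of_nat_mult[symmetric] flip: exp_add)
      qed
      finally show ?thesis using C(1) by (simp add: ennreal_leI mult.assoc)
    qed
    then have "Z \<le> (\<Sum>n. ennreal (?K * ?r ^ n))" unfolding Zeq by (intro suminf_le) auto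
    also have "\<dots> = ennreal (\<Sum>n. ?K * ?r ^ n)"
      using \<epsilon> C(1) by (intro suminf_ennreal2) (auto intro!: summable_mult summable_geometric)
    finally show ?thesis using le_less_trans by fastforce
  qed
  \<comment> \<open>A large mass makes the initial point mass at \<open>x\<close>, of weight 1,
    contribute at most \<epsilon> after normalization.\<close>
  have Zlow: "ennreal (1 / \<epsilon>) \<le> Z"
  proof -
    have "1 / \<epsilon> \<le> exp (\<epsilon> / 2 * real N0)" by (rule N0)
    also have "\<dots> \<le> exp (\<epsilon> / 2 * real N)" using N(1) \<epsilon> by simp
    also have "\<dots> = d N * exp ((p - \<epsilon> / 2) * real N)"
      unfolding d_def c_def by (simp add: algebra_simps flip: exp_add)
    finally have "ennreal (1 / \<epsilon>) \<le> ennreal (d N * exp ((p - \<epsilon> / 2) * real N))" by (rule ennreal_leI)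
    also have "\<dots> = ennreal (d N) * ennreal (exp ((p - \<epsilon> / 2) * real N))"
      using dpos[of N] by (simp add: ennreal_mult)
    also have "\<dots> \<le> ennreal (d N) * (L ^^ N) (\<lambda>_. 1) x" by (intro mult_left_mono N) auto
    also have "\<dots> \<le> Z" unfolding Zeq
      using sum_le_suminf[of "\<lambda>n. ennreal (d n) * (L ^^ n) (\<lambda>_. 1) x" "{N}"] by simp
    finally show ?thesis .
  qed
  have Zpos: "Z > 0" using Zlow \<epsilon> by (intro less_le_trans[OF _ Zlow]) simp
  define M where "M = density (count_space UNIV) (\<lambda>z. U z / Z)"
  have MI: "(\<integral>\<^sup>+z. \<phi> z \<partial>M) = (\<Sum>n. ennreal (d n) * (L ^^ n) \<phi> x) / Z" for \<phi>
  proof -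
    have "(\<integral>\<^sup>+z. \<phi> z \<partial>M) = (\<integral>\<^sup>+z. U z / Z * \<phi> z \<partial>count_space UNIV)"
      unfolding M_def by (simp add: nn_integral_density)
    also have "\<dots> = (\<integral>\<^sup>+z. (U z * \<phi> z) / Z \<partial>count_space UNIV)"
      by (simp add: divide_ennreal_def mult_ac)
    also have "\<dots> = (\<integral>\<^sup>+z. U z * \<phi> z \<partial>count_space UNIV) / Z"
      by (rule nn_integral_divide) simp
    finally show ?thesis by (simp add: UI)
  qed
  have prob: "prob_space M"
  proof
    have "emeasure M (space M) = (\<integral>\<^sup>+z. 1 \<partial>M)" by simp
    also have "\<dots> = Z / Z" unfolding MI Zeq ..
    also have "\<dots> = 1" using Zpos Zfin by (intro ennreal_divide_self) auto
    finally show "emeasure M (space M) = 1" .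
  qed
  have supp: "emeasure M {z. \<forall>n. ?v n z = 0} = 0"
  proof -
    have "emeasure M {z. \<forall>n. ?v n z = 0} = (\<integral>\<^sup>+z. U z / Z * indicator {z. \<forall>n. ?v n z = 0} z \<partial>count_space UNIV)"
      unfolding M_def by (simp add: emeasure_density)
    also have "\<dots> = (\<integral>\<^sup>+(z::'a). 0 \<partial>count_space UNIV)"
      by (intro nn_integral_cong) (auto simp: U_def split: split_indicator)
    finally show ?thesis by simp
  qed
  have Lsuc: "(L ^^ n) (L \<phi>) x = (L ^^ Suc n) \<phi> x" for n \<phi> by (simp only: funpow_Suc_right o_apply)
  have A: "(\<integral>\<^sup>+z. L \<phi> z \<partial>M) \<le> ennreal (exp \<epsilon>) * (ennreal (exp p) * (\<integral>\<^sup>+z. \<phi> z \<partial>M))" for \<phi>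
  proof -
    let ?b = "\<lambda>n. (L ^^ n) \<phi> x"
    have "(\<Sum>n. ennreal (d n) * (L ^^ n) (L \<phi>) x) \<le> (\<Sum>n. ennreal (exp \<epsilon> * exp p) * (ennreal (d (Suc n)) * ?b (Suc n)))"
    proof (intro suminf_le allI)
      fix n
      have "ennreal (d n) \<le> ennreal (exp \<epsilon> * exp p * d (Suc n))" by (intro ennreal_leI dd)
      also have "\<dots> = ennreal (exp \<epsilon> * exp p) * ennreal (d (Suc n))" using dpos[of "Suc n"] by (simp add: ennreal_mult)
      finally show "ennreal (d n) * (L ^^ n) (L \<phi>) x \<le> ennreal (exp \<epsilon> * exp p) * (ennreal (d (Suc n)) * ?b (Suc n))"
        unfolding Lsuc by (simp add: mult_right_mono flip: mult.assoc)
    qed auto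
    also have "\<dots> = ennreal (exp \<epsilon> * exp p) * (\<Sum>n. ennreal (d (Suc n)) * ?b (Suc n))"
      by (rule ennreal_suminf_cmult)
    also have "(\<Sum>n. ennreal (d (Suc n)) * ?b (Suc n)) \<le> (\<Sum>n. ennreal (d n) * ?b n)"
      using suminf_offset[of "\<lambda>n. ennreal (d n) * ?b n" 1] by simp
    finally have "(\<Sum>n. ennreal (d n) * (L ^^ n) (L \<phi>) x) / Z \<le> (ennreal (exp \<epsilon> * exp p) * (\<Sum>n. ennreal (d n) * ?b n)) / Z"
      by (intro divide_right_mono_ennreal) (simp add: mult_left_mono)
    then show ?thesis unfolding MI by (simp add: ennreal_mult ennreal_times_divide mult.assoc)
  qed
  \<comment> \<open>Here the shift loses the term with index 0, which becomes the error at
    \<open>x\<close>; in the opposite inequality it is simply dropped.\<close>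
  have B: "ennreal (exp p) * (\<integral>\<^sup>+z. \<phi> z \<partial>M) \<le>
        ennreal (exp \<epsilon>) * (\<integral>\<^sup>+z. L \<phi> z \<partial>M) + ennreal \<epsilon> * (ennreal (exp p) * \<phi> x)" for \<phi>
  proof -
    let ?b = "\<lambda>n. (L ^^ n) \<phi> x"
    have "ennreal (exp p) * (\<Sum>n. ennreal (d n) * ?b n)
        = ennreal (exp p) * (\<phi> x + (\<Sum>n. ennreal (d (Suc n)) * ?b (Suc n)))"
      using suminf_offset[of "\<lambda>n. ennreal (d n) * ?b n" 1] by (simp add: d0 add.commute)
    also have "\<dots> = ennreal (exp p) * \<phi> x + (\<Sum>n. ennreal (exp p) * (ennreal (d (Suc n)) * ?b (Suc n)))"
      by (simp add: distrib_left)
    also have "(\<Sum>n. ennreal (exp p) * (ennreal (d (Suc n)) * ?b (Suc n))) \<le> (\<Sum>n. ennreal (exp \<epsilon>) * (ennreal (d n) * (L ^^ n) (L \<phi>) x))"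
    proof (intro suminf_le allI)
      fix n
      have "ennreal (exp p) * ennreal (d (Suc n)) = ennreal (exp p * d (Suc n))"
        using dpos[of "Suc n"] by (simp add: ennreal_mult)
      also have "\<dots> \<le> ennreal (exp \<epsilon> * d n)" by (intro ennreal_leI dd)
      also have "\<dots> = ennreal (exp \<epsilon>) * ennreal (d n)" using dpos[of n] by (simp add: ennreal_mult)
      finally show "ennreal (exp p) * (ennreal (d (Suc n)) * ?b (Suc n)) \<le> ennreal (exp \<epsilon>) * (ennreal (d n) * (L ^^ n) (L \<phi>) x)"
        unfolding Lsuc by (simp add: mult_right_mono flip: mult.assoc)
    qed auto
    also have "\<dots> = ennreal (exp \<epsilon>) * (\<Sum>n. ennreal (d n) * (L ^^ n) (L \<phi>) x)"
      by (rule ennreal_suminf_cmult)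
    finally have *: "(ennreal (exp p) * (\<Sum>n. ennreal (d n) * ?b n)) / Z \<le>
       (ennreal (exp p) * \<phi> x + ennreal (exp \<epsilon>) * (\<Sum>n. ennreal (d n) * (L ^^ n) (L \<phi>) x)) / Z"
      by (intro divide_right_mono_ennreal) (simp add: add_left_mono)
    have "ennreal (exp p) * \<phi> x / Z \<le> ennreal (exp p) * \<phi> x * ennreal \<epsilon>"
    proof -
      obtain r where r: "Z = ennreal r" "0 \<le> r" using Zfin by (cases Z) auto
      then have "1 / \<epsilon> \<le> r" "0 < r" using Zlow Zpos \<epsilon> by (auto simp: ennreal_le_iff)
      then have "1 / r \<le> \<epsilon>" using \<epsilon> by (simp add: field_simps)
      then have "inverse Z \<le> ennreal \<epsilon>"
        using \<open>0 < r\<close> unfolding r(1) by (simp add: inverse_ennreal ennreal_leI inverse_eq_divide)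
      then show ?thesis unfolding divide_ennreal_def by (rule mult_left_mono) simp
    qed
    then have "(ennreal (exp p) * \<phi> x + ennreal (exp \<epsilon>) * (\<Sum>n. ennreal (d n) * (L ^^ n) (L \<phi>) x)) / Z
       \<le> ennreal (exp p) * \<phi> x * ennreal \<epsilon> + ennreal (exp \<epsilon>) * (\<Sum>n. ennreal (d n) * (L ^^ n) (L \<phi>) x) / Z"
      by (simp add: divide_ennreal_def distrib_right add_right_mono)
    with * show ?thesis unfolding MI by (simp add: ennreal_times_divide mult_ac add.commute)
  qed
  show thesis by (rule that[of M, OF prob _ supp A B]) (simp add: M_def)
qed


subsection \<open>Bounds for the transfer operator\<close>

text \<open>The value 0 at poles keeps them from being counted as preimages of their dummy
  value.\<close>

definition inv_weight :: "(complex \<Rightarrow> complex) \<Rightarrow> real \<Rightarrow> real \<Rightarrow> complex \<Rightarrow> ennreal" where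
  "inv_weight f \<alpha>2 t z = (if is_pole f z then 0 else ennreal (sigma_deriv f \<alpha>2 z powr (- t)))"

lemma countable_preimages:
  assumes f: "transcendental_meromorphic f"
  shows "countable {z. f z = w}"
proof -
  have "\<not> (\<forall>z. f z = w)"
    using transcendental_not_constant_on[OF f open_UNIV UNIV_not_empty] by (auto simp: constant_on_def)
  then have "\<forall>\<^sub>\<approx>z\<in>UNIV. f z \<noteq> w"
    using nicely_meromorphic_imp_constant_or_avoid[OF transcendental_nicely_meromorphic[OF f] open_UNIV connected_UNIV, of w]
    by blast
  then have "{z. f z = w} sparse_in UNIV" by (simp add: eventually_cosparse)
  then show ?thesis using sparse_imp_countable[OF open_UNIV, of "{z. f z = w}"] by simp
qed

lemma transfer_op_eq_ruelle_op:
  assumes f: "transcendental_meromorphic f"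
  shows "transfer_op f \<alpha>2 t = ruelle_op (inv_weight f \<alpha>2 t) f"
proof (intro ext)
  fix \<phi> w
  let ?A = "{z. \<not> is_pole f z \<and> f z = w}"
  have "countable ?A" by (rule countable_subset[OF _ countable_preimages[OF f, of w]]) auto
  then have "transfer_op f \<alpha>2 t \<phi> w = (\<integral>\<^sup>+z. ennreal (sigma_deriv f \<alpha>2 z powr (- t)) * \<phi> z \<partial>count_space ?A)"
    unfolding transfer_op_def by (rule infsum_eq_nn_integral_count_space)
  also have "\<dots> = (\<integral>\<^sup>+z. ennreal (sigma_deriv f \<alpha>2 z powr (- t)) * \<phi> z * indicator ?A z \<partial>count_space UNIV)"
    by (rule nn_integral_count_space_indicator) simp
  also have "\<dots> = ruelle_op (inv_weight f \<alpha>2 t) f \<phi> w"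
    unfolding ruelle_op_def by (intro nn_integral_cong) (auto simp: inv_weight_def split: split_indicator)
  finally show "transfer_op f \<alpha>2 t \<phi> w = ruelle_op (inv_weight f \<alpha>2 t) f \<phi> w" .
qed

lemma julia_set_nonzero:
  assumes "0 \<in> fatou_set f" "z \<in> julia_set f"
  shows "z \<noteq> 0"
  using assms by (auto simp: julia_set_def)

text \<open>By invariance, only points of the Julia set contribute to the operator at a Julia
  point.\<close>

lemma ruelle_op_mono_julia:
  assumes f: "transcendental_meromorphic f" and w: "w \<in> julia_set f"
    and le: "\<And>z. z \<in> julia_set f \<Longrightarrow> \<not> is_pole f z \<Longrightarrow> f z = w \<Longrightarrow> \<phi> z \<le> \<psi> z"
  shows "ruelle_op (inv_weight f \<alpha>2 t) f \<phi> w \<le> ruelle_op (inv_weight f \<alpha>2 t) f \<psi> w"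
  unfolding ruelle_op_def
proof (intro nn_integral_mono)
  fix z
  show "inv_weight f \<alpha>2 t z * indicator {w} (f z) * \<phi> z \<le> inv_weight f \<alpha>2 t z * indicator {w} (f z) * \<psi> z"
  proof (cases "is_pole f z \<or> f z \<noteq> w")
    case False
    then have "z \<in> julia_set f" using w julia_set_image_iff[OF f, of z] by simp
    then show ?thesis using le[of z] False by (intro mult_left_mono) auto
  qed (auto simp: inv_weight_def)
qed

text \<open>The metric is chosen so that the factor \<open>norm (f z) powr \<alpha>2\<close> of the
  growth condition cancels, leaving a bound in \<open>norm z\<close> alone.\<close>

lemma sigma_deriv_lower_bound:
  assumes f: "transcendental_meromorphic f" and F0: "0 \<in> fatou_set f"
    and rg: "rapid_derivative_growth f \<alpha>1 \<alpha>2"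
  obtains \<kappa> where "\<kappa> > 0"
    "\<And>z. z \<in> julia_set f \<Longrightarrow> \<not> is_pole f z \<Longrightarrow> inverse \<kappa> * norm z powr (\<alpha>1 + \<alpha>2) \<le> sigma_deriv f \<alpha>2 z"
proof -
  obtain \<kappa> where \<kappa>: "\<kappa> > 0" "\<And>z. z \<in> julia_set f \<Longrightarrow> \<not> is_pole f z \<Longrightarrow>
      norm (deriv f z) \<ge> inverse \<kappa> * norm z powr \<alpha>1 * norm (f z) powr \<alpha>2"
    using rg unfolding rapid_derivative_growth_def by blast
  have "inverse \<kappa> * norm z powr (\<alpha>1 + \<alpha>2) \<le> sigma_deriv f \<alpha>2 z" if z: "z \<in> julia_set f" "\<not> is_pole f z" for z
  proof -
    have "f z \<in> julia_set f" using julia_set_image_iff[OF f z(2)] z(1) by simp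
    then have "norm (f z) > 0" using julia_set_nonzero[OF F0] by simp
    then have 1: "norm (f z) powr \<alpha>2 * norm (f z) powr (- \<alpha>2) = 1" by (simp flip: powr_add)
    have "inverse \<kappa> * norm z powr (\<alpha>1 + \<alpha>2)
      = inverse \<kappa> * norm z powr \<alpha>1 * norm z powr \<alpha>2 * (norm (f z) powr \<alpha>2 * norm (f z) powr (- \<alpha>2))"
      unfolding 1 by (simp add: powr_add)
    also have "\<dots> = (inverse \<kappa> * norm z powr \<alpha>1 * norm (f z) powr \<alpha>2) * norm z powr \<alpha>2 * norm (f z) powr (- \<alpha>2)"
      by (simp only: mult_ac)
    also have "\<dots> \<le> norm (deriv f z) * norm z powr \<alpha>2 * norm (f z) powr (- \<alpha>2)"
      by (intro mult_right_mono \<kappa> z) auto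
    finally show ?thesis unfolding sigma_deriv_def .
  qed
  then show thesis using that \<kappa>(1) by blast
qed

text \<open>In particular \<open>f\<close> has no critical point in the Julia set.\<close>

lemma sigma_deriv_pos:
  assumes f: "transcendental_meromorphic f" and F0: "0 \<in> fatou_set f"
    and rg: "rapid_derivative_growth f \<alpha>1 \<alpha>2" and z: "z \<in> julia_set f" "\<not> is_pole f z"
  shows "sigma_deriv f \<alpha>2 z > 0"
proof -
  obtain \<kappa> where \<kappa>: "\<kappa> > 0"
    "\<And>z. z \<in> julia_set f \<Longrightarrow> \<not> is_pole f z \<Longrightarrow> inverse \<kappa> * norm z powr (\<alpha>1 + \<alpha>2) \<le> sigma_deriv f \<alpha>2 z"
    using sigma_deriv_lower_bound[OF f F0 rg] by blast
  have "0 < inverse \<kappa> * norm z powr (\<alpha>1 + \<alpha>2)"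
    using \<kappa>(1) julia_set_nonzero[OF F0 z(1)] by (intro mult_pos_pos) auto
  then show ?thesis using \<kappa>(2)[OF z] by linarith
qed

lemma term_le_suminf_ennreal:
  fixes g :: "nat \<Rightarrow> ennreal"
  shows "g j \<le> (\<Sum>i. g i)"
  using sum_le_suminf[of g "{j}"] by simp

lemma dyadic_index:
  fixes R y :: real
  assumes "0 < R" "R \<le> y"
  shows "\<exists>j. 2 ^ j * R \<le> y \<and> y \<le> 2 ^ Suc j * R"
proof -
  obtain n where n: "y / R < 2 ^ n" using real_arch_pow[of 2 "y / R"] by auto
  define m where "m = (LEAST n. y / R < 2 ^ n)"
  have m: "y / R < 2 ^ m" unfolding m_def by (rule LeastI[of _ n]) (rule n)
  have "m \<noteq> 0"
  proof
    assume "m = 0"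
    then show False using m assms by (simp add: field_simps)
  qed
  then obtain j where j: "m = Suc j" by (cases m) auto
  have "\<not> y / R < 2 ^ j" using not_less_Least[of j "\<lambda>n. y / R < 2 ^ n"] j unfolding m_def by simp
  then show ?thesis using m assms unfolding j by (intro exI[of _ j]) (auto simp: field_simps)
qed

text \<open>Preimages are grouped in dyadic annuli. The annulus at radius \<open>2 ^ j * R\<close>
  holds a multiple of \<open>(2 ^ j * R) powr q\<close> points at most, each of weight a multiple of
  \<open>(2 ^ j * R) powr (- b)\<close> at most, so the sum is geometric with ratio
  \<open>2 powr (- \<gamma>)\<close>.\<close>

lemma ruelle_op_tail_bound:
  assumes f: "transcendental_meromorphic f" and F0: "0 \<in> fatou_set f"
    and \<rho>: "order_of_growth f = ereal \<rho>"
    and rg: "rapid_derivative_growth f \<alpha>1 \<alpha>2" and t: "t > \<rho> / (\<alpha>1 + \<alpha>2)"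
    and \<delta>: "\<delta> > 0"
  obtains C \<gamma> where "C > 0" "\<gamma> > 0"
    "\<And>w R. w \<in> julia_set f \<Longrightarrow> R \<ge> \<delta> \<Longrightarrow>
       ruelle_op (inv_weight f \<alpha>2 t) f (indicator {z. R \<le> norm z}) w \<le> ennreal (C * R powr (- \<gamma>))"
proof -
  have \<rho>0: "\<rho> \<ge> 0" using order_of_growth_nonneg[OF f fatou_set_nonpole[OF F0]] \<rho> by simp
  have \<alpha>: "\<alpha>1 + \<alpha>2 > 0" using rg by (auto simp: rapid_derivative_growth_def)
  have t0: "t > 0" using t \<rho>0 \<alpha> by (meson divide_nonneg_pos le_less_trans)
  define b where "b = (\<alpha>1 + \<alpha>2) * t"
  have b: "b > \<rho>" using t \<alpha> by (simp add: b_def field_simps)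
  \<comment> \<open>The gap between \<rho> and \<open>b\<close> leaves room on both sides, and the
    midpoint is positive even for order 0.\<close>
  define q where "q = (b + \<rho>) / 2"
  have q: "0 < q" "\<rho> < q" "q < b" using b \<rho>0 by (auto simp: q_def)
  define \<gamma> where "\<gamma> = b - q"
  have \<gamma>: "\<gamma> > 0" using q by (simp add: \<gamma>_def)
  obtain \<kappa> where \<kappa>: "\<kappa> > 0"
    "\<And>z. z \<in> julia_set f \<Longrightarrow> \<not> is_pole f z \<Longrightarrow> inverse \<kappa> * norm z powr (\<alpha>1 + \<alpha>2) \<le> sigma_deriv f \<alpha>2 z"
    using sigma_deriv_lower_bound[OF f F0 rg] by blast
  have oq: "order_of_growth f < ereal q" using \<rho> q(2) by simp
  obtain C0 where C0: "C0 > 0" "\<And>w r. w \<in> julia_set f \<Longrightarrow> \<delta> \<le> r \<Longrightarrow>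
    finite {z. \<not> is_pole f z \<and> f z = w \<and> norm z \<le> r} \<and>
    real (card {z. \<not> is_pole f z \<and> f z = w \<and> norm z \<le> r}) \<le> C0 * r powr q"
    using card_preimages_le_powr[OF f F0 q(1) oq \<delta>] by blast
  define K where "K = \<kappa> powr t * C0 * 2 powr q"
  have K: "K > 0" using \<kappa>(1) C0(1) by (simp add: K_def)
  define s where "s = (2::real) powr (- \<gamma>)"
  have s: "0 < s" "s < 1" using \<gamma> by (auto simp: s_def powr_less_one)
  have "ruelle_op (inv_weight f \<alpha>2 t) f (indicator {z. R \<le> norm z}) w \<le> ennreal (K / (1 - s) * R powr (- \<gamma>))"
    if w: "w \<in> julia_set f" and R: "R \<ge> \<delta>" for w R
  proof -
    have R0: "R > 0" using R \<delta> by linarith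
    define A where "A j = {z. \<not> is_pole f z \<and> f z = w \<and> norm z \<le> 2 ^ Suc j * R}" for j
    define a where "a j = \<kappa> powr t * (2 ^ j * R) powr (- b)" for j :: nat
    have a0: "a j \<ge> 0" for j by (simp add: a_def)
    have ptw: "inv_weight f \<alpha>2 t z * indicator {w} (f z) * indicator {z. R \<le> norm z} z
       \<le> (\<Sum>j. ennreal (a j) * indicator (A j) z)" for z
    proof (cases "\<not> is_pole f z \<and> f z = w \<and> R \<le> norm z")
      case True
      then have z: "\<not> is_pole f z" "f z = w" "R \<le> norm z" by auto
      have zJ: "z \<in> julia_set f" using w julia_set_image_iff[OF f z(1)] z(2) by simp
      obtain j where j: "2 ^ j * R \<le> norm z" "norm z \<le> 2 ^ Suc j * R" using dyadic_index[OF R0 z(3)] by blast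
      have pos: "0 < inverse \<kappa> * norm z powr (\<alpha>1 + \<alpha>2)"
        using \<kappa>(1) julia_set_nonzero[OF F0 zJ] by (intro mult_pos_pos) auto
      have "sigma_deriv f \<alpha>2 z powr (- t) \<le> (inverse \<kappa> * norm z powr (\<alpha>1 + \<alpha>2)) powr (- t)"
        using \<kappa>(2)[OF zJ z(1)] pos t0 by (intro powr_mono2') auto
      also have "\<dots> = \<kappa> powr t * norm z powr (- b)"
        using \<kappa>(1) by (simp add: powr_mult powr_powr b_def powr_minus inverse_powr)
      also have "norm z powr (- b) \<le> (2 ^ j * R) powr (- b)"
        using j(1) R0 b \<rho>0 by (intro powr_mono2') auto
      finally have "sigma_deriv f \<alpha>2 z powr (- t) \<le> a j" unfolding a_def by (simp add: mult_left_mono)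
      then have "inv_weight f \<alpha>2 t z * indicator {w} (f z) * indicator {z. R \<le> norm z} z \<le> ennreal (a j) * indicator (A j) z"
        using z j by (simp add: inv_weight_def A_def ennreal_leI)
      also have "\<dots> \<le> (\<Sum>j. ennreal (a j) * indicator (A j) z)"
        by (rule term_le_suminf_ennreal)
      finally show ?thesis .
    qed (auto simp: inv_weight_def)
    have "ruelle_op (inv_weight f \<alpha>2 t) f (indicator {z. R \<le> norm z}) w
        \<le> (\<integral>\<^sup>+z. (\<Sum>j. ennreal (a j) * indicator (A j) z) \<partial>count_space UNIV)"
      unfolding ruelle_op_def by (intro nn_integral_mono ptw)
    also have "\<dots> = (\<Sum>j. ennreal (a j) * emeasure (count_space UNIV) (A j))"
      by (simp add: nn_integral_suminf nn_integral_cmult)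
    also have "\<dots> \<le> (\<Sum>j. ennreal (K * R powr (- \<gamma>) * s ^ j))"
    proof (intro suminf_le allI)
      fix j
      have le: "\<delta> \<le> 2 ^ Suc j * R"
      proof -
        have "1 * R \<le> 2 ^ Suc j * R" using R0 by (intro mult_right_mono one_le_power) auto
        then show ?thesis using R by linarith
      qed
      have fin: "finite (A j)" and cd: "real (card (A j)) \<le> C0 * (2 ^ Suc j * R) powr q"
        using C0(2)[OF w le] unfolding A_def by auto
      have "ennreal (a j) * emeasure (count_space UNIV) (A j) = ennreal (a j * real (card (A j)))"
        using fin a0 by (simp add: emeasure_count_space ennreal_mult ennreal_of_nat_eq_real_of_nat)
      also have "\<dots> \<le> ennreal (a j * (C0 * (2 ^ Suc j * R) powr q))"
        by (intro ennreal_leI mult_left_mono cd a0)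
      also have "a j * (C0 * (2 ^ Suc j * R) powr q) = K * (2 ^ j * R) powr (- \<gamma>)"
      proof -
        have "(2 ^ Suc j * R) powr q = 2 powr q * (2 ^ j * R) powr q"
          by (simp add: powr_mult mult.assoc)
        then show ?thesis unfolding a_def K_def \<gamma>_def by (simp add: mult_ac powr_diff powr_minus field_simps)
      qed
      also have "(2 ^ j * R) powr (- \<gamma>) = R powr (- \<gamma>) * s ^ j"
      proof -
        have "(2 ^ j) powr (- \<gamma>) = s ^ j"
          unfolding s_def by (simp add: powr_powr powr_realpow[symmetric] mult.commute)
        then show ?thesis by (simp add: powr_mult mult.commute)
      qed
      finally show "ennreal (a j) * emeasure (count_space UNIV) (A j) \<le> ennreal (K * R powr (- \<gamma>) * s ^ j)"
        by (simp add: mult.assoc)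
    qed auto
    also have "\<dots> = ennreal (\<Sum>j. K * R powr (- \<gamma>) * s ^ j)"
      using s K by (intro suminf_ennreal2 summable_mult summable_geometric) auto
    also have "(\<Sum>j. K * R powr (- \<gamma>) * s ^ j) = K * R powr (- \<gamma>) * (1 / (1 - s))"
      using s by (subst suminf_mult) (auto simp: suminf_geometric summable_geometric)
    also have "\<dots> = K / (1 - s) * R powr (- \<gamma>)" by simp
    finally show ?thesis .
  qed
  moreover have "K / (1 - s) > 0" using K s by simp
  ultimately show thesis using that \<gamma> by blast
qed

section \<open>Exponential bounds for the iterates\<close>

lemma ruelle_op_funpow_upper:
  assumes f: "transcendental_meromorphic f"
    and B: "\<And>w. w \<in> julia_set f \<Longrightarrow> ruelle_op (inv_weight f \<alpha>2 t) f (\<lambda>_. 1) w \<le> ennreal B" "B > 0"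
    and w: "w \<in> julia_set f"
  shows "(ruelle_op (inv_weight f \<alpha>2 t) f ^^ n) (\<lambda>_. 1) w \<le> ennreal (B ^ n)"
  using w
proof (induction n arbitrary: w)
  case (Suc n)
  let ?L = "ruelle_op (inv_weight f \<alpha>2 t) f"
  have "(?L ^^ Suc n) (\<lambda>_. 1) w = ?L ((?L ^^ n) (\<lambda>_. 1)) w" by simp
  also have "\<dots> \<le> ?L (\<lambda>_. ennreal (B ^ n)) w"
    by (intro ruelle_op_mono_julia[OF f Suc.prems]) (rule Suc.IH)
  also have "\<dots> = ennreal (B ^ n) * ?L (\<lambda>_. 1) w"
    unfolding ruelle_op_def by (subst nn_integral_cmult[symmetric]) (auto simp: mult_ac)
  also have "\<dots> \<le> ennreal (B ^ n) * ennreal B" by (intro mult_left_mono B Suc.prems) auto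
  also have "\<dots> = ennreal (B ^ Suc n)" using B(2) by (simp add: mult.commute flip: ennreal_mult)
  finally show ?case .
qed simp

text \<open>It is enough to follow one backward orbit that never leaves the disc of radius
  \<open>R\<close>: each step has weight at least \<open>c\<close>.\<close>

lemma ruelle_op_funpow_lower:
  assumes f: "transcendental_meromorphic f" and F0: "0 \<in> fatou_set f"
    and q: "order_of_growth f < ereal q"
    and rg: "rapid_derivative_growth f \<alpha>1 \<alpha>2" and t: "t > 0"
    and surj: "\<And>w. w \<in> julia_set f \<Longrightarrow> \<exists>z. \<not> is_pole f z \<and> f z = w"
    and x: "x \<in> julia_set f"
  shows "\<exists>c>0. \<forall>n. ennreal (c ^ n) \<le> (ruelle_op (inv_weight f \<alpha>2 t) f ^^ n) (\<lambda>_. 1) x"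
proof -
  note nm = transcendental_nicely_meromorphic[OF f]
  let ?L = "ruelle_op (inv_weight f \<alpha>2 t) f"
  obtain \<delta> where \<delta>: "\<delta> > 0" "\<And>z. z \<in> julia_set f \<Longrightarrow> norm z \<ge> \<delta>"
    using julia_set_away_from_0[OF F0] by blast
  obtain R where R: "R \<ge> norm x" "\<And>w. w \<in> julia_set f \<Longrightarrow> norm w \<le> R \<Longrightarrow> \<exists>z. \<not> is_pole f z \<and> f z = w \<and> norm z \<le> R"
    using exists_return_radius[OF f F0 q surj, of "norm x"] by blast
  have R0: "R > 0" using R(1) \<delta>(2)[OF x] \<delta>(1) by linarith
  \<comment> \<open>The condition \<open>norm (f z) \<le> R\<close> cuts out neighbourhoods of the
    poles, so this set is compact and \<open>deriv f\<close> is bounded on it.\<close>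
  let ?K = "{z. \<not> is_pole f z \<and> norm (f z) \<le> R} \<inter> cball 0 R"
  have "closed {z. \<not> is_pole f z \<and> norm (f z) \<le> R}"
  proof -
    have "\<exists>e>0. ball z e \<subseteq> - {z. \<not> is_pole f z \<and> norm (f z) \<le> R}" if z: "z \<in> - {z. \<not> is_pole f z \<and> norm (f z) \<le> R}" for z
    proof (cases "is_pole f z")
      case True
      then have "\<forall>\<^sub>F w in at z. norm (f w) \<ge> R + 1"
        by (simp add: is_pole_def filterlim_at_infinity[of 0, OF order_refl] R0 less_imp_le)
           (use R0 in \<open>auto simp: filterlim_at_infinity[of 0]\<close>)
      then obtain e where e: "e > 0" "\<And>w. w \<noteq> z \<Longrightarrow> dist w z < e \<Longrightarrow> norm (f w) \<ge> R + 1"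
        by (auto simp: eventually_at)
      have "w \<notin> {z. \<not> is_pole f z \<and> norm (f z) \<le> R}" if "w \<in> ball z e" for w
        using e(2)[of w] that True by (cases "w = z") (auto simp: dist_commute)
      then show ?thesis using e(1) by blast
    next
      case False
      then have "norm (f z) > R" using z by auto
      moreover have "isCont (\<lambda>z. norm (f z)) z" using isCont_nonpole[OF nm False] by (intro continuous_intros)
      ultimately have "\<forall>\<^sub>F w in at z. norm (f w) > R" by (simp add: isCont_def order_tendstoD(1))
      then obtain e where e: "e > 0" "\<And>w. w \<noteq> z \<Longrightarrow> dist w z < e \<Longrightarrow> norm (f w) > R"
        by (auto simp: eventually_at)
      have "w \<notin> {z. \<not> is_pole f z \<and> norm (f z) \<le> R}" if "w \<in> ball z e" for w
        using e(2)[of w] that \<open>norm (f z) > R\<close> by (cases "w = z") (auto simp: dist_commute)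
      then show ?thesis using e(1) by blast
    qed
    then show ?thesis unfolding closed_def open_contains_ball by blast
  qed
  then have "compact ?K" by (intro closed_Int_compact) auto
  moreover have "continuous_on ?K (deriv f)"
    by (intro holomorphic_on_imp_continuous_on holomorphic_on_subset[OF holomorphic_deriv[OF holomorphic_on_nonpoles[OF nm] open_nonpoles[OF nm]]]) auto
  ultimately have "bounded (deriv f ` ?K)" by (intro compact_imp_bounded compact_continuous_image)
  then obtain D where D: "D > 0" "\<forall>y\<in>deriv f ` ?K. norm y \<le> D" unfolding bounded_pos by blast
  \<comment> \<open>The factors bound \<open>norm (deriv f z)\<close>,
    \<open>norm z powr \<alpha>2\<close> and \<open>norm (f z) powr (- \<alpha>2)\<close>; the last
    uses the distance \<delta> of the Julia set from 0.\<close>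
  define S where "S = D * R powr \<alpha>2 * \<delta> powr (- \<alpha>2)"
  have S: "S > 0" using D(1) R0 \<delta>(1) by (simp add: S_def)
  have \<alpha>2: "\<alpha>2 > 0" using rg by (simp add: rapid_derivative_growth_def)
  define c where "c = S powr (- t)"
  have c: "c > 0" using S by (simp add: c_def)
  have "ennreal (c ^ n) \<le> (?L ^^ n) (\<lambda>_. 1) w" if "w \<in> julia_set f" "norm w \<le> R" for n w
    using that
  proof (induction n arbitrary: w)
    case (Suc n)
    obtain z where z: "\<not> is_pole f z" "f z = w" "norm z \<le> R" using R(2) Suc.prems by blast
    have zJ: "z \<in> julia_set f" using julia_set_image_iff[OF f z(1)] z(2) Suc.prems by simp
    have "z \<in> ?K" using z Suc.prems by auto
    then have "norm (deriv f z) \<le> D" using D(2) by blast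
    then have "sigma_deriv f \<alpha>2 z \<le> S"
      unfolding sigma_deriv_def S_def using z \<alpha>2 \<delta>(2)[OF Suc.prems(1)] \<delta>(1) D(1)
      by (intro mult_mono powr_mono2 powr_mono2') auto
    then have "c \<le> sigma_deriv f \<alpha>2 z powr (- t)"
      unfolding c_def using sigma_deriv_pos[OF f F0 rg zJ z(1)] t by (intro powr_mono2') auto
    then have cw: "ennreal c \<le> inv_weight f \<alpha>2 t z" using z(1) by (simp add: inv_weight_def ennreal_leI)
    have "ennreal (c ^ Suc n) = ennreal c * ennreal (c ^ n)" using c by (simp add: ennreal_mult)
    also have "\<dots> \<le> inv_weight f \<alpha>2 t z * (?L ^^ n) (\<lambda>_. 1) z"
      by (intro mult_mono cw Suc.IH zJ z(3)) auto
    also have "\<dots> = (\<integral>\<^sup>+y. inv_weight f \<alpha>2 t y * (?L ^^ n) (\<lambda>_. 1) y * indicator {z} y \<partial>count_space UNIV)"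
      by (rule nn_integral_singleton[symmetric])
    also have "\<dots> \<le> ?L ((?L ^^ n) (\<lambda>_. 1)) w"
      unfolding ruelle_op_def[of _ _ "(?L ^^ n) (\<lambda>_. 1)"] using z(2) by (intro nn_integral_mono) (auto split: split_indicator)
    finally show ?case by simp
  qed simp
  then show ?thesis using c x R(1) by blast
qed


subsection \<open>Eigenmeasures\<close>

lemma backward_weight_julia:
  assumes f: "transcendental_meromorphic f" and x: "x \<in> julia_set f"
  shows "backward_weight (inv_weight f \<alpha>2 t) f x n z \<noteq> 0 \<Longrightarrow> z \<in> julia_set f"
proof (induction n arbitrary: z)
  case 0
  then show ?case using x by (auto split: split_indicator_asm)
next
  case (Suc n)
  then have "f z \<in> julia_set f" "\<not> is_pole f z" by (auto simp: inv_weight_def split: if_splits)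
  then show ?case using julia_set_image_iff[OF f] by blast
qed

text \<open>The dual eigenvalue equation, demanded only for \<phi> whose image under the operator
  agrees on the Julia set with a bounded continuous \<Psi>. In this form it passes to weak limits of
  measures carried by the Julia set.\<close>

definition eigenmeasure :: "(complex \<Rightarrow> complex) \<Rightarrow> real \<Rightarrow> real \<Rightarrow> real \<Rightarrow> complex measure \<Rightarrow> bool" where
  "eigenmeasure f \<alpha>2 t p \<mu> \<longleftrightarrow> (\<forall>\<phi> \<Psi> :: complex \<Rightarrow> real.
     continuous_on UNIV \<phi> \<longrightarrow> bounded (range \<phi>) \<longrightarrow> (\<forall>z. \<phi> z \<ge> 0) \<longrightarrow>
     continuous_on UNIV \<Psi> \<longrightarrow> bounded (range \<Psi>) \<longrightarrow> (\<forall>z. \<Psi> z \<ge> 0) \<longrightarrow>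
     (\<forall>w\<in>julia_set f. ruelle_op (inv_weight f \<alpha>2 t) f (\<lambda>z. ennreal (\<phi> z)) w = ennreal (\<Psi> w)) \<longrightarrow>
     (\<integral>z. \<Psi> z \<partial>\<mu>) = exp p * (\<integral>z. \<phi> z \<partial>\<mu>))"

text \<open>The discrete measures satisfy the dual equation up to the factor
  \<open>exp (e k)\<close> and an error \<open>e k\<close> times a fixed number; both disappear as
  \<open>e k\<close> tends to 0.\<close>

lemma exists_eigenmeasure:
  fixes f :: "complex \<Rightarrow> complex" and \<alpha>2 t p :: real
  defines "L \<equiv> ruelle_op (inv_weight f \<alpha>2 t) f"
  assumes f: "transcendental_meromorphic f" and x: "x \<in> julia_set f"
    and \<gamma>: "\<gamma> > 0" and \<delta>: "\<delta> > 0" and C: "C > 0"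
    and tail: "\<And>w R. w \<in> julia_set f \<Longrightarrow> R \<ge> \<delta> \<Longrightarrow> L (indicator {z. R \<le> norm z}) w \<le> ennreal (C * R powr (- \<gamma>))"
    and up: "\<And>s. s > 0 \<Longrightarrow> \<exists>C>0. \<forall>n. (L ^^ n) (\<lambda>_. 1) x \<le> ennreal (C * exp ((p + s) * real n))"
    and lo: "\<And>s. s > 0 \<Longrightarrow> \<exists>\<^sub>\<infinity>n. ennreal (exp ((p - s) * real n)) \<le> (L ^^ n) (\<lambda>_. 1) x"
  obtains \<mu> where "prob_space \<mu>" "sets \<mu> = sets borel" "AE z in \<mu>. z \<in> julia_set f"
    "eigenmeasure f \<alpha>2 t p \<mu>"
proof -
  let ?J = "julia_set f"
  define e where "e k = inverse (real (Suc k))" for k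
  have e: "e k > 0" "e k \<le> 1" for k by (auto simp: e_def field_simps)
  have e_lim: "e \<longlonglongrightarrow> 0" unfolding e_def by (rule LIMSEQ_inverse_real_of_nat)
  have "\<exists>M. prob_space M \<and> sets M = UNIV \<and> emeasure M (- ?J) = 0 \<and>
     (\<forall>\<phi>. (\<integral>\<^sup>+z. L \<phi> z \<partial>M) \<le> ennreal (exp (e k)) * (ennreal (exp p) * (\<integral>\<^sup>+z. \<phi> z \<partial>M))) \<and>
     (\<forall>\<phi>. ennreal (exp p) * (\<integral>\<^sup>+z. \<phi> z \<partial>M) \<le>
        ennreal (exp (e k)) * (\<integral>\<^sup>+z. L \<phi> z \<partial>M) + ennreal (e k) * (ennreal (exp p) * \<phi> x))" for k
  proof -
    obtain M where M: "prob_space M" "sets M = UNIV"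
      "emeasure M {z. \<forall>n. backward_weight (inv_weight f \<alpha>2 t) f x n z = 0} = 0"
      "\<And>\<phi>. (\<integral>\<^sup>+z. L \<phi> z \<partial>M) \<le> ennreal (exp (e k)) * (ennreal (exp p) * (\<integral>\<^sup>+z. \<phi> z \<partial>M))"
      "\<And>\<phi>. ennreal (exp p) * (\<integral>\<^sup>+z. \<phi> z \<partial>M) \<le>
        ennreal (exp (e k)) * (\<integral>\<^sup>+z. L \<phi> z \<partial>M) + ennreal (e k) * (ennreal (exp p) * \<phi> x)"
      using exists_almost_conformal_discrete_measure[OF up[unfolded L_def] lo[unfolded L_def] e(1)[of k]]
      unfolding L_def by blast
    have "- ?J \<subseteq> {z. \<forall>n. backward_weight (inv_weight f \<alpha>2 t) f x n z = 0}"
      using backward_weight_julia[OF f x] by blast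
    then have "emeasure M (- ?J) \<le> emeasure M {z. \<forall>n. backward_weight (inv_weight f \<alpha>2 t) f x n z = 0}"
      by (intro emeasure_mono) (auto simp: M(2))
    then have "emeasure M (- ?J) = 0" using M(3) by simp
    then show ?thesis using M by blast
  qed
  then obtain M where M: "\<And>k. prob_space (M k)" "\<And>k. sets (M k) = UNIV" "\<And>k. emeasure (M k) (- ?J) = 0"
     and Ma: "\<And>k \<phi>. (\<integral>\<^sup>+z. L \<phi> z \<partial>M k) \<le> ennreal (exp (e k)) * (ennreal (exp p) * (\<integral>\<^sup>+z. \<phi> z \<partial>M k))"
     and Mb: "\<And>k \<phi>. ennreal (exp p) * (\<integral>\<^sup>+z. \<phi> z \<partial>M k) \<le>
        ennreal (exp (e k)) * (\<integral>\<^sup>+z. L \<phi> z \<partial>M k) + ennreal (e k) * (ennreal (exp p) * \<phi> x)"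
    by metis
  have space: "space (M k) = UNIV" for k
    using sets_eq_imp_space_eq[of "M k" "count_space UNIV"] M(2) by simp
  have meas: "g \<in> borel_measurable (M k)" for g :: "complex \<Rightarrow> 'c::topological_space" and k
    using M(2) by (auto simp: measurable_def space)
  have AEJ: "AE z in M k. z \<in> ?J" for k
    by (rule AE_I[of _ _ "- ?J"]) (auto simp: M)
  \<comment> \<open>Tested on the indicator of the outside of a disc containing \<open>x\<close>,
    the lower dual inequality loses its error term and bounds the mass outside by the tail estimate.
    The \<open>exp 1\<close> hidden in \<open>exp (p - 1)\<close> bounds
    \<open>exp (e k)\<close>.\<close>
  have tight: "\<exists>B. \<forall>k. measure (M k) {z. norm z > B} < \<epsilon>" if \<epsilon>: "\<epsilon> > 0" for \<epsilon>
  proof -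
    have "((\<lambda>R. R powr (- \<gamma>)) \<longlongrightarrow> 0) at_top"
      by (rule tendsto_neg_powr) (use \<gamma> filterlim_ident in auto)
    then have "\<forall>\<^sub>F R in at_top. R powr (- \<gamma>) < \<epsilon> * exp (p - 1) / C"
      using \<epsilon> C by (intro order_tendstoD(2)) auto
    then have "\<forall>\<^sub>F R in at_top. R powr (- \<gamma>) < \<epsilon> * exp (p - 1) / C \<and> R > norm x \<and> R \<ge> \<delta>"
      using eventually_gt_at_top[of "norm x"] eventually_ge_at_top[of \<delta>] by eventually_elim auto
    then obtain R where R: "R powr (- \<gamma>) < \<epsilon> * exp (p - 1) / C" "R > norm x" "R \<ge> \<delta>"
      by (auto simp: eventually_at_top_linorder)
    have "measure (M k) {z. norm z > R} < \<epsilon>" for k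
    proof -
      interpret prob_space "M k" by (rule M)
      let ?\<phi> = "indicator {z. R \<le> norm z} :: complex \<Rightarrow> ennreal"
      have "(\<integral>\<^sup>+z. L ?\<phi> z \<partial>M k) \<le> (\<integral>\<^sup>+z. ennreal (C * R powr (- \<gamma>)) \<partial>M k)"
        by (intro nn_integral_mono_AE eventually_mono[OF AEJ[of k]]) (use tail R(3) in blast)
      also have "\<dots> = ennreal (C * R powr (- \<gamma>))" by (simp add: emeasure_space_1)
      finally have 1: "(\<integral>\<^sup>+z. L ?\<phi> z \<partial>M k) \<le> ennreal (C * R powr (- \<gamma>))" .
      have "ennreal (exp p) * (\<integral>\<^sup>+z. ?\<phi> z \<partial>M k) \<le> ennreal (exp (e k)) * (\<integral>\<^sup>+z. L ?\<phi> z \<partial>M k)"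
        using Mb[of k ?\<phi>] R(2) by (simp add: not_le)
      also have "\<dots> \<le> ennreal (exp 1) * ennreal (C * R powr (- \<gamma>))"
        using e(2)[of k] by (intro mult_mono 1 ennreal_leI) auto
      also have "(\<integral>\<^sup>+z. ?\<phi> z \<partial>M k) = emeasure (M k) {z. R \<le> norm z}" by (simp add: M(2))
      finally have "ennreal (exp p * measure (M k) {z. R \<le> norm z}) \<le> ennreal (exp 1 * (C * R powr (- \<gamma>)))"
        using C by (simp add: emeasure_eq_measure ennreal_mult)
      then have "exp p * measure (M k) {z. R \<le> norm z} \<le> exp 1 * (C * R powr (- \<gamma>))"
        using C by (subst (asm) ennreal_le_iff) auto
      also have "\<dots> < exp 1 * (\<epsilon> * exp (p - 1))" using R(1) C by (simp add: field_simps)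
      also have "\<dots> = exp p * \<epsilon>" by (simp add: exp_diff)
      finally have "measure (M k) {z. R \<le> norm z} < \<epsilon>" by simp
      moreover have "measure (M k) {z. norm z > R} \<le> measure (M k) {z. R \<le> norm z}"
        by (intro finite_measure_mono) (auto simp: M(2))
      ultimately show ?thesis by linarith
    qed
    then show ?thesis by blast
  qed
  obtain r \<mu> where r: "strict_mono r" and \<mu>: "prob_space \<mu>" "sets \<mu> = sets borel"
    and conv: "\<And>\<phi> :: complex \<Rightarrow> real. continuous_on UNIV \<phi> \<Longrightarrow> bounded (range \<phi>) \<Longrightarrow>
       (\<lambda>k. \<integral>z. \<phi> z \<partial>M (r k)) \<longlonglongrightarrow> (\<integral>z. \<phi> z \<partial>\<mu>)"
    using tight_discrete_weak_limit[OF M(1,2) tight] by blast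
  interpret \<mu>: prob_space \<mu> by (rule \<mu>)
  have intM: "integrable (M k) \<phi>" if b: "bounded (range \<phi>)" for \<phi> :: "complex \<Rightarrow> real" and k
  proof -
    interpret prob_space "M k" by (rule M)
    obtain B where "\<And>z. norm (\<phi> z) \<le> B" using b unfolding bounded_iff by auto
    then show ?thesis by (intro integrable_const_bound[of _ B] meas) auto
  qed
  have int\<mu>: "integrable \<mu> \<phi>" if \<phi>: "continuous_on UNIV \<phi>" "bounded (range \<phi>)" for \<phi> :: "complex \<Rightarrow> real"
  proof -
    obtain B where B: "\<And>z. norm (\<phi> z) \<le> B" using \<phi>(2) unfolding bounded_iff by auto
    have "\<phi> \<in> borel_measurable \<mu>"
      using borel_measurable_continuous_onI[OF \<phi>(1)] by (simp add: measurable_cong_sets[OF \<mu>(2) refl])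
    then show ?thesis using B by (intro \<mu>.integrable_const_bound[of _ B]) auto
  qed
  have "AE z in \<mu>. z \<in> ?J"
  proof -
    \<comment> \<open>A bounded continuous function that vanishes exactly on the closed Julia set
      detects mass off it.\<close>
    let ?\<phi> = "\<lambda>z. min 1 (infdist z ?J)"
    have c: "continuous_on UNIV ?\<phi>" by (intro continuous_intros)
    have b: "bounded (range ?\<phi>)" by (rule boundedI[of _ 1]) (auto simp: infdist_nonneg)
    have "(\<integral>z. ?\<phi> z \<partial>M k) = (\<integral>z. 0 \<partial>M k)" for k
      by (intro integral_cong_AE meas eventually_mono[OF AEJ[of k]]) simp
    then have "(\<lambda>k. 0) \<longlonglongrightarrow> (\<integral>z. ?\<phi> z \<partial>\<mu>)" using conv[OF c b] by simp
    then have "(\<integral>z. ?\<phi> z \<partial>\<mu>) = 0" by (metis LIMSEQ_const_iff)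
    then have "AE z in \<mu>. ?\<phi> z = 0"
      by (subst (asm) integral_nonneg_eq_0_iff_AE) (auto intro: int\<mu>[OF c b] simp: infdist_nonneg)
    then show ?thesis
    proof eventually_elim
      case (elim z)
      then have "infdist z ?J = 0" by (auto simp: min_def split: if_splits)
      then show ?case using in_closed_iff_infdist_zero[OF closed_julia_set, of f z] x by blast
    qed
  qed
  moreover have "(\<integral>z. \<Psi> z \<partial>\<mu>) = exp p * (\<integral>z. \<phi> z \<partial>\<mu>)"
    if \<phi>: "continuous_on UNIV \<phi>" "bounded (range \<phi>)" "\<And>z. \<phi> z \<ge> 0"
      and \<Psi>: "continuous_on UNIV \<Psi>" "bounded (range \<Psi>)" "\<And>z. \<Psi> z \<ge> 0"
      and eq: "\<And>w. w \<in> ?J \<Longrightarrow> L (\<lambda>z. ennreal (\<phi> z)) w = ennreal (\<Psi> w)" for \<phi> \<Psi> :: "complex \<Rightarrow> real"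
  proof -
    have L: "(\<integral>\<^sup>+z. L (\<lambda>z. ennreal (\<phi> z)) z \<partial>M k) = ennreal (\<integral>z. \<Psi> z \<partial>M k)" for k
    proof -
      have "(\<integral>\<^sup>+z. L (\<lambda>z. ennreal (\<phi> z)) z \<partial>M k) = (\<integral>\<^sup>+z. ennreal (\<Psi> z) \<partial>M k)"
        by (intro nn_integral_cong_AE eventually_mono[OF AEJ[of k]]) (simp add: eq)
      then show ?thesis using intM[OF \<Psi>(2)] \<Psi>(3) by (simp add: nn_integral_eq_integral)
    qed
    have F: "(\<integral>\<^sup>+z. ennreal (\<phi> z) \<partial>M k) = ennreal (\<integral>z. \<phi> z \<partial>M k)" for k
      using intM[OF \<phi>(2)] \<phi>(3) by (simp add: nn_integral_eq_integral)
    have pos: "(\<integral>z. \<Psi> z \<partial>M k) \<ge> 0" "(\<integral>z. \<phi> z \<partial>M k) \<ge> 0" for k using \<phi>(3) \<Psi>(3) by auto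
    have a: "(\<integral>z. \<Psi> z \<partial>M k) \<le> exp (e k) * (exp p * (\<integral>z. \<phi> z \<partial>M k))" for k
    proof -
      have "ennreal (\<integral>z. \<Psi> z \<partial>M k) \<le> ennreal (exp (e k) * (exp p * (\<integral>z. \<phi> z \<partial>M k)))"
        using Ma[of k "\<lambda>z. ennreal (\<phi> z)"] pos[of k] unfolding L F by (simp add: ennreal_mult)
      then show ?thesis using pos[of k] by (subst (asm) ennreal_le_iff) auto
    qed
    have b: "exp p * (\<integral>z. \<phi> z \<partial>M k) \<le> exp (e k) * (\<integral>z. \<Psi> z \<partial>M k) + e k * (exp p * \<phi> x)" for k
    proof -
      have "ennreal (exp p * (\<integral>z. \<phi> z \<partial>M k)) \<le> ennreal (exp (e k) * (\<integral>z. \<Psi> z \<partial>M k) + e k * (exp p * \<phi> x))"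
        using Mb[of k "\<lambda>z. ennreal (\<phi> z)"] pos[of k] e(1)[of k] \<phi>(3)[of x]
        unfolding L F by (simp add: ennreal_mult ennreal_plus)
      then show ?thesis using pos[of k] e(1)[of k] \<phi>(3)[of x] by (subst (asm) ennreal_le_iff) auto
    qed
    have er: "(\<lambda>k. e (r k)) \<longlonglongrightarrow> 0" using LIMSEQ_subseq_LIMSEQ[OF e_lim r] by (simp add: o_def)
    have exr: "(\<lambda>k. exp (e (r k))) \<longlonglongrightarrow> exp 0" by (intro tendsto_exp er)
    have c1: "(\<lambda>k. \<integral>z. \<Psi> z \<partial>M (r k)) \<longlonglongrightarrow> (\<integral>z. \<Psi> z \<partial>\<mu>)" by (rule conv[OF \<Psi>(1,2)])
    have c2: "(\<lambda>k. \<integral>z. \<phi> z \<partial>M (r k)) \<longlonglongrightarrow> (\<integral>z. \<phi> z \<partial>\<mu>)" by (rule conv[OF \<phi>(1,2)])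
    have "(\<integral>z. \<Psi> z \<partial>\<mu>) \<le> exp 0 * (exp p * (\<integral>z. \<phi> z \<partial>\<mu>))"
      by (rule LIMSEQ_le[OF c1 tendsto_mult[OF exr tendsto_mult[OF tendsto_const c2]]]) (use a in blast)
    moreover have "exp p * (\<integral>z. \<phi> z \<partial>\<mu>) \<le> exp 0 * (\<integral>z. \<Psi> z \<partial>\<mu>) + 0 * (exp p * \<phi> x)"
      by (rule LIMSEQ_le[OF tendsto_mult[OF tendsto_const c2] tendsto_add[OF tendsto_mult[OF exr c1] tendsto_mult[OF er tendsto_const]]])
         (use b in blast)
    ultimately show ?thesis by simp
  qed
  then have "eigenmeasure f \<alpha>2 t p \<mu>" unfolding eigenmeasure_def L_def by blast
  ultimately show thesis using that \<mu> by blast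
qed


subsection \<open>Conformality\<close>

text \<open>The derivative does not vanish at \<open>z0\<close>, so \<open>f\<close> is injective
  nearby. The disc also avoids poles, zeros of \<open>f\<close> and the origin, which makes \<sigma>
  positive and continuous on all of it, not only on the Julia set.\<close>

lemma julia_injective_ball:
  assumes f: "transcendental_meromorphic f" and F0: "0 \<in> fatou_set f"
    and rg: "rapid_derivative_growth f \<alpha>1 \<alpha>2" and z0: "z0 \<in> julia_set f" "\<not> is_pole f z0"
  obtains e where "e > 0" "ball z0 e \<subseteq> {z. \<not> is_pole f z}" "inj_on f (ball z0 e)"
    "\<And>z. z \<in> ball z0 e \<Longrightarrow> sigma_deriv f \<alpha>2 z > 0" "continuous_on (ball z0 e) (sigma_deriv f \<alpha>2)"
proof -
  note nm = transcendental_nicely_meromorphic[OF f]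
  note hol = holomorphic_on_nonpoles[OF nm]
  have fz0: "f z0 \<noteq> 0" "z0 \<noteq> 0"
    using julia_set_nonzero[OF F0] z0 julia_set_image_iff[OF f z0(2)] by blast+
  have dz0: "deriv f z0 \<noteq> 0"
    using sigma_deriv_pos[OF f F0 rg z0] by (auto simp: sigma_deriv_def)
  define S where "S = ({z. \<not> is_pole f z} \<inter> f -` (- {0})) \<inter> - {0}"
  have "open ({z. \<not> is_pole f z} \<inter> f -` (- {0}))"
    by (rule continuous_open_preimage[OF holomorphic_on_imp_continuous_on[OF hol] open_nonpoles[OF nm]]) auto
  then have "open S" unfolding S_def by (rule open_Int) auto
  moreover have "z0 \<in> S" using fz0 z0 by (simp add: S_def)
  moreover have hS: "f holomorphic_on S" by (rule holomorphic_on_subset[OF hol]) (auto simp: S_def)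
  ultimately obtain e where e: "e > 0" "ball z0 e \<subseteq> S" "inj_on f (ball z0 e)"
    using has_complex_derivative_locally_injective[OF hS _ _ dz0] by blast
  have hb: "f holomorphic_on ball z0 e" by (rule holomorphic_on_subset[OF hS e(2)])
  have S: "\<not> is_pole f z" "f z \<noteq> 0" "z \<noteq> 0" if "z \<in> ball z0 e" for z
    using that e(2) by (auto simp: S_def)
  have d: "deriv f z \<noteq> 0" if "z \<in> ball z0 e" for z
    using holomorphic_injective_imp_regular[OF hb open_ball e(3) that] .
  have "sigma_deriv f \<alpha>2 z > 0" if "z \<in> ball z0 e" for z
    using S[OF that] d[OF that] unfolding sigma_deriv_def by (intro mult_pos_pos) auto
  moreover have "continuous_on (ball z0 e) (sigma_deriv f \<alpha>2)"
  proof -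
    have "continuous_on (ball z0 e) f" "continuous_on (ball z0 e) (deriv f)"
      using hb holomorphic_deriv[OF hb open_ball] by (auto intro: holomorphic_on_imp_continuous_on)
    then show ?thesis unfolding sigma_deriv_def[abs_def]
      using S by (intro continuous_intros) auto
  qed
  ultimately show thesis using that[of e] e S by blast
qed

text \<open>Testing the eigenmeasure property against \<open>\<phi> = \<psi> \<sigma>^t\<close> with \<open>\<psi>\<close> supported where \<open>f\<close> is injective:
  then the sum \<open>L \<phi>\<close> has at most one term and equals \<open>\<psi>\<close> composed with the inverse branch.\<close>

lemma eigenmeasure_conformal_open:
  fixes \<mu> :: "complex measure" and f :: "complex \<Rightarrow> complex"
  assumes f: "transcendental_meromorphic f"
    and \<mu>: "prob_space \<mu>" "sets \<mu> = sets borel"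
    and eig: "eigenmeasure f \<alpha>2 t p \<mu>"
    and e: "0 < e" "ball z0 e \<subseteq> {z. \<not> is_pole f z}" "inj_on f (ball z0 e)"
    and sd: "\<And>z. z \<in> ball z0 e \<Longrightarrow> sigma_deriv f \<alpha>2 z > 0" "continuous_on (ball z0 e) (sigma_deriv f \<alpha>2)"
    and U: "open U" "U \<subseteq> ball z0 (e / 2)"
  shows "emeasure \<mu> (f ` U) = (\<integral>\<^sup>+z. ennreal (exp p * sigma_deriv f \<alpha>2 z powr t) * indicator U z \<partial>\<mu>)"
proof -
  interpret \<mu>: prob_space \<mu> by (rule \<mu>)
  let ?B = "ball z0 e" and ?K = "cball z0 (e / 2)"
  note nm = transcendental_nicely_meromorphic[OF f]
  have KB: "?K \<subseteq> ?B" using e(1) by auto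
  have hol: "f holomorphic_on ?B" by (rule holomorphic_on_subset[OF holomorphic_on_nonpoles[OF nm] e(2)])
  obtain g where g: "g holomorphic_on f ` ?B" "\<And>z. z \<in> ?B \<Longrightarrow> g (f z) = z"
    using holomorphic_has_inverse[OF hol open_ball e(3)] by metis
  have ofB: "open (f ` ?B)" using e(2) by (intro transcendental_open_map[OF f]) auto
  have fU: "open (f ` U)" using U KB e(1,2) ball_subset_cball[of z0 "e / 2"]
    by (intro transcendental_open_map[OF f]) blast+
  have UK: "U \<subseteq> ?K" using U(2) ball_subset_cball by blast
  \<comment> \<open>The distance to the empty set is 0 by convention, which would make \<psi> vanish
    identically.\<close>
  have ne: "- U \<noteq> {}"
  proof
    assume "- U = {}"
    then have "ball z0 (e / 2) = UNIV" using U(2) by auto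
    then show False using bounded_ball not_bounded_UNIV by metis
  qed
  \<comment> \<open>Continuous functions increasing to the indicator of \<open>U\<close>.\<close>
  define \<psi> where "\<psi> n z = min 1 (real n * infdist z (- U))" for n z
  define \<phi> where "\<phi> n z = (if z \<in> ?B then \<psi> n z * sigma_deriv f \<alpha>2 z powr t else 0)" for n z
  define \<Psi> where "\<Psi> n w = (if w \<in> f ` ?B then \<psi> n (g w) else 0)" for n w
  have \<psi>0: "\<psi> n z = 0" if "z \<notin> U" for n z
    using that by (simp add: \<psi>_def infdist_zero)
  have \<psi>b: "0 \<le> \<psi> n z" "\<psi> n z \<le> 1" for n z by (auto simp: \<psi>_def infdist_nonneg)
  have \<psi>c: "continuous_on A (\<psi> n)" for A n unfolding \<psi>_def by (intro continuous_intros)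
  have sdt: "continuous_on ?B (\<lambda>z. sigma_deriv f \<alpha>2 z powr t)"
    using sd(1) by (intro continuous_on_powr sd(2) continuous_on_const) (metis less_irrefl)
  \<comment> \<open>Extension by 0 is continuous because the support lies in the closed half-radius
    disc, inside the disc of injectivity.\<close>
  have \<phi>c: "continuous_on UNIV (\<phi> n)" for n
  proof -
    have "continuous_on ?B (\<phi> n)"
      using continuous_on_mult[OF \<psi>c sdt, of n] by (rule continuous_on_eq) (simp add: \<phi>_def)
    moreover have "continuous_on (- ?K) (\<phi> n)"
    proof (rule continuous_on_eq[OF continuous_on_const[of _ 0]])
      fix z assume "z \<in> - ?K"
      then have "z \<notin> U" using UK by blast
      then show "0 = \<phi> n z" using \<psi>0 by (simp add: \<phi>_def)
    qed
    ultimately have "continuous_on (?B \<union> - ?K) (\<phi> n)" by (intro continuous_on_open_Un) auto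
    moreover have "?B \<union> - ?K = UNIV" using KB by auto
    ultimately show ?thesis by simp
  qed
  have \<phi>0: "\<phi> n z = 0" if "z \<notin> U" for n z using \<psi>0[OF that] by (simp add: \<phi>_def)
  have \<phi>b: "bounded (range (\<phi> n))" for n
  proof -
    have "compact (\<phi> n ` ?K)" by (intro compact_continuous_image continuous_on_subset[OF \<phi>c]) auto
    then have "bounded (insert 0 (\<phi> n ` ?K))" by (simp add: compact_imp_bounded)
    moreover have "range (\<phi> n) \<subseteq> insert 0 (\<phi> n ` ?K)" using \<phi>0 UK by blast
    ultimately show ?thesis using bounded_subset by blast
  qed
  have \<phi>pos: "\<phi> n z \<ge> 0" for n z using \<psi>b by (simp add: \<phi>_def)
  have \<Psi>c: "continuous_on UNIV (\<Psi> n)" for n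
  proof -
    have "continuous_on (f ` ?B) (\<lambda>w. \<psi> n (g w))"
      by (rule continuous_on_compose2[OF \<psi>c[of UNIV] holomorphic_on_imp_continuous_on[OF g(1)]]) auto
    then have "continuous_on (f ` ?B) (\<Psi> n)" by (rule continuous_on_eq) (simp add: \<Psi>_def)
    moreover have "continuous_on (- (f ` ?K)) (\<Psi> n)"
    proof (rule continuous_on_eq[OF continuous_on_const[of _ 0]])
      fix w assume w: "w \<in> - (f ` ?K)"
      show "0 = \<Psi> n w"
      proof (cases "w \<in> f ` ?B")
        case True
        then obtain z where z: "z \<in> ?B" "w = f z" by blast
        then have "z \<notin> U" using w UK by auto
        then show ?thesis using z g(2) \<psi>0 by (simp add: \<Psi>_def)
      qed (simp add: \<Psi>_def)
    qed
    moreover have "closed (f ` ?K)"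
      by (intro compact_imp_closed compact_continuous_image continuous_on_subset[OF holomorphic_on_imp_continuous_on[OF hol] KB]) auto
    ultimately have "continuous_on (f ` ?B \<union> - (f ` ?K)) (\<Psi> n)"
      using ofB by (intro continuous_on_open_Un) auto
    moreover have "f ` ?B \<union> - (f ` ?K) = UNIV" using KB by auto
    ultimately show ?thesis by simp
  qed
  have \<Psi>b: "0 \<le> \<Psi> n w" "\<Psi> n w \<le> 1" for n w using \<psi>b by (auto simp: \<Psi>_def)
  have \<Psi>bd: "bounded (range (\<Psi> n))" for n by (rule boundedI[of _ 1]) (use \<Psi>b in auto)
  have L: "ruelle_op (inv_weight f \<alpha>2 t) f (\<lambda>z. ennreal (\<phi> n z)) w = ennreal (\<Psi> n w)" for n w
  proof (cases "w \<in> f ` ?B")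
    case True
    then obtain y where y: "y \<in> ?B" "w = f y" by blast
    have "ruelle_op (inv_weight f \<alpha>2 t) f (\<lambda>z. ennreal (\<phi> n z)) w
        = (\<integral>\<^sup>+z. inv_weight f \<alpha>2 t z * ennreal (\<phi> n z) * indicator {y} z \<partial>count_space UNIV)"
      unfolding ruelle_op_def
    proof (rule nn_integral_cong)
      fix z
      show "inv_weight f \<alpha>2 t z * indicator {w} (f z) * ennreal (\<phi> n z) = inv_weight f \<alpha>2 t z * ennreal (\<phi> n z) * indicator {y} z"
      proof (cases "z \<in> ?B")
        case True
        then have "f z = w \<longleftrightarrow> z = y" using y e(3) by (auto dest: inj_onD)
        then have "indicator {w} (f z) = (indicator {y} z :: ennreal)" by (auto split: split_indicator)
        then show ?thesis by (simp only: mult_ac)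
      qed (simp add: \<phi>_def)
    qed
    also have "\<dots> = inv_weight f \<alpha>2 t y * ennreal (\<phi> n y)" by (rule nn_integral_singleton)
    also have "\<dots> = ennreal (sigma_deriv f \<alpha>2 y powr (- t) * (\<psi> n y * sigma_deriv f \<alpha>2 y powr t))"
      using y e(2) \<psi>b[of n y] by (auto simp: inv_weight_def \<phi>_def ennreal_mult)
    also have "sigma_deriv f \<alpha>2 y powr (- t) * (\<psi> n y * sigma_deriv f \<alpha>2 y powr t) = \<psi> n y"
      using sd(1)[OF y(1)] by (simp add: powr_minus field_simps)
    also have "\<psi> n y = \<Psi> n w" using y g(2) by (simp add: \<Psi>_def)
    finally show ?thesis .
  next
    case False
    have "ruelle_op (inv_weight f \<alpha>2 t) f (\<lambda>z. ennreal (\<phi> n z)) w = (\<integral>\<^sup>+(z::complex). 0 \<partial>count_space UNIV)"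
      unfolding ruelle_op_def
    proof (rule nn_integral_cong)
      fix z
      show "inv_weight f \<alpha>2 t z * indicator {w} (f z) * ennreal (\<phi> n z) = 0"
        using False by (cases "z \<in> ?B") (auto simp: \<phi>_def split: split_indicator)
    qed
    then show ?thesis using False by (simp add: \<Psi>_def)
  qed
  have meas: "h \<in> borel_measurable \<mu>" if "continuous_on UNIV h" for h :: "complex \<Rightarrow> real"
    using borel_measurable_continuous_onI[OF that] by (simp add: measurable_cong_sets[OF \<mu>(2) refl])
  have int: "integrable \<mu> h" if h: "continuous_on UNIV h" "bounded (range h)" for h :: "complex \<Rightarrow> real"
  proof -
    obtain B where B: "\<And>z. norm (h z) \<le> B" using h(2) unfolding bounded_iff by auto
    show ?thesis using B by (intro \<mu>.integrable_const_bound[of _ B] meas h) auto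
  qed
  have main: "(\<integral>\<^sup>+w. ennreal (\<Psi> n w) \<partial>\<mu>) = (\<integral>\<^sup>+z. ennreal (exp p * \<phi> n z) \<partial>\<mu>)" for n
  proof -
    have "(\<integral>\<^sup>+w. ennreal (\<Psi> n w) \<partial>\<mu>) = ennreal (\<integral>w. \<Psi> n w \<partial>\<mu>)"
      using \<Psi>b(1) by (intro nn_integral_eq_integral int \<Psi>c \<Psi>bd) auto
    also have "(\<integral>w. \<Psi> n w \<partial>\<mu>) = exp p * (\<integral>z. \<phi> n z \<partial>\<mu>)"
      using eig \<phi>c \<phi>b \<phi>pos \<Psi>c \<Psi>bd \<Psi>b(1) L unfolding eigenmeasure_def by simp
    also have "\<dots> = (\<integral>z. exp p * \<phi> n z \<partial>\<mu>)" by simp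
    also have "ennreal \<dots> = (\<integral>\<^sup>+z. ennreal (exp p * \<phi> n z) \<partial>\<mu>)"
      using \<phi>pos by (intro nn_integral_eq_integral[symmetric] integrable_mult_right int \<phi>c \<phi>b) auto
    finally show ?thesis .
  qed
  have \<psi>mono: "\<psi> m z \<le> \<psi> n z" if "m \<le> n" for m n z
    unfolding \<psi>_def using that by (intro min.mono mult_right_mono) (auto simp: infdist_nonneg)
  have \<psi>lim: "(\<lambda>n. \<psi> n z) \<longlonglongrightarrow> indicator U z" for z
  proof (cases "z \<in> U")
    case True
    have "closed (- U)" using U(1) by (simp only: closed_Compl)
    then have "infdist z (- U) \<noteq> 0" using in_closed_iff_infdist_zero[of "- U" z] ne True by auto
    then have pos: "infdist z (- U) > 0" using infdist_nonneg[of z "- U"] by linarith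
    obtain N :: nat where N: "1 / infdist z (- U) \<le> real N" using real_arch_simple by blast
    have "\<psi> n z = 1" if "n \<ge> N" for n
    proof -
      have "1 / infdist z (- U) \<le> real n" using N that by linarith
      then show ?thesis using pos by (simp add: \<psi>_def field_simps)
    qed
    then have "\<forall>\<^sub>F n in sequentially. \<psi> n z = 1" by (auto simp: eventually_sequentially)
    then show ?thesis using True by (simp add: tendsto_eventually)
  next
    case False
    then show ?thesis using \<psi>0[OF False] by simp
  qed
  have l1: "(\<lambda>n. \<integral>\<^sup>+w. ennreal (\<Psi> n w) \<partial>\<mu>) \<longlonglongrightarrow> (\<integral>\<^sup>+w. indicator (f ` U) w \<partial>\<mu>)"
  proof (rule nn_integral_LIMSEQ)
    show "incseq (\<lambda>n w. ennreal (\<Psi> n w))"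
      using \<psi>mono by (auto simp: incseq_def le_fun_def \<Psi>_def intro!: ennreal_leI)
    show "(\<lambda>w. ennreal (\<Psi> n w)) \<in> borel_measurable \<mu>" for n using meas[OF \<Psi>c] by simp
    fix w
    show "(\<lambda>n. ennreal (\<Psi> n w)) \<longlonglongrightarrow> indicator (f ` U) w"
    proof (cases "w \<in> f ` ?B")
      case True
      then obtain y where y: "y \<in> ?B" "w = f y" by blast
      have "w \<in> f ` U \<longleftrightarrow> y \<in> U"
        unfolding y(2) using UK KB by (intro inj_on_image_mem_iff[OF e(3) y(1)]) blast
      then have ind: "indicator (f ` U) w = ennreal (indicator U y)" by (auto split: split_indicator)
      have "(\<lambda>n. ennreal (\<psi> n y)) \<longlonglongrightarrow> ennreal (indicator U y)" by (intro tendsto_ennrealI \<psi>lim)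
      then show ?thesis unfolding ind using y g(2) by (simp add: \<Psi>_def)
    next
      case False
      then have "w \<notin> f ` U" using UK KB by blast
      then show ?thesis using False by (simp add: \<Psi>_def)
    qed
  qed
  have l2: "(\<lambda>n. \<integral>\<^sup>+z. ennreal (exp p * \<phi> n z) \<partial>\<mu>) \<longlonglongrightarrow>
      (\<integral>\<^sup>+z. ennreal (exp p * sigma_deriv f \<alpha>2 z powr t) * indicator U z \<partial>\<mu>)"
  proof (rule nn_integral_LIMSEQ)
    show "incseq (\<lambda>n z. ennreal (exp p * \<phi> n z))"
      using \<psi>mono by (auto simp: incseq_def le_fun_def \<phi>_def intro!: ennreal_leI mult_left_mono mult_right_mono)
    show "(\<lambda>z. ennreal (exp p * \<phi> n z)) \<in> borel_measurable \<mu>" for n using meas[OF \<phi>c] by simp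
    fix z
    show "(\<lambda>n. ennreal (exp p * \<phi> n z)) \<longlonglongrightarrow> ennreal (exp p * sigma_deriv f \<alpha>2 z powr t) * indicator U z"
    proof (cases "z \<in> U")
      case True
      then have "z \<in> ?B" using UK KB by blast
      have "(\<lambda>n. ennreal (exp p * (\<psi> n z * sigma_deriv f \<alpha>2 z powr t))) \<longlonglongrightarrow>
          ennreal (exp p * (indicator U z * sigma_deriv f \<alpha>2 z powr t))"
        by (intro tendsto_ennrealI tendsto_intros \<psi>lim)
      then show ?thesis using True \<open>z \<in> ?B\<close> by (simp add: \<phi>_def)
    next
      case False
      then show ?thesis by (simp add: \<phi>0)
    qed
  qed
  have "(\<integral>\<^sup>+w. indicator (f ` U) w \<partial>\<mu>) = (\<integral>\<^sup>+z. ennreal (exp p * sigma_deriv f \<alpha>2 z powr t) * indicator U z \<partial>\<mu>)"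
    using LIMSEQ_unique[OF l1[unfolded main] l2] .
  moreover have "(\<integral>\<^sup>+w. indicator (f ` U) w \<partial>\<mu>) = emeasure \<mu> (f ` U)"
    using fU by (intro nn_integral_indicator) (simp add: \<mu>(2))
  ultimately show ?thesis by simp
qed

text \<open>Both sides are measures in the set: the push-forward of \<mu> under the inverse branch
  \<open>g\<close>, and a density. They agree on open sets, which are closed under intersection and
  generate the Borel sets, and the first has finite mass.\<close>

lemma conformal_on_Borel_subsets:
  fixes \<mu> :: "complex measure" and f :: "complex \<Rightarrow> complex" and h :: "complex \<Rightarrow> real"
  assumes \<mu>: "prob_space \<mu>" "sets \<mu> = sets borel"
    and D: "open D" "continuous_on D f" "inj_on f D" "open (f ` D)" and h: "continuous_on D h"
    and g: "continuous_on (f ` D) g" "\<And>z. z \<in> D \<Longrightarrow> g (f z) = z"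
    and eq: "\<And>U. open U \<Longrightarrow> U \<subseteq> D \<Longrightarrow> emeasure \<mu> (f ` U) = (\<integral>\<^sup>+z. ennreal (h z) * indicator U z \<partial>\<mu>)"
    and A: "A \<in> sets borel" "A \<subseteq> D"
  shows "f ` A \<in> sets borel" "emeasure \<mu> (f ` A) = (\<integral>\<^sup>+z. ennreal (h z) * indicator A z \<partial>\<mu>)"
proof -
  interpret \<mu>: prob_space \<mu> by (rule \<mu>)
  have sp: "space \<mu> = UNIV" using sets_eq_imp_space_eq[OF \<mu>(2)] by simp
  have gm: "g \<in> borel_measurable (restrict_space borel (f ` D))"
    by (rule borel_measurable_continuous_on_restrict[OF g(1)])
  have img: "f ` (B \<inter> D) = g -` B \<inter> f ` D" for B using g(2) by force
  have Bm: "f ` (B \<inter> D) \<in> sets borel" if "B \<in> sets borel" for B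
  proof -
    have "g -` B \<inter> space (restrict_space borel (f ` D)) \<in> sets (restrict_space borel (f ` D))"
      by (rule measurable_sets[OF gm that])
    then have "g -` B \<inter> f ` D \<in> sets (restrict_space borel (f ` D))" by (simp add: space_restrict_space)
    then show ?thesis unfolding img using D(4) by (subst (asm) sets_restrict_space_iff) auto
  qed
  have AD: "A \<inter> D = A" using A(2) by blast
  show "f ` A \<in> sets borel" using Bm[OF A(1)] AD by simp
  let ?R = "restrict_space \<mu> (f ` D)"
  have gR: "g \<in> borel_measurable ?R"
    using gm by (subst measurable_cong_sets[OF sets_restrict_space_cong[OF \<mu>(2)] refl])
  define N1 where "N1 = distr ?R borel g"
  have N1: "emeasure N1 B = emeasure \<mu> (f ` (B \<inter> D))" if "B \<in> sets borel" for B
  proof -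
    have "emeasure N1 B = emeasure ?R (g -` B \<inter> space ?R)" unfolding N1_def by (rule emeasure_distr[OF gR that])
    also have "g -` B \<inter> space ?R = f ` (B \<inter> D)" unfolding img by (simp add: space_restrict_space sp)
    also have "emeasure ?R (f ` (B \<inter> D)) = emeasure \<mu> (f ` (B \<inter> D))"
      using D(4) by (intro emeasure_restrict_space) (auto simp: \<mu>(2) sp)
    finally show ?thesis .
  qed
  have hm: "(\<lambda>z. indicator D z *\<^sub>R h z) \<in> borel_measurable borel"
    using D(1) h by (intro borel_measurable_continuous_on_indicator) auto
  \<comment> \<open>The density is cut off outside \<open>D\<close>, since \<open>h\<close> is known
    to be continuous only there.\<close>
  define k where "k z = ennreal (indicator D z *\<^sub>R h z)" for z
  have km: "k \<in> borel_measurable \<mu>"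
    unfolding k_def using hm by (simp add: measurable_cong_sets[OF \<mu>(2) refl])
  define N2 where "N2 = density \<mu> k"
  have N2: "emeasure N2 B = (\<integral>\<^sup>+z. ennreal (h z) * indicator (B \<inter> D) z \<partial>\<mu>)" if "B \<in> sets borel" for B
  proof -
    have "emeasure N2 B = (\<integral>\<^sup>+z. k z * indicator B z \<partial>\<mu>)"
      unfolding N2_def by (rule emeasure_density[OF km]) (simp add: \<mu>(2) that)
    also have "\<dots> = (\<integral>\<^sup>+z. ennreal (h z) * indicator (B \<inter> D) z \<partial>\<mu>)"
      by (intro nn_integral_cong) (auto simp: k_def split: split_indicator)
    finally show ?thesis .
  qed
  have "N1 = N2"
  proof (rule measure_eqI_generator_eq[where \<Omega> = UNIV and E = "{S. open S}" and A = "\<lambda>_. UNIV"])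
    show "Int_stable {S::complex set. open S}" by (auto simp: Int_stable_def)
    show "sets N1 = sigma_sets UNIV {S. open S}" unfolding N1_def by (simp add: borel_def)
    show "sets N2 = sigma_sets UNIV {S. open S}" unfolding N2_def by (simp add: \<mu>(2)) (simp add: borel_def)
    show "emeasure N1 X = emeasure N2 X" if "X \<in> {S. open S}" for X
      using that D(1) eq[of "X \<inter> D"] by (simp add: N1 N2 open_Int)
    show "emeasure N1 UNIV \<noteq> \<infinity>" for i :: nat
      by (subst N1) (auto simp: \<mu>.emeasure_finite)
  qed auto
  then have "emeasure N1 A = emeasure N2 A" by simp
  then show "emeasure \<mu> (f ` A) = (\<integral>\<^sup>+z. ennreal (h z) * indicator A z \<partial>\<mu>)"
    using N1[OF A(1)] N2[OF A(1)] AD by simp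
qed

lemma eigenmeasure_conformal_disc:
  fixes \<mu> :: "complex measure" and f :: "complex \<Rightarrow> complex"
  assumes f: "transcendental_meromorphic f" and F0: "0 \<in> fatou_set f"
    and rg: "rapid_derivative_growth f \<alpha>1 \<alpha>2"
    and \<mu>: "prob_space \<mu>" "sets \<mu> = sets borel"
    and eig: "eigenmeasure f \<alpha>2 t p \<mu>"
    and z0: "z0 \<in> julia_set f" "\<not> is_pole f z0"
  shows "\<exists>D. open D \<and> z0 \<in> D \<and> (\<forall>A\<in>sets borel. A \<subseteq> D \<longrightarrow> f ` A \<in> sets borel \<and>
     emeasure \<mu> (f ` A) = (\<integral>\<^sup>+z. ennreal (exp p * sigma_deriv f \<alpha>2 z powr t) * indicator A z \<partial>\<mu>))"
proof -
  obtain e where e: "e > 0" "ball z0 e \<subseteq> {z. \<not> is_pole f z}" "inj_on f (ball z0 e)"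
    and sd: "\<And>z. z \<in> ball z0 e \<Longrightarrow> sigma_deriv f \<alpha>2 z > 0" "continuous_on (ball z0 e) (sigma_deriv f \<alpha>2)"
    using julia_injective_ball[OF f F0 rg z0] by blast
  \<comment> \<open>Half the radius leaves room for cutting off test functions inside the disc of
    injectivity.\<close>
  let ?D = "ball z0 (e / 2)"
  have sub: "?D \<subseteq> ball z0 e" using e(1) by auto
  have hol: "f holomorphic_on ?D"
    using holomorphic_on_nonpoles[OF transcendental_nicely_meromorphic[OF f]] by (rule holomorphic_on_subset) (use sub e(2) in blast)
  have inj: "inj_on f ?D" by (rule inj_on_subset[OF e(3) sub])
  obtain g where g: "g holomorphic_on f ` ?D" "\<And>z. z \<in> ?D \<Longrightarrow> g (f z) = z"
    using holomorphic_has_inverse[OF hol open_ball inj] by metis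
  have ofD: "open (f ` ?D)" using sub e(2) by (intro transcendental_open_map[OF f]) auto
  have cont: "continuous_on ?D (\<lambda>z. exp p * sigma_deriv f \<alpha>2 z powr t)"
    using sd(1) sub by (intro continuous_on_mult continuous_on_powr continuous_on_const continuous_on_subset[OF sd(2) sub])
      (metis less_irrefl subsetD)
  have open_eq: "emeasure \<mu> (f ` U) = (\<integral>\<^sup>+z. ennreal (exp p * sigma_deriv f \<alpha>2 z powr t) * indicator U z \<partial>\<mu>)"
    if "open U" "U \<subseteq> ?D" for U
    by (rule eigenmeasure_conformal_open[OF f \<mu> eig e sd that])
  have "f ` A \<in> sets borel \<and> emeasure \<mu> (f ` A) = (\<integral>\<^sup>+z. ennreal (exp p * sigma_deriv f \<alpha>2 z powr t) * indicator A z \<partial>\<mu>)"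
    if "A \<in> sets borel" "A \<subseteq> ?D" for A
    using conformal_on_Borel_subsets[OF \<mu> open_ball holomorphic_on_imp_continuous_on[OF hol] inj ofD cont
        holomorphic_on_imp_continuous_on[OF g(1)] g(2) open_eq that] by blast
  then show ?thesis using e(1) by (intro exI[of _ ?D]) auto
qed

lemma borel_measurable_sigma_deriv_nonpoles:
  assumes f: "transcendental_meromorphic f"
  shows "(\<lambda>z. indicator {z. \<not> is_pole f z} z * sigma_deriv f \<alpha>2 z) \<in> borel_measurable borel"
proof -
  note nm = transcendental_nicely_meromorphic[OF f]
  note hol = holomorphic_on_nonpoles[OF nm] and op = open_nonpoles[OF nm]
  let ?S = "{z. \<not> is_pole f z}"
  have 1: "(\<lambda>z. indicator ?S z *\<^sub>R deriv f z) \<in> borel_measurable borel"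
    using op by (intro borel_measurable_continuous_on_indicator holomorphic_on_imp_continuous_on holomorphic_deriv[OF hol op]) auto
  have 2: "(\<lambda>z. indicator ?S z *\<^sub>R f z) \<in> borel_measurable borel"
    using op by (intro borel_measurable_continuous_on_indicator holomorphic_on_imp_continuous_on hol) auto
  have "(\<lambda>z. norm (indicator ?S z *\<^sub>R deriv f z) * norm z powr \<alpha>2 * norm (indicator ?S z *\<^sub>R f z) powr (- \<alpha>2))
      \<in> borel_measurable borel"
    using 1 2 by measurable
  also have "(\<lambda>z. norm (indicator ?S z *\<^sub>R deriv f z) * norm z powr \<alpha>2 * norm (indicator ?S z *\<^sub>R f z) powr (- \<alpha>2))
      = (\<lambda>z. indicator ?S z * sigma_deriv f \<alpha>2 z)"
    by (rule ext) (auto simp: sigma_deriv_def split: split_indicator)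
  finally show ?thesis .
qed

text \<open>Countably many good open sets cover \<open>A\<close>, by the Lindelof property. The
  pieces of \<open>A\<close> are made disjoint, injectivity on \<open>A\<close> keeps their images
  disjoint, and both sides add up.\<close>

lemma eigenmeasure_conformal:
  fixes \<mu> :: "complex measure" and f :: "complex \<Rightarrow> complex"
  assumes f: "transcendental_meromorphic f" and F0: "0 \<in> fatou_set f"
    and rg: "rapid_derivative_growth f \<alpha>1 \<alpha>2"
    and \<mu>: "prob_space \<mu>" "sets \<mu> = sets borel"
    and eig: "eigenmeasure f \<alpha>2 t p \<mu>"
    and A: "A \<in> sets borel" "A \<subseteq> julia_set f" "\<And>z. z \<in> A \<Longrightarrow> \<not> is_pole f z" "inj_on f A"
  shows "f ` A \<in> sets borel"
    "emeasure \<mu> (f ` A) = (\<integral>\<^sup>+z. ennreal (exp p * sigma_deriv f \<alpha>2 z powr t) * indicator A z \<partial>\<mu>)"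
proof -
  let ?h = "\<lambda>z. ennreal (exp p * sigma_deriv f \<alpha>2 z powr t)"
  define good where "good D \<longleftrightarrow> open D \<and> (\<forall>B\<in>sets borel. B \<subseteq> D \<longrightarrow> f ` B \<in> sets borel \<and>
     emeasure \<mu> (f ` B) = (\<integral>\<^sup>+z. ?h z * indicator B z \<partial>\<mu>))" for D
  have gD: "f ` B \<in> sets borel" "emeasure \<mu> (f ` B) = (\<integral>\<^sup>+z. ?h z * indicator B z \<partial>\<mu>)"
    if "good D" "B \<in> sets borel" "B \<subseteq> D" for B D using that unfolding good_def by blast+
  have g0: "good {}" by (auto simp: good_def)
  have cover: "\<exists>D. good D \<and> z \<in> D" if z: "z \<in> A" for z
  proof -
    have "z \<in> julia_set f" using z A(2) by blast
    from eigenmeasure_conformal_disc[OF f F0 rg \<mu> eig this A(3)[OF z]]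
    show ?thesis unfolding good_def by blast
  qed
  obtain F where F: "F \<subseteq> Collect good" "countable F" "\<Union>F = \<Union>(Collect good)"
    using Lindelof[of "Collect good"] unfolding good_def by auto
  \<comment> \<open>The empty set is inserted so that the enumerated family is nonempty.\<close>
  define D where "D i = from_nat_into (insert {} F) i" for i
  have rD: "range D = insert {} F" unfolding D_def using F(2) by (intro range_from_nat_into) auto
  have Dgood: "good (D i)" for i
  proof -
    have "D i \<in> insert {} F" unfolding rD[symmetric] by (rule rangeI)
    moreover have "insert {} F \<subseteq> Collect good" using F(1) g0 by simp
    ultimately show ?thesis by (metis mem_Collect_eq subsetD)
  qed
  have AD: "A \<subseteq> (\<Union>i. D i)"
  proof
    fix z assume "z \<in> A"
    then have "z \<in> \<Union>F" unfolding F(3) using cover by blast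
    then show "z \<in> (\<Union>i. D i)" using rD by blast
  qed
  define E where "E i = A \<inter> disjointed D i" for i
  have Dm: "range D \<subseteq> sets borel" using Dgood by (auto simp: good_def)
  have Em: "E i \<in> sets borel" for i
    unfolding E_def using A(1) sets.range_disjointed_sets[OF Dm] by blast
  have ED: "E i \<subseteq> D i" for i unfolding E_def using disjointed_subset by fastforce
  have disj: "disjoint_family E" unfolding E_def using disjoint_family_disjointed[of D]
    by (auto simp: disjoint_family_on_def)
  have EU: "(\<Union>i. E i) = A" unfolding E_def using AD UN_disjointed_eq[of D] by auto
  have fE: "f ` E i \<in> sets borel" "emeasure \<mu> (f ` E i) = (\<integral>\<^sup>+z. ?h z * indicator (E i) z \<partial>\<mu>)" for i
    using gD[OF Dgood Em ED] by blast+
  have fA: "f ` A = (\<Union>i. f ` E i)" using EU by blast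
  show "f ` A \<in> sets borel" unfolding fA using fE by (intro sets.countable_UN) auto
  have fdisj: "disjoint_family (\<lambda>i. f ` E i)"
  proof (unfold disjoint_family_on_def, intro ballI impI)
    fix i j :: nat assume "i \<noteq> j"
    then have "E i \<inter> E j = {}" using disj by (auto simp: disjoint_family_on_def)
    moreover have "f ` E i \<inter> f ` E j = f ` (E i \<inter> E j)"
      by (rule inj_on_image_Int[OF A(4), symmetric]) (auto simp: E_def)
    ultimately show "f ` E i \<inter> f ` E j = {}" by simp
  qed
  let ?S = "{z. \<not> is_pole f z}"
  define k where "k z = ennreal (exp p * (indicator ?S z * sigma_deriv f \<alpha>2 z) powr t)" for z
  have km: "k \<in> borel_measurable \<mu>"
  proof -
    have "k \<in> borel_measurable borel"
      unfolding k_def using borel_measurable_sigma_deriv_nonpoles[OF f, of \<alpha>2] by measurable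
    then show ?thesis by (simp add: measurable_cong_sets[OF \<mu>(2) refl])
  qed
  have N: "emeasure (density \<mu> k) B = (\<integral>\<^sup>+z. ?h z * indicator B z \<partial>\<mu>)" if "B \<in> sets borel" "B \<subseteq> A" for B
  proof -
    have "emeasure (density \<mu> k) B = (\<integral>\<^sup>+z. k z * indicator B z \<partial>\<mu>)"
      by (rule emeasure_density[OF km]) (simp add: \<mu>(2) that)
    also have "\<dots> = (\<integral>\<^sup>+z. ?h z * indicator B z \<partial>\<mu>)"
      using that(2) A(3) by (intro nn_integral_cong) (auto simp: k_def split: split_indicator)
    finally show ?thesis .
  qed
  have EA: "E i \<subseteq> A" for i by (auto simp: E_def)
  have "emeasure \<mu> (f ` A) = (\<Sum>i. emeasure \<mu> (f ` E i))"
    unfolding fA using fE(1) by (intro suminf_emeasure[symmetric] fdisj) (auto simp: \<mu>(2))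
  also have "\<dots> = (\<Sum>i. emeasure (density \<mu> k) (E i))"
    by (simp only: fE(2) N[OF Em EA])
  also have "\<dots> = emeasure (density \<mu> k) (\<Union>i. E i)"
    using Em by (intro suminf_emeasure disj) (auto simp: \<mu>(2))
  also have "\<dots> = (\<integral>\<^sup>+z. ?h z * indicator A z \<partial>\<mu>)" unfolding EU by (rule N[OF A(1) order_refl])
  finally show "emeasure \<mu> (f ` A) = (\<integral>\<^sup>+z. ?h z * indicator A z \<partial>\<mu>)" .
qed

text \<open>No image under \<open>f\<close> of a set without poles contains \<open>y\<close>, so the
  point mass there vanishes on every image, as a zero conformal factor demands.\<close>

lemma conformal_dirac_omitted_value:
  assumes y: "y \<in> julia_set f" and om: "\<And>z. \<not> is_pole f z \<Longrightarrow> f z \<noteq> y"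
  shows "\<exists>m. borel_prob_on (julia_set f) m \<and> conformal_measure f (\<lambda>_. 0) m"
proof -
  let ?R = "restrict_space borel (julia_set f)"
  define m where "m = return ?R y"
  have "borel_prob_on (julia_set f) m"
    unfolding borel_prob_on_def m_def using y
    by (auto intro!: prob_space_return simp: space_restrict_space)
  moreover have "conformal_measure f (\<lambda>_. 0) m"
    unfolding conformal_measure_def
  proof (intro ballI impI)
    fix A assume "A \<in> sets m" and A: "(\<forall>z\<in>A. \<not> is_pole f z) \<and> inj_on f A"
    have "y \<notin> f ` A" using A om by blast
    then have "emeasure m (f ` A) = 0"
      by (cases "f ` A \<in> sets m") (auto simp: m_def emeasure_notin_sets)
    then show "emeasure m (f ` A) = (\<integral>\<^sup>+z\<in>A. 0 \<partial>m)" by simp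
  qed
  ultimately show ?thesis by blast
qed

theorem theorem5p1:
  fixes f :: "complex \<Rightarrow> complex" and \<rho> \<alpha>1 \<alpha>2 \<alpha> t :: real and x :: complex
  assumes "transcendental_meromorphic f"
    and "order_of_growth f = ereal \<rho>"
    and "fatou_set f \<noteq> {}"
    and "0 \<in> fatou_set f"
    and "rapid_derivative_growth f \<alpha>1 \<alpha>2"
    and "\<alpha> = \<alpha>1 + \<alpha>2"
    and "x \<in> julia_set f"
    and "t > \<rho> / \<alpha>"
  shows "\<exists>m. borel_prob_on (julia_set f) m \<and>
           conformal_measure f
             (\<lambda>z. ext_exp (pressure f \<alpha>2 t x) * ennreal (sigma_deriv f \<alpha>2 z powr t)) m"
proof -
  note f = assms(1) and \<rho> = assms(2) and F0 = assms(4) and rg = assms(5) and x = assms(7)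
  let ?J = "julia_set f" and ?L = "ruelle_op (inv_weight f \<alpha>2 t) f"
  have t: "t > \<rho> / (\<alpha>1 + \<alpha>2)" using assms(6,8) by simp
  have \<alpha>: "\<alpha>1 + \<alpha>2 > 0" using rg by (auto simp: rapid_derivative_growth_def)
  have "\<rho> \<ge> 0" using order_of_growth_nonneg[OF f fatou_set_nonpole[OF F0]] \<rho> by simp
  then have t0: "t > 0" using t \<alpha> by (meson divide_nonneg_pos le_less_trans)
  define a where "a n = (?L ^^ n) (\<lambda>_. 1) x" for n
  have P: "pressure f \<alpha>2 t x = limsup (\<lambda>n. ereal (1 / real n) * ext_ln (a n))"
    unfolding pressure_def a_def transfer_op_eq_ruelle_op[OF f] ..
  obtain \<delta> where \<delta>: "\<delta> > 0" "\<And>z. z \<in> ?J \<Longrightarrow> norm z \<ge> \<delta>"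
    using julia_set_away_from_0[OF F0] by blast
  obtain C \<gamma> where C: "C > 0" "\<gamma> > 0" and tail: "\<And>w R. w \<in> ?J \<Longrightarrow> R \<ge> \<delta> \<Longrightarrow>
       ?L (indicator {z. R \<le> norm z}) w \<le> ennreal (C * R powr (- \<gamma>))"
    using ruelle_op_tail_bound[OF f F0 \<rho> rg t \<delta>(1)] by blast
  define B where "B = C * \<delta> powr (- \<gamma>)"
  have B: "B > 0" using C \<delta>(1) by (simp add: B_def)
  \<comment> \<open>No Julia point has modulus below \<delta>, so the tail beyond \<delta> is the
    whole sum.\<close>
  have LB: "?L (\<lambda>_. 1) w \<le> ennreal B" if w: "w \<in> ?J" for w
  proof -
    have "?L (\<lambda>_. 1) w \<le> ?L (indicator {z. \<delta> \<le> norm z}) w"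
      by (rule ruelle_op_mono_julia[OF f w]) (use \<delta>(2) in simp)
    also have "\<dots> \<le> ennreal B" unfolding B_def by (rule tail[OF w order_refl])
    finally show ?thesis .
  qed
  have aB: "a n \<le> ennreal (B ^ n)" for n
    unfolding a_def by (rule ruelle_op_funpow_upper[OF f LB B x])
  have afin: "a n < \<infinity>" for n using le_less_trans[OF aB[of n], of \<infinity>] by simp
  have Pub: "pressure f \<alpha>2 t x \<le> ereal (ln B)" unfolding P
  proof (rule Limsup_bounded)
    show "\<forall>\<^sub>F n in sequentially. ereal (1 / real n) * ext_ln (a n) \<le> ereal (ln B)"
      using eventually_gt_at_top[of 0]
    proof eventually_elim
      case (elim n)
      have "exp (ln B * real n) = B ^ n" using B by (simp add: exp_of_nat2_mult)
      then show ?case using scaled_ext_ln_le_iff[OF elim, of "a n" "ln B"] aB[of n] by simp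
    qed
  qed
  show ?thesis
  proof (cases "pressure f \<alpha>2 t x")
    case PInf
    then show ?thesis using Pub by simp
  next
    case MInf
    \<comment> \<open>If every Julia point had a preimage, the bound \<open>c ^ n \<le> a n\<close>
      would force a pressure of at least \<open>ln c\<close>.\<close>
    have "\<exists>y\<in>?J. \<forall>z. \<not> is_pole f z \<longrightarrow> f z \<noteq> y"
    proof (rule ccontr)
      assume "\<not> ?thesis"
      then have surj: "\<And>w. w \<in> ?J \<Longrightarrow> \<exists>z. \<not> is_pole f z \<and> f z = w" by blast
      have q: "order_of_growth f < ereal (\<rho> + 1)" using \<rho> by simp
      obtain c where c: "c > 0" "\<And>n. ennreal (c ^ n) \<le> a n"
        using ruelle_op_funpow_lower[OF f F0 q rg t0 surj x] unfolding a_def by blast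
      have "limsup (\<lambda>n. ereal (1 / real n) * ext_ln (a n)) < ereal (ln c - 1)"
        using MInf unfolding P by simp
      from Limsup_lessD[OF this] obtain N where
        N: "\<And>n. n \<ge> N \<Longrightarrow> ereal (1 / real n) * ext_ln (a n) < ereal (ln c - 1)"
        by (auto simp: eventually_sequentially)
      let ?n = "Suc N"
      have "a ?n \<le> ennreal (exp ((ln c - 1) * real ?n))"
        using N[of ?n] scaled_ext_ln_le_iff[of ?n "a ?n" "ln c - 1"] by (simp add: less_imp_le del: of_nat_Suc)
      then have "ennreal (c ^ ?n) \<le> ennreal (exp ((ln c - 1) * real ?n))" using c(2)[of ?n] by (rule order_trans[rotated])
      then have "c ^ ?n \<le> exp ((ln c - 1) * real ?n)" by (subst (asm) ennreal_le_iff) auto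
      also have "\<dots> < exp (ln c * real ?n)" by simp
      also have "\<dots> = c ^ ?n" using c(1) by (simp add: exp_of_nat2_mult del: of_nat_Suc power_Suc)
      finally show False by simp
    qed
    then obtain y where y: "y \<in> ?J" "\<And>z. \<not> is_pole f z \<Longrightarrow> f z \<noteq> y" by blast
    have "(\<lambda>z. ext_exp (pressure f \<alpha>2 t x) * ennreal (sigma_deriv f \<alpha>2 z powr t)) = (\<lambda>_. 0)"
      by (simp add: MInf ext_exp_def)
    then show ?thesis using conformal_dirac_omitted_value[OF y] by simp
  next
    case (real p)
    have lim: "limsup (\<lambda>n. ereal (1 / real n) * ext_ln (a n)) = ereal p" using real P by simp
    have up: "\<exists>C>0. \<forall>n. (?L ^^ n) (\<lambda>_. 1) x \<le> ennreal (C * exp ((p + s) * real n))" if "s > 0" for s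
      using limsup_scaled_ext_ln(1)[OF lim afin that] unfolding a_def .
    have lo: "\<exists>\<^sub>\<infinity>n. ennreal (exp ((p - s) * real n)) \<le> (?L ^^ n) (\<lambda>_. 1) x" if "s > 0" for s
      using limsup_scaled_ext_ln(2)[OF lim afin that] unfolding a_def .
    obtain \<mu> where \<mu>: "prob_space \<mu>" "sets \<mu> = sets borel" "AE z in \<mu>. z \<in> ?J"
      and eig: "eigenmeasure f \<alpha>2 t p \<mu>"
      using exists_eigenmeasure[OF f x C(2) \<delta>(1) C(1) tail up lo] by blast
    interpret \<mu>: prob_space \<mu> by (rule \<mu>)
    have sp: "space \<mu> = UNIV" using sets_eq_imp_space_eq[OF \<mu>(2)] by simp
    have Jm: "?J \<in> sets \<mu>" using closed_julia_set by (simp add: \<mu>(2))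
    have Jb: "?J \<in> sets borel" using closed_julia_set by simp
    \<comment> \<open>The eigenmeasure lives on the whole plane but is carried by the Julia set, so
      the restriction keeps its total mass.\<close>
    define m where "m = restrict_space \<mu> ?J"
    have "emeasure \<mu> ?J = 1" using \<mu>(3) Jm by (intro \<mu>.emeasure_eq_1_AE) auto
    then have "prob_space m" unfolding m_def using Jm by (intro prob_space_restrict_space) auto
    moreover have setsm: "sets m = sets (restrict_space borel ?J)"
      unfolding m_def by (rule sets_restrict_space_cong[OF \<mu>(2)])
    ultimately have "borel_prob_on ?J m" by (simp add: borel_prob_on_def)
    moreover have "conformal_measure f (\<lambda>z. ext_exp (pressure f \<alpha>2 t x) * ennreal (sigma_deriv f \<alpha>2 z powr t)) m"
      unfolding conformal_measure_def
    proof (intro ballI impI)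
      fix A assume "A \<in> sets m" and A: "(\<forall>z\<in>A. \<not> is_pole f z) \<and> inj_on f A"
      then have AJ: "A \<subseteq> ?J" "A \<in> sets borel"
        using Jb unfolding setsm by (auto simp: sets_restrict_space_iff)
      have cf: "emeasure \<mu> (f ` A) = (\<integral>\<^sup>+z. ennreal (exp p * sigma_deriv f \<alpha>2 z powr t) * indicator A z \<partial>\<mu>)"
        using A by (intro eigenmeasure_conformal(2)[OF f F0 rg \<mu>(1,2) eig AJ(2,1)]) auto
      have "f ` A \<subseteq> ?J" using julia_set_image_iff[OF f] A AJ(1) by blast
      then have "emeasure m (f ` A) = emeasure \<mu> (f ` A)"
        unfolding m_def using Jm by (intro emeasure_restrict_space) (auto simp: sp)
      also have "\<dots> = (\<integral>\<^sup>+z. (ext_exp (pressure f \<alpha>2 t x) * ennreal (sigma_deriv f \<alpha>2 z powr t) * indicator A z) * indicator ?J z \<partial>\<mu>)"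
        unfolding cf real using AJ(1)
        by (intro nn_integral_cong) (auto simp: ext_exp_def ennreal_mult split: split_indicator)
      also have "\<dots> = (\<integral>\<^sup>+z\<in>A. (ext_exp (pressure f \<alpha>2 t x) * ennreal (sigma_deriv f \<alpha>2 z powr t)) \<partial>m)"
        unfolding m_def using Jm by (intro nn_integral_restrict_space[symmetric]) (simp add: sp)
      finally show "emeasure m (f ` A) = (\<integral>\<^sup>+z\<in>A. (ext_exp (pressure f \<alpha>2 t x) * ennreal (sigma_deriv f \<alpha>2 z powr t)) \<partial>m)" .
    qed
    ultimately show ?thesis by blast
  qed
qed

end
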